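(* Let $H\in C^0(\mathbb R^2)$ be convex and superlinear, with $H(0)=\min_{\mathbb R^2}H=0$, and suppose that for every $c\in\mathbb R$ the level set $H^{-1}(c)$ does not contain any line segment. Then for each $\epsilon>0$ and each vector $e_8\in H^{-1}([1,2])$ there exists $\delta_*=\delta_*(H,\epsilon,e_8)>0$ such that for every $u\in AM_H(B(0,8))$ and every $0<\delta<\delta_*$, $$\max_{e\in\mathscr D u(0)}|e_8-e|\le\epsilon\qquad\text{whenever } e_8\in\mathscr D(u)\big(0;8;\tfrac{\delta}{8}\big).$$
   Context: Superlinear means $\lim_{|p|\to\infty}H(p)/|p|=\infty$. A line segment is a set $[a,b]$ with $a\neq b$. $B(x,r)$ is the open ball of centre $x$ and radius $r$ in $\mathbb R^2$. For a domain $\Omega\subset\mathbb R^2$, a function $u\in W^{1,\infty}_{\rm loc}(\Omega)$ is an absolute minimizer for $H$ in $\Omega$, written $u\in AM_H(\Omega)$, if $\operatorname{ess\,sup}_{V}H(Du)\le \operatorname{ess\,sup}_{V}H(Dv)$ for every open $V\Subset\Omega$ and every $v\in W^{1,\infty}_{\rm loc}(V)\cap C(\overline V)$ with $v=u$ on $\partial V$. $\mathscr D u(x)$ is the set of all $e\in\mathbb R^2$ for which there is a sequence of positive numbers $r_k\to0$ with $\lim_{k\to\infty}\sup_{y\in B(0,1)}\big|\frac{u(x+r_ky)-u(x)}{r_k}-e\cdot y\big|=0$. For $u\in C^0(\Omega)$, $\delta>0$ and a ball $B(x^0,r)\subset\Omega$, $\mathscr D(u)(x^0;r;\delta)$ is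 the set of all $e\in\mathbb R^2$ with $\sup_{x\in B(x^0,r)}|u(x)-u(x^0)-e\cdot(x-x^0)|\le\delta r$. *)

theory Defs
  imports "HOL-Analysis.Analysis" "HOL-Probability.Essential_Supremum"
begin

definition superlinear :: "('a::euclidean_space \<Rightarrow> real) \<Rightarrow> bool" where
  "superlinear H \<longleftrightarrow> filterlim (\<lambda>p. H p / norm p) at_top at_infinity"

definition has_line_segment :: "'a::euclidean_space set \<Rightarrow> bool" where
  "has_line_segment S \<longleftrightarrow> (\<exists>a b. a \<noteq> b \<and> closed_segment a b \<subseteq> S)"

text \<open>Smooth functions on the whole space: all iterated partial derivatives
  (along the standard basis) of totally differentiable functions exist and are continuous.\<close>

primrec Ck :: "nat \<Rightarrow> ('a::euclidean_space \<Rightarrow> real) \<Rightarrow> bool" where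
  "Ck 0 f \<longleftrightarrow> continuous_on UNIV f"
| "Ck (Suc k) f \<longleftrightarrow>
     (\<forall>x. f differentiable (at x)) \<and>
     (\<forall>i\<in>Basis. Ck k (\<lambda>x. frechet_derivative f (at x) i))"

definition test_functions :: "'a::euclidean_space set \<Rightarrow> ('a \<Rightarrow> real) set" where
  "test_functions \<Omega> =
     {\<phi>. (\<forall>k. Ck k \<phi>) \<and> compact (closure {x. \<phi> x \<noteq> 0}) \<and> closure {x. \<phi> x \<noteq> 0} \<subseteq> \<Omega>}"

definition L1_loc ::
  "'a::euclidean_space set \<Rightarrow> ('a \<Rightarrow> 'b::{banach, second_countable_topology}) set" where
  "L1_loc \<Omega> = {f. f \<in> borel_measurable (lebesgue_on \<Omega>) \<and>
                  (\<forall>K. compact K \<and> K \<subseteq> \<Omega> \<longrightarrow> integrable (lebesgue_on K) f)}"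

definition Linf_loc ::
  "'a::euclidean_space set \<Rightarrow> ('a \<Rightarrow> 'b::{banach, second_countable_topology}) set" where
  "Linf_loc \<Omega> = {f. f \<in> borel_measurable (lebesgue_on \<Omega>) \<and>
                    (\<forall>K. compact K \<and> K \<subseteq> \<Omega> \<longrightarrow>
                       (\<exists>C. AE x in lebesgue_on K. norm (f x) \<le> C))}"

definition has_weak_gradient ::
  "'a::euclidean_space set \<Rightarrow> ('a \<Rightarrow> real) \<Rightarrow> ('a \<Rightarrow> 'a) \<Rightarrow> bool" where
  "has_weak_gradient \<Omega> u g \<longleftrightarrow>
     u \<in> L1_loc \<Omega> \<and> g \<in> L1_loc \<Omega> \<and>
     (\<forall>\<phi>\<in>test_functions \<Omega>. \<forall>i\<in>Basis.
        integral\<^sup>L (lebesgue_on \<Omega>) (\<lambda>x. u x * frechet_derivative \<phi> (at x) i) =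
        - integral\<^sup>L (lebesgue_on \<Omega>) (\<lambda>x. (g x \<bullet> i) * \<phi> x))"

text \<open>The weak gradient on an open set is determined only up to null sets; any representative
  may be chosen, as it is used below only under an essential supremum.\<close>

definition weak_gradient ::
  "'a::euclidean_space set \<Rightarrow> ('a \<Rightarrow> real) \<Rightarrow> 'a \<Rightarrow> 'a" where
  "weak_gradient \<Omega> u = (SOME g. has_weak_gradient \<Omega> u g)"

definition W1inf_loc :: "'a::euclidean_space set \<Rightarrow> ('a \<Rightarrow> real) set" where
  "W1inf_loc \<Omega> = {u. u \<in> Linf_loc \<Omega> \<and> (\<exists>g. has_weak_gradient \<Omega> u g \<and> g \<in> Linf_loc \<Omega>)}"

text \<open>Classically, Sobolev functions are classes modulo null sets; in the definition
  of absolute minimizers \<open>u\<close> denotes the continuous representative, so that its boundary values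
  on \<open>\<partial>V\<close> make sense. Values of \<open>u\<close> outside \<open>\<Omega>\<close> and of \<open>v\<close> outside the closure of \<open>V\<close>
  are irrelevant.\<close>

definition AM :: "('a::euclidean_space \<Rightarrow> real) \<Rightarrow> 'a set \<Rightarrow> ('a \<Rightarrow> real) set" where
  "AM H \<Omega> = {u. u \<in> W1inf_loc \<Omega> \<and> continuous_on \<Omega> u \<and>
     (\<forall>V v. open V \<and> compact (closure V) \<and> closure V \<subseteq> \<Omega> \<and>
            v \<in> W1inf_loc V \<and> continuous_on (closure V) v \<and>
            (\<forall>x\<in>frontier V. v x = u x) \<longrightarrow>
        esssup (lebesgue_on V) (\<lambda>x. ereal (H (weak_gradient \<Omega> u x)))
        \<le> esssup (lebesgue_on V) (\<lambda>x. ereal (H (weak_gradient V v x))))}"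

text \<open>Suprema are taken in the extended reals: a function that is continuous on an open ball
  may be unbounded there, and the real-valued supremum of an unbounded set is unspecified.
  In \<open>blowup_slopes\<close> only the values of \<open>u\<close> near \<open>x\<close> matter, since \<open>r\<^sub>k \<rightarrow> 0\<close>.\<close>

definition blowup_slopes :: "('a::euclidean_space \<Rightarrow> real) \<Rightarrow> 'a \<Rightarrow> 'a set" where
  "blowup_slopes u x = {e. \<exists>r :: nat \<Rightarrow> real. (\<forall>k. r k > 0) \<and> r \<longlonglongrightarrow> 0 \<and>
     (\<lambda>k. SUP y\<in>ball 0 1. ereal \<bar>(u (x + r k *\<^sub>R y) - u x) / r k - e \<bullet> y\<bar>) \<longlonglongrightarrow> 0}"

definition approx_slopes ::
  "('a::euclidean_space \<Rightarrow> real) \<Rightarrow> 'a \<Rightarrow> real \<Rightarrow> real \<Rightarrow> 'a set" where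
  "approx_slopes u x0 r \<delta> =
     {e. (SUP x\<in>ball x0 r. ereal \<bar>u x - u x0 - e \<bullet> (x - x0)\<bar>) \<le> ereal (\<delta> * r)}"

end

theory Submission
  imports Defs "HOL-Complex_Analysis.Complex_Analysis"
begin

text \<open>
  For \<open>k \<ge> 0\<close> let \<open>C k\<close> be the support function of the sublevel set \<open>{H \<le> k}\<close>; it is
  positively homogeneous, solves \<open>H (D C k) = k\<close> away from the origin, and is the largest increment
  that a function with \<open>H (D v) \<le> k\<close> can have in a given direction. Strict convexity of the sublevel
  sets (no level set contains a segment) makes it continuously differentiable away from the origin.

  Let \<open>u\<close> be an absolute minimizer on \<open>B(0,8)\<close>. Testing minimality against cones
  \<open>c + C k (x - z)\<close> shows that \<open>u\<close> lies below every such cone on a set \<open>V\<close> with \<open>z \<notin> V\<close> as soon as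
  it does so on the boundary of \<open>V\<close>; the same holds for \<open>-u\<close> and the reflected Hamiltonian
  \<open>p \<mapsto> H (-p)\<close> (\<open>AM_imp_cone_comparison\<close>). Only these two comparison principles are used from then
  on.

  Let \<open>\<bar>u x - u 0 - e \<bullet> x\<bar> \<le> \<delta>\<close> on \<open>B(0,8)\<close> and suppose that some blow-up slope \<open>b\<close> at \<open>0\<close> has
  \<open>\<bar>b - e\<bar> > \<epsilon>\<close>. Consider the slopes \<open>f\<close> on the circle \<open>\<bar>e - f\<bar> = \<epsilon>\<close>. The crucial fact
  (\<open>far_connection\<close>) is that, for \<open>\<delta>\<close> small depending on \<open>H\<close>, \<open>\<epsilon>\<close> and \<open>e\<close> only, every component of
  \<open>{u x - u 0 - f \<bullet> x > 0}\<close> that meets \<open>B(0,1)\<close> reaches the half \<open>{(e - f) \<bullet> x > \<delta>}\<close> of the ball, on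
  which the inequality is evident; symmetrically, components of \<open>{u x - u 0 - f \<bullet> x < 0}\<close> reach the
  opposite half. Otherwise such a component is confined to the thin strip
  \<open>{\<bar>(e - f) \<bullet> x\<bar> \<le> \<delta>}\<close>, and there are two cases. If \<open>H\<close> is smaller at the midpoint of \<open>e\<close> and
  \<open>f\<close> than at \<open>f\<close>, cones of level \<open>H f\<close> dominate \<open>u\<close> inside the component, which can therefore be
  followed backwards along a normal of \<open>{H \<le> H f}\<close> until it leaves the strip
  (\<open>component_far_strict\<close>). If \<open>H f\<close> lies well below \<open>H e\<close>, then \<open>u\<close> has steep points next to the
  strip; from such a point a chain of steepest ascent crosses the strip within a short distance, and it
  has to meet the component, which extends to the boundary of the ball along the strip
  (\<open>component_far_below\<close>). By strict quasiconvexity of \<open>H\<close> one of the two cases always occurs, with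
  constants uniform in \<open>f\<close>.

  Since \<open>b\<close> lies outside the circle, there is a point \<open>p\<close> close to \<open>0\<close> with
  \<open>u p - u 0 - f \<bullet> p > 0 > u (-p) - u 0 + f \<bullet> p\<close> for all \<open>f\<close> on the circle at once. So for every \<open>f\<close>
  the fixed point \<open>p\<close> is joined inside the positive set to a far point in direction \<open>e - f\<close>, and \<open>-p\<close> is
  joined to infinity in the complement of the positive set. Letting \<open>f\<close> run once around the circle, the
  winding number about \<open>-p\<close> of the first path increases by one, although it depends only on \<open>f\<close>: a
  contradiction (\<open>no_rotating_path_family\<close>, \<open>slope_near_of_far_connection\<close>). Hence all blow-up slopes
  lie within \<open>\<epsilon>\<close> of \<open>e\<close>.

  The maximum in the conclusion is attained because the blow-up slopes form a nonempty compact set.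
  Nonemptiness (\<open>blowup_slopes_nonempty\<close>) comes from the smallest level \<open>k0\<close> of cones that bound \<open>u\<close>
  near \<open>0\<close>: at small scales the bound is almost attained both upwards and downwards, and
  differentiability of \<open>C k0\<close> then pins \<open>u\<close> between two nearly equal linear functions.
\<close>

section \<open>Smooth bump functions\<close>

lemma frechet_derivative_eqI: "(f has_derivative f') (at x) \<Longrightarrow> frechet_derivative f (at x) = f'"
  using frechet_derivative_at by metis

lemma Ck_imp_continuous: "Ck k f \<Longrightarrow> continuous_on UNIV f"
  by (cases k) (auto intro!: continuous_at_imp_continuous_on differentiable_imp_continuous_within)

lemma Ck_SucD: "Ck (Suc k) f \<Longrightarrow> Ck k f"
proof (induction k arbitrary: f)
  case 0
  then show ?case using Ck_imp_continuous[of "Suc 0" f] by simp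
next
  case (Suc k)
  then show ?case by (metis Ck.simps(2))
qed

lemma Ck_const: "Ck k (\<lambda>x. c)"
proof (induction k arbitrary: c)
  case (Suc k)
  have "frechet_derivative (\<lambda>x. c) (at x) = (\<lambda>h. 0)" for x :: 'a
    by (rule frechet_derivative_eqI) simp
  then show ?case using Suc by simp
qed simp

lemma Ck_add: "Ck k f \<Longrightarrow> Ck k g \<Longrightarrow> Ck k (\<lambda>x. f x + g x)"
proof (induction k arbitrary: f g)
  case 0 then show ?case by (simp add: continuous_on_add)
next
  case (Suc k)
  have "frechet_derivative (\<lambda>x. f x + g x) (at x) i
      = frechet_derivative f (at x) i + frechet_derivative g (at x) i" for x i
    using Suc.prems
    by (subst frechet_derivative_eqI[OF has_derivative_add[OF frechet_derivative_works[THEN iffD1] frechet_derivative_works[THEN iffD1]]]) auto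
  then show ?case using Suc by auto
qed

lemma Ck_mult: "Ck k f \<Longrightarrow> Ck k g \<Longrightarrow> Ck k (\<lambda>x. f x * g x)"
proof (induction k arbitrary: f g)
  case 0 then show ?case by (simp add: continuous_on_mult)
next
  case (Suc k)
  have "frechet_derivative (\<lambda>x. f x * g x) (at x) i
      = f x * frechet_derivative g (at x) i + frechet_derivative f (at x) i * g x" for x i
    using Suc.prems
    by (subst frechet_derivative_eqI[OF has_derivative_mult[OF frechet_derivative_works[THEN iffD1] frechet_derivative_works[THEN iffD1]]]) auto
  moreover have "Ck k f" "Ck k g" using Suc.prems Ck_SucD by auto
  ultimately show ?case using Suc by (auto intro!: Ck_add)
qed

lemma Ck_prod: "finite A \<Longrightarrow> (\<And>i. i \<in> A \<Longrightarrow> Ck k (f i)) \<Longrightarrow> Ck k (\<lambda>x. \<Prod>i\<in>A. f i x)"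
  by (induction A rule: finite_induct) (auto intro!: Ck_mult Ck_const)

text \<open>
  The factors \<open>1 / t ^ m\<close> are included because the derivative of \<open>flat m\<close> is then again a
  combination of such functions, so that smoothness is a plain induction.
\<close>

definition flat :: "nat \<Rightarrow> real \<Rightarrow> real" where
  "flat m t = (if t > 0 then exp (- 1 / t) / t ^ m else 0)"

lemma flat_tendsto_0: "((\<lambda>h. flat m h) \<longlongrightarrow> 0) (at 0)"
proof -
  have "((\<lambda>x::real. x ^ m / exp x) \<longlongrightarrow> 0) at_top"
    by (rule tendsto_power_div_exp_0)
  then have "((\<lambda>t::real. inverse t ^ m / exp (inverse t)) \<longlongrightarrow> 0) (at_right 0)"
    by (rule filterlim_compose[OF _ filterlim_inverse_at_top_right])
  then have "((\<lambda>h. flat m h) \<longlongrightarrow> 0) (at_right 0)"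
    by (rule Lim_transform_eventually)
       (auto simp: eventually_at_right_less flat_def exp_minus field_simps eventually_at_filter)
  moreover have "((\<lambda>h. flat m h) \<longlongrightarrow> 0) (at_left 0)"
    by (rule Lim_transform_eventually[OF tendsto_const])
       (auto simp: flat_def eventually_at_filter)
  ultimately show ?thesis by (simp add: filterlim_at_split)
qed

lemma flat_deriv:
  "(flat m has_field_derivative flat (m + 2) t - m * flat (m + 1) t) (at t)"
proof -
  consider "t > 0" | "t < 0" | "t = 0" by linarith
  then show ?thesis
  proof cases
    case 1
    have "((\<lambda>t. exp (- 1 / t) / t ^ m) has_field_derivative
          flat (m + 2) t - m * flat (m + 1) t) (at t)"
    proof -
      have P: "real m * t ^ (m - Suc 0) = real m * t ^ m / t" using 1 by (cases m) auto
      have "((\<lambda>t. exp (- 1 / t) / t ^ m) has_field_derivative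
          (exp (- 1 / t) * (1 / t\<^sup>2) * t ^ m - exp (- 1 / t) * (real m * t ^ (m - Suc 0))) / (t ^ m * t ^ m)) (at t)"
        using 1 by (auto intro!: derivative_eq_intros simp: power2_eq_square)
      moreover have "(exp (- 1 / t) * (1 / t\<^sup>2) * t ^ m - exp (- 1 / t) * (real m * t ^ (m - Suc 0))) / (t ^ m * t ^ m)
          = flat (m + 2) t - m * flat (m + 1) t"
        using 1 unfolding P by (simp add: flat_def field_simps power2_eq_square)
      ultimately show ?thesis by simp
    qed
    then show ?thesis
      by (rule has_field_derivative_transform_within_open[of _ _ _ "{0<..}"])
         (use 1 in \<open>auto simp: flat_def\<close>)
  next
    case 2
    have "((\<lambda>t. 0) has_field_derivative flat (m + 2) t - m * flat (m + 1) t) (at t)"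
      using 2 by (auto simp: flat_def)
    then show ?thesis
      by (rule has_field_derivative_transform_within_open[of _ _ _ "{..<0}"])
         (use 2 in \<open>auto simp: flat_def\<close>)
  next
    case 3
    have "(\<lambda>h. (flat m (0 + h) - flat m 0) / h) = flat (Suc m)"
      by (auto simp: flat_def fun_eq_iff field_simps)
    then have "(flat m has_field_derivative 0) (at 0)"
      unfolding DERIV_def using flat_tendsto_0[of "Suc m"] by simp
    then show ?thesis using 3 by (simp add: flat_def)
  qed
qed

lemma Ck_flat: "Ck k (\<lambda>x. flat m (a \<bullet> x + b))"
proof (induction k arbitrary: m)
  case 0
  have "continuous_on UNIV (flat m)"
    by (meson DERIV_isCont continuous_at_imp_continuous_on flat_deriv)
  then show ?case
    by (auto intro!: continuous_on_compose2[of UNIV "flat m"] continuous_intros)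
next
  case (Suc k)
  have D: "((\<lambda>x. flat m (a \<bullet> x + b)) has_derivative
      (\<lambda>h. (flat (m + 2) (a \<bullet> x + b) - m * flat (m + 1) (a \<bullet> x + b)) * (a \<bullet> h))) (at x)" for x
    by (rule has_derivative_compose[OF _ flat_deriv[unfolded has_field_derivative_def]])
       (auto intro!: derivative_eq_intros)
  have "frechet_derivative (\<lambda>x. flat m (a \<bullet> x + b)) (at x) i
      = (a \<bullet> i) * flat (m + 2) (a \<bullet> x + b) + (- (a \<bullet> i) * m) * flat (m + 1) (a \<bullet> x + b)" for x i
    unfolding frechet_derivative_eqI[OF D] by (simp add: algebra_simps)
  moreover have "Ck k (\<lambda>x. (a \<bullet> i) * flat (m + 2) (a \<bullet> x + b) + (- (a \<bullet> i) * m) * flat (m + 1) (a \<bullet> x + b))" for i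
    by (intro Ck_add Ck_mult[OF Ck_const] Suc)
  ultimately show ?case using D unfolding Ck.simps differentiable_def by (metis (no_types, lifting) ext)
qed

text \<open>
  A product of one-dimensional profiles is positive exactly on an open box, is bounded by \<open>1\<close>, and
  tends to the indicator function of the box as \<open>n\<close> grows.
\<close>

definition bump :: "real \<Rightarrow> 'a::euclidean_space \<Rightarrow> 'a \<Rightarrow> 'a \<Rightarrow> real" where
  "bump n a b x = (\<Prod>i\<in>Basis. flat 0 (n * ((x - a) \<bullet> i)) * flat 0 (n * ((b - x) \<bullet> i)))"

lemma Ck_bump: "Ck k (bump n a b)"
proof -
  have "bump n a b = (\<lambda>x. \<Prod>i\<in>Basis. flat 0 ((n *\<^sub>R i) \<bullet> x + (- n * (a \<bullet> i))) * flat 0 ((- n *\<^sub>R i) \<bullet> x + n * (b \<bullet> i)))"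
    by (auto simp: bump_def fun_eq_iff algebra_simps inner_commute)
  then show ?thesis by (simp only: Ck_prod Ck_mult Ck_flat finite_Basis)
qed

lemma bump_nonneg: "bump n a b x \<ge> 0"
  by (auto simp: bump_def flat_def intro!: prod_nonneg)

lemma bump_le_1: "bump n a b x \<le> 1"
  by (auto simp: bump_def flat_def intro!: prod_le_1 mult_le_one)

lemma bump_eq_0_iff: "n > 0 \<Longrightarrow> bump n a b x = 0 \<longleftrightarrow> x \<notin> box a b"
  by (auto simp: bump_def flat_def box_def zero_less_mult_iff algebra_simps)

lemma bump_test_function:
  assumes "n > 0" "cbox a b \<subseteq> \<Omega>"
  shows "bump n a b \<in> test_functions \<Omega>"
proof -
  have "{x. bump n a b x \<noteq> 0} = box a b" using assms by (auto simp: bump_eq_0_iff)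
  moreover have "closure (box a b) \<subseteq> cbox a b" by (intro closure_minimal box_subset_cbox closed_cbox)
  ultimately show ?thesis
    using assms Ck_bump by (auto simp: test_functions_def bounded_box compact_closure)
qed

lemma bump_tendsto_indicator: "(\<lambda>n. bump (real (Suc n)) a b x) \<longlonglongrightarrow> indicator (box a b) x"
proof (cases "x \<in> box a b")
  case False
  then show ?thesis using bump_eq_0_iff[of "real (Suc _)" a b x] by simp
next
  case True
  have *: "(\<lambda>n. flat 0 (real (Suc n) * t)) \<longlonglongrightarrow> 1" if "t > 0" for t
  proof -
    have "(\<lambda>n. exp (- (1 / t) * inverse (real (Suc n)))) \<longlonglongrightarrow> exp (- (1 / t) * 0)"
      by (intro tendsto_intros LIMSEQ_inverse_real_of_nat)
    then have "(\<lambda>n. exp (- (1 / t) * inverse (real (Suc n)))) \<longlonglongrightarrow> 1" by simp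
    then show ?thesis
      by (rule Lim_transform_eventually)
         (use that in \<open>auto simp: flat_def field_simps add_pos_nonneg intro!: always_eventually\<close>)
  qed
  have "(\<lambda>n. bump (real (Suc n)) a b x) \<longlonglongrightarrow> (\<Prod>i\<in>(Basis::'a set). 1 * 1)"
    unfolding bump_def using True
    by (intro tendsto_prod tendsto_mult *) (auto simp: box_def algebra_simps)
  then show ?thesis using True by simp
qed

section \<open>Weak gradients of continuously differentiable functions\<close>

lemma
  fixes f :: "'a::euclidean_space \<Rightarrow> real"
  assumes "continuous_on UNIV (\<lambda>x. if x \<in> V then f x else 0)"
    "compact K" "\<And>x. x \<in> V \<Longrightarrow> x \<notin> K \<Longrightarrow> f x = 0" "open V"
  shows lebesgue_on_integral_compact_support:
      "integral\<^sup>L (lebesgue_on V) f = integral\<^sup>L lborel (\<lambda>x. if x \<in> V then f x else 0)"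
    and lborel_integrable_compact_support: "integrable lborel (\<lambda>x. if x \<in> V then f x else 0)"
proof -
  let ?F = "\<lambda>x. if x \<in> V then f x else 0"
  have "integrable lborel (\<lambda>x. indicator K x *\<^sub>R ?F x)"
    using assms continuous_on_subset by (intro borel_integrable_compact) blast+
  moreover have "(\<lambda>x. indicator K x *\<^sub>R ?F x) = ?F"
    using assms(3) by (auto simp: indicator_def fun_eq_iff)
  ultimately show I: "integrable lborel ?F" by simp
  have V: "V \<in> sets lebesgue" using assms(4) by auto
  have eq: "(\<lambda>x. indicator V x *\<^sub>R f x) = ?F" by (auto simp: indicator_def fun_eq_iff)
  show "integral\<^sup>L (lebesgue_on V) f = integral\<^sup>L lborel ?F"
    using V I by (subst integral_restrict_space) (simp_all only: eq, simp_all add: integral_completion)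
qed

lemma lborel_integral_translate:
  fixes f :: "'a::euclidean_space \<Rightarrow> real"
  assumes "integrable lborel f"
  shows "integrable lborel (\<lambda>x. f (a + x))" "integral\<^sup>L lborel (\<lambda>x. f (a + x)) = integral\<^sup>L lborel f"
proof -
  have m: "f \<in> borel_measurable borel" using borel_measurable_integrable[OF assms] measurable_cong_sets[OF sets_lborel refl] by blast
  have "integrable (distr lborel borel ((+) a)) f" using assms by (simp add: lborel_distr_plus)
  then show "integrable lborel (\<lambda>x. f (a + x))" using m by (subst (asm) integrable_distr_eq) auto
  show "integral\<^sup>L lborel (\<lambda>x. f (a + x)) = integral\<^sup>L lborel f"
    using integral_distr[of "(+) a" lborel borel f] m by (simp add: lborel_distr_plus)
qed

text \<open>
  Translation invariance makes the integrals of the difference quotients vanish; compact support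
  supplies a dominating function for the passage to the derivative.
\<close>

lemma integral_directional_derivative_eq_0:
  fixes \<psi> :: "'a::euclidean_space \<Rightarrow> real"
  assumes D: "\<And>x. (\<psi> has_derivative D x) (at x)"
    and cont: "continuous_on UNIV (\<lambda>x. D x v)"
    and K: "compact K" "\<And>x. x \<notin> K \<Longrightarrow> \<psi> x = 0"
  shows "integral\<^sup>L lborel (\<lambda>x. D x v) = 0"
proof -
  obtain R where "\<forall>x\<in>K. norm x \<le> R"
    using compact_imp_bounded[OF K(1)] by (auto simp: bounded_iff)
  then have R: "K \<subseteq> cball 0 R" by auto
  \<comment> \<open>The difference quotients with steps at most \<open>1\<close> are supported in this larger ball.\<close>
  define K' where "K' = cball (0::'a) (R + norm v)"
  have cK': "compact K'" by (simp add: K'_def)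
  obtain M where M: "\<And>x. x \<in> K' \<Longrightarrow> \<bar>D x v\<bar> \<le> M"
    using compact_imp_bounded[OF compact_continuous_image[OF continuous_on_subset[OF cont] cK']]
    by (auto simp: bounded_iff)
  have zero: "\<psi> x = 0" if "x \<notin> cball 0 R" for x using that R K by blast
  have Dzero: "D x v = 0" if "x \<notin> cball 0 R" for x
  proof -
    have "(\<psi> has_derivative (\<lambda>_. 0)) (at x)"
      by (rule has_derivative_transform_within_open[of "\<lambda>_. 0" _ _ _ "- cball 0 R"])
         (use that zero in \<open>auto\<close>)
    then show ?thesis using D[of x] has_derivative_unique by metis
  qed
  have contpsi: "continuous_on UNIV \<psi>"
    using D has_derivative_continuous by (blast intro: continuous_at_imp_continuous_on)
  have int: "integrable lborel \<psi>"
  proof -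
    have "integrable lborel (\<lambda>x. indicator K x *\<^sub>R \<psi> x)"
      using K contpsi continuous_on_subset by (intro borel_integrable_compact) blast+
    moreover have "(\<lambda>x. indicator K x *\<^sub>R \<psi> x) = \<psi>" using K by (auto simp: indicator_def fun_eq_iff)
    ultimately show ?thesis by simp
  qed
  define h where "h n = inverse (real (Suc n))" for n
  have h: "h n > 0" "h n \<le> 1" for n by (auto simp: h_def field_simps)
  have hl: "h \<longlonglongrightarrow> 0" unfolding h_def by (rule LIMSEQ_inverse_real_of_nat)
  have hat: "filterlim h (at 0) sequentially"
    using hl h(1) by (intro filterlim_atI always_eventually) (auto simp: less_imp_neq[symmetric])
  let ?s = "\<lambda>n x. (\<psi> (h n *\<^sub>R v + x) - \<psi> x) / h n"
  have "(\<lambda>n. integral\<^sup>L lborel (?s n)) \<longlonglongrightarrow> integral\<^sup>L lborel (\<lambda>x. D x v)"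
  proof (rule integral_dominated_convergence[where w = "\<lambda>x. indicator K' x *\<^sub>R \<bar>M\<bar>"])
    show "(\<lambda>x. D x v) \<in> borel_measurable lborel"
      using cont by (simp add: borel_measurable_continuous_onI)
    show "?s n \<in> borel_measurable lborel" for n
      using contpsi h(1)[of n]
      by (auto intro!: borel_measurable_continuous_onI continuous_intros continuous_on_compose2[of UNIV \<psi>])
    show "integrable lborel (\<lambda>x. indicator K' x *\<^sub>R \<bar>M\<bar>)"
      by (intro borel_integrable_compact cK') auto
    show "AE x in lborel. (\<lambda>n. ?s n x) \<longlonglongrightarrow> D x v"
    proof (rule AE_I2)
      fix x
      have "((\<lambda>t. \<psi> (x + t *\<^sub>R v)) has_derivative (\<lambda>t. D x (t *\<^sub>R v))) (at 0)"
        by (rule has_derivative_compose[where f = "\<lambda>t. x + t *\<^sub>R v" and g = \<psi> and g' = "D x"])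
           (auto intro!: derivative_eq_intros D)
      moreover have "D x (t *\<^sub>R v) = D x v * t" for t
        by (simp add: linear_cmul[OF has_derivative_linear[OF D]])
      ultimately have "((\<lambda>t. \<psi> (x + t *\<^sub>R v)) has_field_derivative D x v) (at 0)"
        by (simp add: has_field_derivative_def)
      then have "((\<lambda>t. (\<psi> (x + t *\<^sub>R v) - \<psi> x) / t) \<longlongrightarrow> D x v) (at 0)"
        by (simp add: DERIV_def)
      then show "(\<lambda>n. ?s n x) \<longlonglongrightarrow> D x v"
        unfolding add.commute[of _ x] by (rule filterlim_compose[OF _ hat])
    qed
    show "AE x in lborel. norm (?s n x) \<le> indicator K' x *\<^sub>R \<bar>M\<bar>" for n
    proof (rule AE_I2)
      fix x
      have "((\<lambda>t. \<psi> (x + t *\<^sub>R (h n *\<^sub>R v))) has_derivative (\<lambda>s. D (x + t *\<^sub>R (h n *\<^sub>R v)) (s *\<^sub>R (h n *\<^sub>R v))))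
          (at t within {0..1})" for t
        by (rule has_derivative_compose[where f = "\<lambda>t. x + t *\<^sub>R (h n *\<^sub>R v)" and g = \<psi> and g' = "D (x + t *\<^sub>R (h n *\<^sub>R v))"])
           (auto intro!: derivative_eq_intros D)
      from mvt_simple[OF zero_less_one this]
      obtain t where t: "0 < t" "t < 1"
        "\<psi> (x + h n *\<^sub>R v) - \<psi> x = D (x + t *\<^sub>R (h n *\<^sub>R v)) (h n *\<^sub>R v)" by (auto simp: greaterThanLessThan_iff)
      have "D y (h n *\<^sub>R v) = h n * D y v" for y
        by (simp add: linear_cmul[OF has_derivative_linear[OF D]])
      then have s: "?s n x = D (x + (t * h n) *\<^sub>R v) v"
        using t(3) h(1)[of n] by (simp add: add.commute field_simps)
      have small: "t * h n * norm v \<le> norm v"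
        using t h[of n] by (intro mult_left_le_one_le mult_nonneg_nonneg mult_le_one) auto
      show "norm (?s n x) \<le> indicator K' x *\<^sub>R \<bar>M\<bar>"
      proof (cases "x + (t * h n) *\<^sub>R v \<in> cball 0 R")
        case True
        have "norm x \<le> norm (x + (t * h n) *\<^sub>R v) + norm ((t * h n) *\<^sub>R v)"
          by (metis add_diff_cancel_right' norm_triangle_ineq4)
        then have "x \<in> K'" using True small t h(1)[of n] by (auto simp: K'_def)
        moreover have "x + (t * h n) *\<^sub>R v \<in> K'"
          using True norm_ge_zero[of v] unfolding K'_def mem_cball_0 by linarith
        ultimately show ?thesis using M[of "x + (t * h n) *\<^sub>R v"] unfolding s by simp
      next
        case False
        then show ?thesis unfolding s using Dzero[OF False] by simp
      qed
    qed
  qed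
  moreover have "integral\<^sup>L lborel (?s n) = 0" for n
    using lborel_integral_translate[OF int, of "h n *\<^sub>R v"] int by simp
  ultimately have "(\<lambda>n::nat. 0) \<longlonglongrightarrow> integral\<^sup>L lborel (\<lambda>x. D x v)" by (simp only:)
  then show ?thesis by (simp add: LIMSEQ_const_iff)
qed

lemma L1_loc_continuous:
  fixes f :: "'a::euclidean_space \<Rightarrow> 'b::euclidean_space"
  assumes "open V" "continuous_on V f"
  shows "f \<in> L1_loc V"
proof -
  have "integrable (lebesgue_on K) f" if "compact K" "K \<subseteq> V" for K
  proof -
    have i: "integrable lborel (\<lambda>x. indicator K x *\<^sub>R f x)"
      using that assms continuous_on_subset by (intro borel_integrable_compact) blast+
    have "K \<in> sets lebesgue" using that by (simp add: lmeasurable_compact fmeasurableD)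
    then show ?thesis
      using i by (simp add: integrable_restrict_space integrable_completion borel_measurable_integrable)
  qed
  then show ?thesis
    using assms by (auto simp: L1_loc_def intro: continuous_imp_measurable_on_sets_lebesgue)
qed

lemma Linf_loc_continuous:
  fixes f :: "'a::euclidean_space \<Rightarrow> 'b::euclidean_space"
  assumes "open V" "continuous_on V f"
  shows "f \<in> Linf_loc V"
proof -
  have "\<exists>C. AE x in lebesgue_on K. norm (f x) \<le> C" if K: "compact K" "K \<subseteq> V" for K
  proof -
    obtain C where "\<And>x. x \<in> K \<Longrightarrow> norm (f x) \<le> C"
      using compact_imp_bounded[OF compact_continuous_image[OF continuous_on_subset[OF assms(2) K(2)] K(1)]]
      by (auto simp: bounded_iff)
    then show ?thesis by (intro exI[of _ C] AE_I2) (auto simp: space_restrict_space)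
  qed
  then show ?thesis
    using assms by (auto simp: Linf_loc_def intro: continuous_imp_measurable_on_sets_lebesgue)
qed

text \<open>
  The product of the function with a test function, extended by zero, is differentiable on the whole
  space, and its partial derivatives have integral zero: this is the integration by parts formula.
\<close>

lemma has_weak_gradient_C1:
  fixes G :: "'a::euclidean_space \<Rightarrow> real"
  assumes V: "open V" and D: "\<And>x. x \<in> V \<Longrightarrow> (G has_derivative (\<lambda>h. DG x \<bullet> h)) (at x)"
    and cont: "continuous_on V DG"
  shows "has_weak_gradient V G DG"
proof -
  have contG: "continuous_on V G"
    using D has_derivative_continuous by (blast intro: continuous_at_imp_continuous_on)
  have "integral\<^sup>L (lebesgue_on V) (\<lambda>x. G x * frechet_derivative \<phi> (at x) i) =
        - integral\<^sup>L (lebesgue_on V) (\<lambda>x. (DG x \<bullet> i) * \<phi> x)"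
    if \<phi>: "\<phi> \<in> test_functions V" and i: "i \<in> Basis" for \<phi> i
  proof -
    define K where "K = closure {x. \<phi> x \<noteq> 0}"
    have K: "compact K" "K \<subseteq> V" using \<phi> by (auto simp: test_functions_def K_def)
    have Ck: "\<And>k. Ck k \<phi>" using \<phi> by (auto simp: test_functions_def)
    have D\<phi>: "(\<phi> has_derivative frechet_derivative \<phi> (at x)) (at x)" for x
      using Ck[of 1] by (simp add: frechet_derivative_works[symmetric])
    have c\<phi>: "continuous_on UNIV \<phi>" using Ck[of 0] by simp
    have cD\<phi>: "continuous_on UNIV (\<lambda>x. frechet_derivative \<phi> (at x) i)" using Ck[of 1] i by simp
    have off: "\<phi> x = 0" if "x \<notin> K" for x
      using that closure_subset[of "{x. \<phi> x \<noteq> 0}"] unfolding K_def by blast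
    have oK: "open (- K)" by (simp add: K_def open_Compl)
    have offD: "frechet_derivative \<phi> (at x) = (\<lambda>_. 0)" if "x \<notin> K" for x
    proof (rule frechet_derivative_eqI)
      show "(\<phi> has_derivative (\<lambda>_. 0)) (at x)"
        by (rule has_derivative_transform_within_open[of "\<lambda>_. 0" _ _ _ "- K"])
           (use that off oK in auto)
    qed
    have ext: "continuous_on UNIV (\<lambda>x. if x \<in> V then f x else 0)"
      if f: "continuous_on V f" "\<And>x. x \<notin> K \<Longrightarrow> f x = (0::real)" for f
    proof -
      have "continuous_on (V \<union> - K) (\<lambda>x. if x \<in> V then f x else 0)"
      proof (rule continuous_on_open_Un)
        show "open (- K)" by (rule oK)
        show "continuous_on V (\<lambda>x. if x \<in> V then f x else 0)"
          using f(1) by (rule continuous_on_eq) auto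
        have "continuous_on (- K) (\<lambda>x. 0::real)" by simp
        then show "continuous_on (- K) (\<lambda>x. if x \<in> V then f x else 0)"
          by (rule continuous_on_eq) (use f in auto)
      qed (use V in auto)
      moreover have "V \<union> - K = UNIV" using K by auto
      ultimately show ?thesis by simp
    qed
    define F1 where "F1 x = G x * frechet_derivative \<phi> (at x) i" for x
    define F2 where "F2 x = (DG x \<bullet> i) * \<phi> x" for x
    have F1: "continuous_on V F1" "\<And>x. x \<notin> K \<Longrightarrow> F1 x = 0"
      unfolding F1_def using offD
      by (auto intro!: continuous_on_mult contG continuous_on_subset[OF cD\<phi>])
    have F2: "continuous_on V F2" "\<And>x. x \<notin> K \<Longrightarrow> F2 x = 0"
      unfolding F2_def using off
      by (auto intro!: continuous_on_mult continuous_on_inner cont continuous_on_const continuous_on_subset[OF c\<phi>])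
    define \<psi> where "\<psi> x = (if x \<in> V then G x * \<phi> x else 0)" for x
    define D\<psi> where "D\<psi> x h = (if x \<in> V then G x * frechet_derivative \<phi> (at x) h + (DG x \<bullet> h) * \<phi> x else 0)" for x h
    have "integral\<^sup>L lborel (\<lambda>x. D\<psi> x i) = 0"
    proof (rule integral_directional_derivative_eq_0[of \<psi> D\<psi>])
      show "(\<psi> has_derivative D\<psi> x) (at x)" for x
      proof (cases "x \<in> V")
        case True
        have "((\<lambda>x. G x * \<phi> x) has_derivative D\<psi> x) (at x)"
          using has_derivative_mult[OF D[OF True] D\<phi>[of x]] True by (simp add: D\<psi>_def[abs_def])
        then show ?thesis
          by (rule has_derivative_transform_within_open[of _ _ _ _ V]) (use V True in \<open>auto simp: \<psi>_def\<close>)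
      next
        case False
        then have z: "D\<psi> x = (\<lambda>_. 0)" by (auto simp: D\<psi>_def)
        have xK: "x \<notin> K" using False K by auto
        show ?thesis unfolding z \<psi>_def
          by (rule has_derivative_transform_within_open[of "\<lambda>_. 0" _ _ _ "- K"])
             (use off oK xK in auto)
      qed
      have "continuous_on UNIV (\<lambda>x. if x \<in> V then F1 x + F2 x else 0)"
        by (rule ext[OF continuous_on_add[OF F1(1) F2(1)]]) (simp add: F1(2) F2(2))
      then show "continuous_on UNIV (\<lambda>x. D\<psi> x i)" unfolding D\<psi>_def F1_def F2_def .
      show "\<psi> x = 0" if "x \<notin> K" for x using off[OF that] by (simp add: \<psi>_def)
    qed (use K in auto)
    moreover have "D\<psi> x i = (if x \<in> V then F1 x else 0) + (if x \<in> V then F2 x else 0)" for x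
      by (simp add: D\<psi>_def F1_def F2_def)
    moreover note lborel_integrable_compact_support[OF ext[OF F1] K(1) F1(2) V]
      lborel_integrable_compact_support[OF ext[OF F2] K(1) F2(2) V]
    ultimately have "integral\<^sup>L lborel (\<lambda>x. if x \<in> V then F1 x else 0) + integral\<^sup>L lborel (\<lambda>x. if x \<in> V then F2 x else 0) = 0"
      by simp
    moreover note lebesgue_on_integral_compact_support[OF ext[OF F1] K(1) F1(2) V]
      lebesgue_on_integral_compact_support[OF ext[OF F2] K(1) F2(2) V]
    ultimately show ?thesis by (simp add: F1_def F2_def)
  qed
  then show ?thesis
    using L1_loc_continuous[OF V contG] L1_loc_continuous[OF V cont] by (auto simp: has_weak_gradient_def)
qed

section \<open>Uniqueness of weak gradients\<close>

text \<open>
  The positive and the negative part are densities of finite measures that agree on boxes, an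
  intersection-stable generator of the Borel sets.
\<close>

lemma AE_zero_if_box_integrals_zero:
  fixes h :: "'a::euclidean_space \<Rightarrow> real"
  assumes h: "integrable lborel h"
    and box: "\<And>a b. integral\<^sup>L lborel (\<lambda>x. indicator (box a b) x * h x) = 0"
  shows "AE x in lborel. h x = 0"
proof -
  have [measurable]: "h \<in> borel_measurable borel"
    using borel_measurable_integrable[OF h] measurable_cong_sets[OF sets_lborel refl] by blast
  let ?M = "density lborel (\<lambda>x. ennreal (h x))" and ?N = "density lborel (\<lambda>x. ennreal (- h x))"
  have E: "emeasure ?M (box a b) = ennreal (\<integral>x. indicator (box a b) x * max 0 (h x) \<partial>lborel)"
    "emeasure ?N (box a b) = ennreal (\<integral>x. indicator (box a b) x * max 0 (- h x) \<partial>lborel)" for a b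
  proof -
    have "emeasure (density lborel (\<lambda>x. ennreal (g x))) (box a b)
        = ennreal (\<integral>x. indicator (box a b) x * max 0 (g x) \<partial>lborel)"
      if g[measurable]: "g \<in> borel_measurable borel" and i: "integrable lborel g" for g
    proof -
      have "emeasure (density lborel (\<lambda>x. ennreal (g x))) (box a b)
          = (\<integral>\<^sup>+x. ennreal (g x) * indicator (box a b) x \<partial>lborel)"
        by (rule emeasure_density) auto
      also have "\<dots> = (\<integral>\<^sup>+x. ennreal (indicator (box a b) x * max 0 (g x)) \<partial>lborel)"
        by (rule nn_integral_cong) (auto simp: indicator_def max_def ennreal_neg)
      also have "\<dots> = ennreal (\<integral>x. indicator (box a b) x * max 0 (g x) \<partial>lborel)"
      proof (rule nn_integral_eq_integral)
        show "integrable lborel (\<lambda>x. indicator (box a b) x * max 0 (g x))"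
          by (rule Bochner_Integration.integrable_bound[OF i]) (auto simp: indicator_def)
      qed auto
      finally show ?thesis .
    qed
    from this[of h] this[of "\<lambda>x. - h x"] h
    show "emeasure ?M (box a b) = ennreal (\<integral>x. indicator (box a b) x * max 0 (h x) \<partial>lborel)"
      "emeasure ?N (box a b) = ennreal (\<integral>x. indicator (box a b) x * max 0 (- h x) \<partial>lborel)" by auto
  qed
  have eq: "emeasure ?M (box a b) = emeasure ?N (box a b)" for a b
  proof -
    have i: "integrable lborel (\<lambda>x. indicator (box a b) x * max 0 (h x))"
      "integrable lborel (\<lambda>x. indicator (box a b) x * max 0 (- h x))"
      by (rule Bochner_Integration.integrable_bound[OF h]; auto simp: indicator_def)+
    have "(\<lambda>x. indicator (box a b) x * h x)
        = (\<lambda>x. indicator (box a b) x * max 0 (h x) - indicator (box a b) x * max 0 (- h x))"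
      by (auto simp: fun_eq_iff max_def)
    then have "(\<integral>x. indicator (box a b) x * max 0 (h x) \<partial>lborel)
        - (\<integral>x. indicator (box a b) x * max 0 (- h x) \<partial>lborel) = 0"
      using box[of a b] Bochner_Integration.integral_diff[OF i] by simp
    then show ?thesis unfolding E by simp
  qed
  have "?M = ?N"
  proof (rule measure_eqI_generator_eq)
    let ?E = "range (\<lambda>(a, b). box a b::'a set)"
    show "Int_stable ?E" by (auto simp: Int_stable_def box_Int_box)
    show "?E \<subseteq> Pow UNIV" "sets ?M = sigma_sets UNIV ?E" "sets ?N = sigma_sets UNIV ?E"
      by (simp_all add: borel_eq_box)
    let ?A = "\<lambda>n::nat. box (- (real n *\<^sub>R One)) (real n *\<^sub>R One) :: 'a set"
    show "range ?A \<subseteq> ?E" "(\<Union>i. ?A i) = UNIV" unfolding UN_box_eq_UNIV by auto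
    show "emeasure ?M (?A i) \<noteq> \<infinity>" for i unfolding E by simp
    show "emeasure ?M X = emeasure ?N X" if "X \<in> ?E" for X using that eq by auto
  qed
  then have "AE x in lborel. ennreal (h x) = ennreal (- h x)"
    by (subst (asm) sigma_finite_measure.density_unique_iff[OF lborel.sigma_finite_measure_axioms]) auto
  moreover have "t = 0" if "ennreal t = ennreal (- t)" for t
    using that by (cases t "0::real" rule: linorder_cases) (auto simp: ennreal_neg)
  ultimately show ?thesis by (auto elim!: eventually_mono)
qed

text \<open>
  Bump functions converge boundedly to indicators of boxes, which reduces the claim to boxes inside
  \<open>V\<close>; countably many boxes with rational corners cover \<open>V\<close>.
\<close>

lemma AE_zero_if_test_integrals_zero:
  fixes h :: "'a::euclidean_space \<Rightarrow> real"
  assumes V: "open V" and h: "h \<in> L1_loc V"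
    and z: "\<And>\<phi>. \<phi> \<in> test_functions V \<Longrightarrow> integral\<^sup>L (lebesgue_on V) (\<lambda>x. h x * \<phi> x) = 0"
  shows "AE x in lebesgue_on V. h x = 0"
proof -
  have V': "V \<inter> space lebesgue \<in> sets lebesgue" using V by auto
  have box: "AE x in lebesgue. x \<in> box a b \<longrightarrow> h x = 0" if ab: "cbox a b \<subseteq> V" for a b
  proof -
    define h0 where "h0 x = indicator (box a b) x * h x" for x
    have ic: "integrable lebesgue (\<lambda>x. indicator (cbox a b) x *\<^sub>R h x)"
    proof -
      have "integrable (lebesgue_on (cbox a b)) h" using h ab by (auto simp: L1_loc_def)
      then show ?thesis using integrable_restrict_space[of "cbox a b" lebesgue h] by simp
    qed
    have h0i: "integrable lebesgue h0"
    proof -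
      have "integrable lebesgue (\<lambda>x. indicator (box a b) x *\<^sub>R (indicator (cbox a b) x *\<^sub>R h x))"
        by (rule integrable_mult_indicator[OF _ ic]) auto
      moreover have "(\<lambda>x. indicator (box a b) x *\<^sub>R (indicator (cbox a b) x *\<^sub>R h x)) = h0"
        using box_subset_cbox[of a b] by (auto simp: h0_def indicator_def fun_eq_iff)
      ultimately show ?thesis by simp
    qed
    \<comment> \<open>Intersections of boxes are boxes, so bumps on the intersection test the truncated function \<open>h0\<close>
      against an arbitrary box.\<close>
    have zero: "integral\<^sup>L lebesgue (\<lambda>x. indicator (box c d) x * h0 x) = 0" for c d
    proof (cases "box a b \<inter> box c d = {}")
      case True
      then have "(\<lambda>x. indicator (box c d) x * h0 x) = (\<lambda>x. 0)"
        by (auto simp: h0_def indicator_def fun_eq_iff)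
      then show ?thesis by simp
    next
      case False
      obtain p q where pq: "box a b \<inter> box c d = box p q"
        by (rule that[OF box_Int_box])
      have "cbox p q \<subseteq> V"
      proof -
        have sub: "box p q \<subseteq> box a b" using pq by blast
        have "cbox p q = closure (box p q)" using False unfolding pq by (rule closure_box[symmetric])
        also have "\<dots> \<subseteq> closure (box a b)" by (rule closure_mono[OF sub])
        also have "\<dots> \<subseteq> cbox a b" by (intro closure_minimal box_subset_cbox closed_cbox)
        finally show ?thesis using ab by simp
      qed
      define \<phi> where "\<phi> n = bump (real (Suc n)) p q" for n
      have \<phi>: "\<phi> n \<in> test_functions V" for n
        unfolding \<phi>_def by (rule bump_test_function) (use \<open>cbox p q \<subseteq> V\<close> in auto)
      have sup: "\<phi> n x = 0" if "x \<notin> box p q" for n x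
        using that bump_eq_0_iff[of "real (Suc n)" p q x] by (simp add: \<phi>_def)
      have meas: "\<phi> n \<in> borel_measurable lebesgue" for n
        using Ck_imp_continuous[OF Ck_bump[of 0 "real (Suc n)" p q]]
        by (auto simp: \<phi>_def intro!: measurable_completion borel_measurable_continuous_onI)
      have "(\<lambda>n. integral\<^sup>L lebesgue (\<lambda>x. h0 x * \<phi> n x)) \<longlonglongrightarrow> integral\<^sup>L lebesgue (\<lambda>x. h0 x * indicator (box p q) x)"
      proof (rule integral_dominated_convergence[where w = "\<lambda>x. \<bar>h0 x\<bar>"])
        show "AE x in lebesgue. (\<lambda>n. h0 x * \<phi> n x) \<longlonglongrightarrow> h0 x * indicator (box p q) x"
          unfolding \<phi>_def by (intro AE_I2 tendsto_mult tendsto_const bump_tendsto_indicator)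
        show "AE x in lebesgue. norm (h0 x * \<phi> n x) \<le> \<bar>h0 x\<bar>" for n
          unfolding \<phi>_def real_norm_def abs_mult abs_of_nonneg[OF bump_nonneg]
          by (intro AE_I2 mult_right_le_one_le bump_nonneg bump_le_1) auto
        show "(\<lambda>x. h0 x * indicator (box p q) x) \<in> borel_measurable lebesgue"
          by (rule borel_measurable_times[OF borel_measurable_integrable[OF h0i] borel_measurable_indicator]) auto
      qed (use h0i meas in auto)
      moreover have "integral\<^sup>L lebesgue (\<lambda>x. h0 x * \<phi> n x) = 0" for n
      proof -
        have "(\<lambda>x. h0 x * \<phi> n x) = (\<lambda>x. indicator V x *\<^sub>R (h x * \<phi> n x))"
        proof
          fix x show "h0 x * \<phi> n x = indicator V x *\<^sub>R (h x * \<phi> n x)"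
          proof (cases "x \<in> box p q")
            case True
            then have "x \<in> box a b" "x \<in> V" using pq ab box_subset_cbox by blast+
            then show ?thesis by (simp add: h0_def)
          qed (simp add: sup)
        qed
        then have "integral\<^sup>L lebesgue (\<lambda>x. h0 x * \<phi> n x) = integral\<^sup>L (lebesgue_on V) (\<lambda>x. h x * \<phi> n x)"
          by (simp only: integral_restrict_space[OF V'])
        then show ?thesis using z[OF \<phi>] by simp
      qed
      ultimately have "integral\<^sup>L lebesgue (\<lambda>x. h0 x * indicator (box p q) x) = 0"
        by (simp add: LIMSEQ_const_iff)
      moreover have "(\<lambda>x. h0 x * indicator (box p q) x) = (\<lambda>x. indicator (box c d) x * h0 x)"
        using pq by (auto simp: h0_def indicator_def fun_eq_iff)
      ultimately show ?thesis by simp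
    qed
    have "h0 \<in> borel_measurable (completion lborel)" using h0i by auto
    then obtain g where g: "g \<in> borel_measurable lborel" "AE x in lborel. h0 x = g x"
      using completion_ex_borel_measurable_real by blast
    have gc: "g \<in> borel_measurable lebesgue" "AE x in lebesgue. h0 x = g x"
      using g by (auto intro: measurable_completion AE_completion)
    have gi: "integrable lborel g"
    proof -
      have "integrable lebesgue g" using h0i gc by (subst integrable_cong_AE[of _ _ h0]) auto
      then show ?thesis using g by (simp add: integrable_completion)
    qed
    have "AE x in lborel. g x = 0"
    proof (rule AE_zero_if_box_integrals_zero[OF gi])
      fix c d :: 'a
      have m: "(\<lambda>x. indicator (box c d) x * g x) \<in> borel_measurable lborel"
        using g by auto
      have "integral\<^sup>L lborel (\<lambda>x. indicator (box c d) x * g x) = integral\<^sup>L lebesgue (\<lambda>x. indicator (box c d) x * g x)"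
        using m by (simp add: integral_completion)
      also have "\<dots> = integral\<^sup>L lebesgue (\<lambda>x. indicator (box c d) x * h0 x)"
      proof (rule integral_cong_AE)
        show "(\<lambda>x. indicator (box c d) x * g x) \<in> borel_measurable lebesgue"
          using m by (rule measurable_completion)
        show "(\<lambda>x. indicator (box c d) x * h0 x) \<in> borel_measurable lebesgue"
          using h0i by (intro borel_measurable_times borel_measurable_indicator) auto
        show "AE x in lebesgue. indicator (box c d) x * g x = indicator (box c d) x * h0 x"
          using gc(2) by eventually_elim simp
      qed
      finally show "integral\<^sup>L lborel (\<lambda>x. indicator (box c d) x * g x) = 0" using zero by simp
    qed
    then have "AE x in lebesgue. g x = 0" by (rule AE_completion)
    with gc(2) show ?thesis by eventually_elim (auto simp: h0_def)
  qed
  define I where "I = {f \<in> (Basis::'a set) \<rightarrow>\<^sub>E \<rat> \<times> \<rat>. cbox (\<Sum>i\<in>Basis. fst (f i) *\<^sub>R i) (\<Sum>i\<in>Basis. snd (f i) *\<^sub>R i) \<subseteq> V}"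
  have cI: "countable I"
    unfolding I_def by (rule countable_subset[OF _ countable_PiE[of Basis "\<lambda>_. \<rat> \<times> \<rat>"]]) (auto intro: countable_rat)
  have "AE x in lebesgue. \<forall>f\<in>I. x \<in> box (\<Sum>i\<in>Basis. fst (f i) *\<^sub>R i) (\<Sum>i\<in>Basis. snd (f i) *\<^sub>R i) \<longrightarrow> h x = 0"
    unfolding AE_ball_countable[OF cI] using box by (auto simp: I_def)
  moreover have "\<exists>f\<in>I. x \<in> box (\<Sum>i\<in>Basis. fst (f i) *\<^sub>R i) (\<Sum>i\<in>Basis. snd (f i) *\<^sub>R i)" if "x \<in> V" for x
  proof -
    obtain e where e: "e > 0" "cball x e \<subseteq> V" using open_contains_cball_eq[OF V] \<open>x \<in> V\<close> by blast
    from rational_boxes[OF e(1), of x] obtain a b where ab: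
      "\<forall>i\<in>Basis. a \<bullet> i \<in> \<rat> \<and> b \<bullet> i \<in> \<rat>" "x \<in> box a b" "box a b \<subseteq> ball x e" by blast
    let ?f = "\<lambda>i. if i \<in> Basis then (a \<bullet> i, b \<bullet> i) else undefined"
    have r: "(\<Sum>i\<in>Basis. fst (?f i) *\<^sub>R i) = a" "(\<Sum>i\<in>Basis. snd (?f i) *\<^sub>R i) = b"
      by (simp_all add: euclidean_representation cong: sum.cong)
    have "cbox a b = closure (box a b)" using ab(2) by (metis closure_box empty_iff)
    also have "\<dots> \<subseteq> closure (ball x e)" using ab(3) by (rule closure_mono)
    also have "\<dots> \<subseteq> V" using e by simp
    finally have "?f \<in> I" using ab(1) unfolding I_def r mem_Collect_eq by (auto simp: r)
    then show ?thesis using ab(2) r by (intro bexI[of _ ?f]) simp_all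
  qed
  ultimately have "AE x in lebesgue. x \<in> V \<longrightarrow> h x = 0" by (auto elim!: eventually_mono)
  then show ?thesis using V' by (subst AE_restrict_space_iff) auto
qed

lemma L1_loc_inner:
  fixes f :: "'a::euclidean_space \<Rightarrow> 'a"
  shows "f \<in> L1_loc V \<Longrightarrow> (\<lambda>x. f x \<bullet> v) \<in> L1_loc V"
  by (auto simp: L1_loc_def)

lemma integrable_L1_loc_times_test:
  fixes h :: "'a::euclidean_space \<Rightarrow> real"
  assumes V: "open V" and h: "h \<in> L1_loc V" and \<phi>: "\<phi> \<in> test_functions V"
  shows "integrable (lebesgue_on V) (\<lambda>x. h x * \<phi> x)"
proof -
  define K where "K = closure {x. \<phi> x \<noteq> 0}"
  have K: "compact K" "K \<subseteq> V" using \<phi> by (auto simp: test_functions_def K_def)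
  have Kl: "K \<inter> space lebesgue \<in> sets lebesgue" using K by (simp add: lmeasurable_compact fmeasurableD)
  have Vl: "V \<inter> space lebesgue \<in> sets lebesgue" using V by auto
  have off: "\<phi> x = 0" if "x \<notin> K" for x
    using that closure_subset[of "{x. \<phi> x \<noteq> 0}"] unfolding K_def by blast
  have c: "continuous_on UNIV \<phi>" using \<phi> Ck_imp_continuous by (auto simp: test_functions_def)
  obtain M where M: "\<And>x. x \<in> K \<Longrightarrow> \<bar>\<phi> x\<bar> \<le> M"
    using compact_imp_bounded[OF compact_continuous_image[OF continuous_on_subset[OF c] K(1)]]
    by (auto simp: bounded_iff)
  have i0: "integrable lebesgue (\<lambda>x. indicator K x * h x)"
  proof -
    have "integrable (lebesgue_on K) h" using h K by (auto simp: L1_loc_def)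
    then show ?thesis using integrable_restrict_space[OF Kl, of h] by simp
  qed
  have "integrable lebesgue (\<lambda>x. (indicator K x * h x) * \<phi> x)"
  proof (rule Bochner_Integration.integrable_bound)
    show "integrable lebesgue (\<lambda>x. M * (indicator K x * h x))" using i0 by (rule integrable_mult_right)
    have "\<phi> \<in> borel_measurable lebesgue"
      using c by (intro measurable_completion) (simp add: borel_measurable_continuous_onI)
    then show "(\<lambda>x. (indicator K x * h x) * \<phi> x) \<in> borel_measurable lebesgue"
      by (intro borel_measurable_times[OF borel_measurable_integrable[OF i0]])
    show "AE x in lebesgue. norm ((indicator K x * h x) * \<phi> x) \<le> norm (M * (indicator K x * h x))"
    proof (rule AE_I2)
      fix x
      show "norm ((indicator K x * h x) * \<phi> x) \<le> norm (M * (indicator K x * h x))"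
      proof (cases "x \<in> K")
        case True
        have "\<bar>h x\<bar> * \<bar>\<phi> x\<bar> \<le> \<bar>h x\<bar> * \<bar>M\<bar>"
          using M[OF True] by (intro mult_left_mono) auto
        then show ?thesis using True by (simp add: abs_mult mult.commute)
      qed simp
    qed
  qed
  moreover have "(\<lambda>x. (indicator K x * h x) * \<phi> x) = (\<lambda>x. indicator V x *\<^sub>R (h x * \<phi> x))"
    using K off by (auto simp: indicator_def fun_eq_iff)
  ultimately show ?thesis using integrable_restrict_space[OF Vl, of "\<lambda>x. h x * \<phi> x"] by simp
qed

lemma weak_gradient_unique:
  fixes g :: "'a::euclidean_space \<Rightarrow> 'a"
  assumes V: "open V" and g: "has_weak_gradient V u g" "has_weak_gradient V u g'"
  shows "AE x in lebesgue_on V. g x = g' x"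
proof -
  have "AE x in lebesgue_on V. (g x - g' x) \<bullet> i = 0" if i: "i \<in> Basis" for i
  proof (rule AE_zero_if_test_integrals_zero[OF V])
    have gL: "g \<in> L1_loc V" "g' \<in> L1_loc V" using g by (auto simp: has_weak_gradient_def)
    then show "(\<lambda>x. (g x - g' x) \<bullet> i) \<in> L1_loc V" by (auto simp: L1_loc_def)
    fix \<phi> :: "'a \<Rightarrow> real" assume \<phi>: "\<phi> \<in> test_functions V"
    have "integral\<^sup>L (lebesgue_on V) (\<lambda>x. (g x \<bullet> i) * \<phi> x) = integral\<^sup>L (lebesgue_on V) (\<lambda>x. (g' x \<bullet> i) * \<phi> x)"
      using g \<phi> i unfolding has_weak_gradient_def by (metis (no_types, lifting) minus_equation_iff)
    then show "integral\<^sup>L (lebesgue_on V) (\<lambda>x. (g x - g' x) \<bullet> i * \<phi> x) = 0"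
      using gL by (simp add: inner_diff_left left_diff_distrib integrable_L1_loc_times_test[OF V _ \<phi>] L1_loc_inner)
  qed
  then have "AE x in lebesgue_on V. \<forall>i\<in>Basis. (g x - g' x) \<bullet> i = 0"
    by (subst AE_ball_countable) (auto simp: countable_finite)
  then show ?thesis
    by eventually_elim (metis eq_iff_diff_eq_0 euclidean_all_zero_iff)
qed

section \<open>Increments controlled by weak gradients\<close>

lemma has_field_derivative_integral_translate:
  fixes \<phi> :: "'a::euclidean_space \<Rightarrow> real"
  assumes w: "integrable lborel w"
    and D: "\<And>y. (\<phi> has_derivative D y) (at y)" and cont: "continuous_on UNIV (\<lambda>y. D y v)"
    and M: "\<And>y. \<bar>D y v\<bar> \<le> M" and B: "\<And>y. \<bar>\<phi> y\<bar> \<le> B"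
  shows "((\<lambda>t. \<integral>\<xi>. w \<xi> * \<phi> (\<xi> - (x + t *\<^sub>R v)) \<partial>lborel) has_field_derivative
      - (\<integral>\<xi>. w \<xi> * D (\<xi> - (x + t *\<^sub>R v)) v \<partial>lborel)) (at t)"
proof -
  define p where "p t \<xi> = \<phi> (\<xi> - (x + t *\<^sub>R v))" for t \<xi>
  define p' where "p' t \<xi> = - D (\<xi> - (x + t *\<^sub>R v)) v" for t \<xi>
  have pd: "((\<lambda>t. p t \<xi>) has_field_derivative p' t \<xi>) (at t)" for t \<xi>
  proof -
    have "((\<lambda>t. p t \<xi>) has_derivative (\<lambda>s. D (\<xi> - (x + t *\<^sub>R v)) (- (s *\<^sub>R v)))) (at t)"
      unfolding p_def
      by (rule has_derivative_compose[where f = "\<lambda>t. \<xi> - (x + t *\<^sub>R v)" and g = \<phi> and g' = "D (\<xi> - (x + t *\<^sub>R v))"])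
         (auto intro!: derivative_eq_intros D)
    moreover have "D (\<xi> - (x + t *\<^sub>R v)) (- (s *\<^sub>R v)) = p' t \<xi> * s" for s
      using linear_cmul[OF has_derivative_linear[OF D], of "\<xi> - (x + t *\<^sub>R v)" "- s" v] by (simp add: p'_def)
    ultimately show ?thesis by (simp add: has_field_derivative_def)
  qed
  have cphi: "continuous_on UNIV \<phi>"
    using D has_derivative_continuous by (blast intro: continuous_at_imp_continuous_on)
  have wm: "w \<in> borel_measurable borel"
    using borel_measurable_integrable[OF w] measurable_cong_sets[OF sets_lborel refl] by blast
  have pm: "p t \<in> borel_measurable borel" for t
    unfolding p_def
    by (rule borel_measurable_continuous_onI, rule continuous_on_compose2[OF cphi]) (auto intro!: continuous_intros)
  have p'm: "p' t \<in> borel_measurable borel" for t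
    unfolding p'_def
    by (rule borel_measurable_continuous_onI, rule continuous_on_minus, rule continuous_on_compose2[OF cont])
       (auto intro!: continuous_intros)
  have pi: "integrable lborel (\<lambda>\<xi>. w \<xi> * p t \<xi>)" for t
  proof (rule Bochner_Integration.integrable_bound[OF integrable_mult_right[OF w, of B]])
    show "(\<lambda>\<xi>. w \<xi> * p t \<xi>) \<in> borel_measurable lborel" using wm pm by simp
    have "\<bar>w \<xi>\<bar> * \<bar>p t \<xi>\<bar> \<le> \<bar>w \<xi>\<bar> * \<bar>B\<bar>" for \<xi>
      using B[of "\<xi> - (x + t *\<^sub>R v)"] unfolding p_def by (intro mult_left_mono) auto
    then show "AE \<xi> in lborel. norm (w \<xi> * p t \<xi>) \<le> norm (B * w \<xi>)"
      by (intro AE_I2) (simp add: abs_mult mult.commute)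
  qed
  have lip: "\<bar>p s \<xi> - p t \<xi>\<bar> \<le> \<bar>M\<bar> * \<bar>s - t\<bar>" for s t \<xi>
  proof -
    have "norm (p s \<xi> - p t \<xi>) \<le> \<bar>M\<bar> * norm (s - t)"
    proof (rule field_differentiable_bound[of UNIV "\<lambda>t. p t \<xi>" "\<lambda>t. p' t \<xi>"])
      show "norm (p' z \<xi>) \<le> \<bar>M\<bar>" for z using M[of "\<xi> - (x + z *\<^sub>R v)"] by (simp add: p'_def)
    qed (use pd in auto)
    then show ?thesis by simp
  qed
  let ?F = "\<lambda>t. \<integral>\<xi>. w \<xi> * p t \<xi> \<partial>lborel"
  have "((\<lambda>h. (?F (t + h) - ?F t) / h) \<longlongrightarrow> (\<integral>\<xi>. w \<xi> * p' t \<xi> \<partial>lborel)) (at 0)"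
    unfolding tendsto_at_iff_sequentially comp_def
  proof (intro allI impI)
    fix h :: "nat \<Rightarrow> real" assume h0: "\<forall>i. h i \<in> UNIV - {0}" and hl: "h \<longlonglongrightarrow> 0"
    then have hat: "filterlim h (at 0) sequentially" by (intro filterlim_atI always_eventually) auto
    have "(\<lambda>n. \<integral>\<xi>. w \<xi> * ((p (t + h n) \<xi> - p t \<xi>) / h n) \<partial>lborel) \<longlonglongrightarrow> (\<integral>\<xi>. w \<xi> * p' t \<xi> \<partial>lborel)"
    proof (rule integral_dominated_convergence[where w = "\<lambda>\<xi>. \<bar>M\<bar> * \<bar>w \<xi>\<bar>"])
      show "integrable lborel (\<lambda>\<xi>. \<bar>M\<bar> * \<bar>w \<xi>\<bar>)" using w by auto
      show "AE \<xi> in lborel. (\<lambda>n. w \<xi> * ((p (t + h n) \<xi> - p t \<xi>) / h n)) \<longlonglongrightarrow> w \<xi> * p' t \<xi>"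
      proof (rule AE_I2)
        fix \<xi>
        show "(\<lambda>n. w \<xi> * ((p (t + h n) \<xi> - p t \<xi>) / h n)) \<longlonglongrightarrow> w \<xi> * p' t \<xi>"
          by (intro tendsto_mult tendsto_const filterlim_compose[OF _ hat]) (use pd in \<open>simp add: DERIV_def\<close>)
      qed
      show "AE \<xi> in lborel. norm (w \<xi> * ((p (t + h n) \<xi> - p t \<xi>) / h n)) \<le> \<bar>M\<bar> * \<bar>w \<xi>\<bar>" for n
      proof (rule AE_I2)
        fix \<xi>
        have "\<bar>(p (t + h n) \<xi> - p t \<xi>) / h n\<bar> \<le> \<bar>M\<bar>"
          using lip[of "t + h n" \<xi> t] h0 by (simp add: abs_divide divide_le_eq)
        then have "\<bar>w \<xi>\<bar> * \<bar>(p (t + h n) \<xi> - p t \<xi>) / h n\<bar> \<le> \<bar>w \<xi>\<bar> * \<bar>M\<bar>"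
          by (intro mult_left_mono) auto
        then show "norm (w \<xi> * ((p (t + h n) \<xi> - p t \<xi>) / h n)) \<le> \<bar>M\<bar> * \<bar>w \<xi>\<bar>"
          by (simp add: abs_mult mult.commute)
      qed
    qed (use wm pm p'm in auto)
    moreover have "(?F (t + h n) - ?F t) / h n = (\<integral>\<xi>. w \<xi> * ((p (t + h n) \<xi> - p t \<xi>) / h n) \<partial>lborel)" for n
    proof -
      have "?F (t + h n) - ?F t = (\<integral>\<xi>. w \<xi> * p (t + h n) \<xi> - w \<xi> * p t \<xi> \<partial>lborel)"
        by (rule Bochner_Integration.integral_diff[symmetric, OF pi pi])
      then have "(?F (t + h n) - ?F t) / h n = (\<integral>\<xi>. (w \<xi> * p (t + h n) \<xi> - w \<xi> * p t \<xi>) / h n \<partial>lborel)" by simp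
      then show ?thesis by (simp add: right_diff_distrib)
    qed
    ultimately show "(\<lambda>n. (?F (t + h n) - ?F t) / h n) \<longlonglongrightarrow> (\<integral>\<xi>. w \<xi> * p' t \<xi> \<partial>lborel)" by (simp only:)
  qed
  then show ?thesis by (simp add: DERIV_def p_def p'_def)
qed

lemma bump_translate: "bump n (a + s) (b + s) \<xi> = bump n a b (\<xi> - s)"
  by (simp add: bump_def algebra_simps)

text \<open>
  This is the fundamental theorem of calculus for a continuous function with a bounded weak
  derivative. Averaging \<open>u\<close> against a small bump \<open>\<phi>\<close> gives a differentiable function \<open>F\<close> of the position
  \<open>x + t *\<^sub>R v\<close> of the bump; its derivative is an average of \<open>g \<bullet> v\<close>, hence at most \<open>c\<close>, and \<open>F\<close> differs
  little from \<open>u\<close> by uniform continuity near the segment.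
\<close>

lemma increment_le_of_weak_gradient:
  fixes u :: "'a::euclidean_space \<Rightarrow> real"
  assumes \<Omega>: "open \<Omega>" and g: "has_weak_gradient \<Omega> u g" and u: "continuous_on \<Omega> u"
    and V: "open V" "V \<subseteq> \<Omega>" and bound: "AE y in lebesgue_on V. g y \<bullet> v \<le> c"
    and seg: "closed_segment x (x + v) \<subseteq> V"
  shows "u (x + v) - u x \<le> c"
proof (rule field_le_epsilon)
  fix \<eta> :: real assume \<eta>: "\<eta> > 0"
  have segc: "compact (closed_segment x (x + v))" by simp
  obtain e where e: "e > 0" "(\<Union>y\<in>closed_segment x (x + v). cball y e) \<subseteq> V"
    using compact_subset_open_imp_cball_epsilon_subset[OF segc V(1) seg] by blast
  define K where "K = (\<Union>y\<in>closed_segment x (x + v). cball y e)"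
  have "K = {y + h | y h. y \<in> closed_segment x (x + v) \<and> h \<in> cball 0 e}"
  proof (intro set_eqI iffI)
    fix z assume "z \<in> K"
    then obtain y where "y \<in> closed_segment x (x + v)" "dist y z \<le> e" by (auto simp: K_def)
    then show "z \<in> {y + h | y h. y \<in> closed_segment x (x + v) \<and> h \<in> cball 0 e}"
      by (intro CollectI exI[of _ y] exI[of _ "z - y"]) (auto simp: dist_norm norm_minus_commute)
  next
    fix z assume "z \<in> {y + h | y h. y \<in> closed_segment x (x + v) \<and> h \<in> cball 0 e}"
    then obtain y h where "z = y + h" "y \<in> closed_segment x (x + v)" "norm h \<le> e" by auto
    then show "z \<in> K" unfolding K_def by (intro UN_I[of y]) (auto simp: dist_norm)
  qed
  then have Kc: "compact K" using compact_sums[OF segc compact_cball[of 0 e]] by simp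
  have KV: "K \<subseteq> V" using e by (simp add: K_def)
  have uK: "continuous_on K u" using u KV V continuous_on_subset by blast
  have "uniformly_continuous_on K u" using compact_uniformly_continuous[OF uK Kc] .
  then obtain d where d: "d > 0" "\<And>y z. y \<in> K \<Longrightarrow> z \<in> K \<Longrightarrow> dist z y < d \<Longrightarrow> dist (u z) (u y) < \<eta> / 2"
    unfolding uniformly_continuous_on_def using \<eta> by (metis half_gt_zero)
  define \<rho> where "\<rho> = min e (d / 2)"
  have \<rho>: "\<rho> > 0" "\<rho> \<le> e" "\<rho> < d" using e d by (auto simp: \<rho>_def)
  obtain a b :: 'a where ab: "0 \<in> box a b" "box a b \<subseteq> ball 0 \<rho>"
    using rational_boxes[OF \<rho>(1), of 0] by blast
  have cab: "cbox a b \<subseteq> cball 0 \<rho>"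
  proof -
    have "cbox a b = closure (box a b)" using ab(1) by (intro closure_box[symmetric]) auto
    also have "\<dots> \<subseteq> closure (ball 0 \<rho>)" using ab(2) by (rule closure_mono)
    finally show ?thesis using \<rho> by simp
  qed
  define \<phi> where "\<phi> = bump 1 a b"
  define m where "m = integral\<^sup>L lborel \<phi>"
  have Ck: "Ck k \<phi>" for k by (simp add: \<phi>_def Ck_bump)
  have D: "(\<phi> has_derivative frechet_derivative \<phi> (at y)) (at y)" for y
    using Ck[of 1] by (simp add: frechet_derivative_works[symmetric])
  have c\<phi>: "continuous_on UNIV \<phi>" using Ck[of 0] by simp
  have Dsum: "frechet_derivative \<phi> (at y) v = (\<Sum>i\<in>Basis. (v \<bullet> i) * frechet_derivative \<phi> (at y) i)" for y
  proof -
    have l: "linear (frechet_derivative \<phi> (at y))" by (rule has_derivative_linear[OF D])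
    have "frechet_derivative \<phi> (at y) v = frechet_derivative \<phi> (at y) (\<Sum>i\<in>Basis. (v \<bullet> i) *\<^sub>R i)"
      by (simp add: euclidean_representation)
    then show ?thesis by (simp add: linear_sum[OF l] linear_cmul[OF l])
  qed
  have cD: "continuous_on UNIV (\<lambda>y. frechet_derivative \<phi> (at y) i)" if "i \<in> Basis" for i
    using Ck[of 1] that by simp
  have cDv: "continuous_on UNIV (\<lambda>y. frechet_derivative \<phi> (at y) v)"
    unfolding Dsum by (intro continuous_on_sum continuous_on_mult continuous_on_const cD)
  have off: "\<phi> y = 0" if "y \<notin> cbox a b" for y
    using that bump_eq_0_iff[of 1 a b y] box_subset_cbox[of a b] by (auto simp: \<phi>_def)
  have offD: "frechet_derivative \<phi> (at y) = (\<lambda>_. 0)" if "y \<notin> cbox a b" for y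
  proof (rule frechet_derivative_eqI)
    show "(\<phi> has_derivative (\<lambda>_. 0)) (at y)"
      by (rule has_derivative_transform_within_open[of "\<lambda>_. 0" _ _ _ "- cbox a b"])
         (use that off closed_cbox open_Compl in auto)
  qed
  obtain M where M: "\<bar>frechet_derivative \<phi> (at y) v\<bar> \<le> M" for y
  proof -
    have "bounded ((\<lambda>y. frechet_derivative \<phi> (at y) v) ` cbox a b)"
      by (rule compact_imp_bounded[OF compact_continuous_image[OF continuous_on_subset[OF cDv]]]) auto
    then obtain M where "\<And>y. y \<in> cbox a b \<Longrightarrow> \<bar>frechet_derivative \<phi> (at y) v\<bar> \<le> M" by (auto simp: bounded_iff)
    then have "\<bar>frechet_derivative \<phi> (at y) v\<bar> \<le> max 0 M" for y
      by (cases "y \<in> cbox a b") (auto simp: offD intro: max.coboundedI2)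
    then show ?thesis using that by blast
  qed
  have \<phi>i: "integrable lborel \<phi>"
  proof -
    have "integrable lborel (\<lambda>y. indicator (cbox a b) y *\<^sub>R \<phi> y)"
      by (intro borel_integrable_compact continuous_on_subset[OF c\<phi>]) auto
    moreover have "(\<lambda>y. indicator (cbox a b) y *\<^sub>R \<phi> y) = \<phi>" using off by (auto simp: indicator_def fun_eq_iff)
    ultimately show ?thesis by simp
  qed
  have mpos: "m > 0"
  proof -
    have "m \<ge> 0" unfolding m_def by (intro integral_nonneg_AE AE_I2) (simp add: \<phi>_def bump_nonneg)
    moreover have "m \<noteq> 0"
    proof
      assume "m = 0"
      then have "AE y in lborel. \<phi> y = 0"
        using integral_nonneg_eq_0_iff_AE[OF \<phi>i] by (simp add: m_def \<phi>_def bump_nonneg)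
      then have "AE y in lborel. y \<notin> box a b" by eventually_elim (simp add: \<phi>_def bump_eq_0_iff)
      then have "emeasure lborel (box a b) = 0"
        using AE_iff_measurable[of "box a b" lborel "\<lambda>y. y \<notin> box a b"] by auto
      then have "negligible (box a b)"
        by (simp add: negligible_iff_emeasure0)
      then have "box a b = {}" by (simp add: negligible_interval)
      then show False using ab by auto
    qed
    ultimately show ?thesis by simp
  qed
  define w where "w \<xi> = indicator K \<xi> * u \<xi>" for \<xi>
  have wi: "integrable lborel w"
    using borel_integrable_compact[OF Kc uK] by (simp add: w_def[abs_def])
  define F where "F t = (\<integral>\<xi>. w \<xi> * \<phi> (\<xi> - (x + t *\<^sub>R v)) \<partial>lborel)" for t
  have F': "(F has_field_derivative - (\<integral>\<xi>. w \<xi> * frechet_derivative \<phi> (at (\<xi> - (x + t *\<^sub>R v))) v \<partial>lborel)) (at t)" for t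
    unfolding F_def
    by (rule has_field_derivative_integral_translate[OF wi D cDv M, of 1]) (auto simp: \<phi>_def bump_nonneg bump_le_1)
  have inseg: "x + t *\<^sub>R v \<in> closed_segment x (x + v)" if "0 \<le> t" "t \<le> 1" for t
    using that by (auto simp: in_segment algebra_simps intro!: exI[of _ t])
  have insupp: "\<xi> \<in> K \<and> dist \<xi> (x + t *\<^sub>R v) \<le> \<rho>" if "0 \<le> t" "t \<le> 1" "\<xi> - (x + t *\<^sub>R v) \<in> cbox a b" for t \<xi>
  proof -
    have "norm (\<xi> - (x + t *\<^sub>R v)) \<le> \<rho>" using that cab by auto
    then have "dist (x + t *\<^sub>R v) \<xi> \<le> \<rho>" by (simp add: dist_norm norm_minus_commute)
    then show ?thesis unfolding K_def using inseg[OF that(1,2)] \<rho>(2)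
      by (auto simp: dist_commute intro!: bexI[of _ "x + t *\<^sub>R v"])
  qed
  have shift: "integral\<^sup>L lborel (\<lambda>\<xi>. \<phi> (\<xi> - s)) = m" "integrable lborel (\<lambda>\<xi>. \<phi> (\<xi> - s))" for s
    using lborel_integral_translate[OF \<phi>i, of "- s"] by (simp_all add: m_def)
  \<comment> \<open>Moving the derivative from the bump to \<open>u\<close> by the definition of the weak gradient.\<close>
  have deriv_le: "- (\<integral>\<xi>. w \<xi> * frechet_derivative \<phi> (at (\<xi> - (x + t *\<^sub>R v))) v \<partial>lborel) \<le> c * m"
    if t: "0 \<le> t" "t \<le> 1" for t
  proof -
    define s where "s = x + t *\<^sub>R v"
    define \<psi> where "\<psi> \<xi> = \<phi> (\<xi> - s)" for \<xi>
    have \<psi>: "\<psi> = bump 1 (a + s) (b + s)" by (auto simp: \<psi>_def \<phi>_def bump_translate)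
    have sub: "cbox (a + s) (b + s) \<subseteq> K"
    proof
      fix \<xi> assume "\<xi> \<in> cbox (a + s) (b + s)"
      then have "\<xi> - s \<in> cbox a b" by (auto simp: mem_box inner_simps)
      then show "\<xi> \<in> K" using insupp[OF t] by (simp add: s_def)
    qed
    have \<psi>t: "\<psi> \<in> test_functions \<Omega>" unfolding \<psi> by (rule bump_test_function) (use sub KV V in auto)
    have \<psi>i: "integrable lborel \<psi>" "integral\<^sup>L lborel \<psi> = m" using shift by (simp_all add: \<psi>_def[abs_def])
    have D\<psi>: "frechet_derivative \<psi> (at \<xi>) = frechet_derivative \<phi> (at (\<xi> - s))" for \<xi>
    proof (rule frechet_derivative_eqI)
      show "(\<psi> has_derivative frechet_derivative \<phi> (at (\<xi> - s))) (at \<xi>)"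
        unfolding \<psi>_def by (rule has_derivative_compose[where g = \<phi>, OF _ D]) (auto intro!: derivative_eq_intros)
    qed
    have \<Omega>s: "\<Omega> \<inter> space lebesgue \<in> sets lebesgue" using \<Omega> by auto
    have conv: "(\<integral>\<xi>. w \<xi> * frechet_derivative \<phi> (at (\<xi> - s)) i \<partial>lborel)
        = integral\<^sup>L (lebesgue_on \<Omega>) (\<lambda>\<xi>. u \<xi> * frechet_derivative \<psi> (at \<xi>) i)"
      and convi: "integrable lborel (\<lambda>\<xi>. w \<xi> * frechet_derivative \<phi> (at (\<xi> - s)) i)" if i: "i \<in> Basis" for i
    proof -
      have cDs: "continuous_on UNIV (\<lambda>\<xi>. frechet_derivative \<phi> (at (\<xi> - s)) i)"
        by (rule continuous_on_compose2[OF cD[OF i]]) (auto intro!: continuous_intros)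
      have "integrable lborel (\<lambda>\<xi>. indicator K \<xi> *\<^sub>R (u \<xi> * frechet_derivative \<phi> (at (\<xi> - s)) i))"
        by (intro borel_integrable_compact Kc continuous_on_mult uK continuous_on_subset[OF cDs]) auto
      then show int: "integrable lborel (\<lambda>\<xi>. w \<xi> * frechet_derivative \<phi> (at (\<xi> - s)) i)"
        by (simp add: w_def mult.assoc)
      have "(\<lambda>\<xi>. w \<xi> * frechet_derivative \<phi> (at (\<xi> - s)) i)
          = (\<lambda>\<xi>. indicator \<Omega> \<xi> *\<^sub>R (u \<xi> * frechet_derivative \<psi> (at \<xi>) i))"
      proof
        fix \<xi>
        show "w \<xi> * frechet_derivative \<phi> (at (\<xi> - s)) i = indicator \<Omega> \<xi> *\<^sub>R (u \<xi> * frechet_derivative \<psi> (at \<xi>) i)"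
        proof (cases "\<xi> - s \<in> cbox a b")
          case True
          then have "\<xi> \<in> K" using insupp[OF t] by (simp add: s_def)
          then show ?thesis using KV V by (auto simp: w_def D\<psi>)
        qed (simp add: D\<psi> offD)
      qed
      then show "(\<integral>\<xi>. w \<xi> * frechet_derivative \<phi> (at (\<xi> - s)) i \<partial>lborel)
          = integral\<^sup>L (lebesgue_on \<Omega>) (\<lambda>\<xi>. u \<xi> * frechet_derivative \<psi> (at \<xi>) i)"
        using int integral_completion[of "\<lambda>\<xi>. w \<xi> * frechet_derivative \<phi> (at (\<xi> - s)) i" lborel]
        by (simp add: integral_restrict_space[OF \<Omega>s])
    qed
    have gL: "g \<in> L1_loc \<Omega>" using g by (simp add: has_weak_gradient_def)
    have "(\<integral>\<xi>. w \<xi> * frechet_derivative \<phi> (at (\<xi> - s)) v \<partial>lborel)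
        = (\<integral>\<xi>. (\<Sum>i\<in>Basis. (v \<bullet> i) * (w \<xi> * frechet_derivative \<phi> (at (\<xi> - s)) i)) \<partial>lborel)"
      unfolding Dsum by (simp add: sum_distrib_left mult_ac)
    also have "\<dots> = (\<Sum>i\<in>Basis. (v \<bullet> i) * (\<integral>\<xi>. w \<xi> * frechet_derivative \<phi> (at (\<xi> - s)) i \<partial>lborel))"
      using convi by (simp add: Bochner_Integration.integral_sum)
    also have "\<dots> = (\<Sum>i\<in>Basis. (v \<bullet> i) * - integral\<^sup>L (lebesgue_on \<Omega>) (\<lambda>\<xi>. (g \<xi> \<bullet> i) * \<psi> \<xi>))"
      using g \<psi>t unfolding has_weak_gradient_def by (simp add: conv)
    also have "\<dots> = - (\<Sum>i\<in>Basis. integral\<^sup>L (lebesgue_on \<Omega>) (\<lambda>\<xi>. (v \<bullet> i) * ((g \<xi> \<bullet> i) * \<psi> \<xi>)))"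
      by (simp add: sum_negf)
    also have "\<dots> = - integral\<^sup>L (lebesgue_on \<Omega>) (\<lambda>\<xi>. \<Sum>i\<in>Basis. (v \<bullet> i) * ((g \<xi> \<bullet> i) * \<psi> \<xi>))"
      by (subst Bochner_Integration.integral_sum)
         (auto intro!: integrable_mult_right integrable_L1_loc_times_test[OF \<Omega> L1_loc_inner[OF gL] \<psi>t])
    also have "(\<lambda>\<xi>. \<Sum>i\<in>Basis. (v \<bullet> i) * ((g \<xi> \<bullet> i) * \<psi> \<xi>)) = (\<lambda>\<xi>. (g \<xi> \<bullet> v) * \<psi> \<xi>)"
      by (simp add: fun_eq_iff euclidean_inner[of "g _" v] sum_distrib_left mult_ac)
    finally have eq: "- (\<integral>\<xi>. w \<xi> * frechet_derivative \<phi> (at (\<xi> - s)) v \<partial>lborel)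
        = integral\<^sup>L (lebesgue_on \<Omega>) (\<lambda>\<xi>. (g \<xi> \<bullet> v) * \<psi> \<xi>)" by simp
    have ind: "(\<lambda>\<xi>. indicator \<Omega> \<xi> *\<^sub>R (c * \<psi> \<xi>)) = (\<lambda>\<xi>. c * \<psi> \<xi>)"
    proof
      fix \<xi> show "indicator \<Omega> \<xi> *\<^sub>R (c * \<psi> \<xi>) = c * \<psi> \<xi>"
      proof (cases "\<xi> - s \<in> cbox a b")
        case True
        then have "\<xi> \<in> K" using insupp[OF t] by (simp add: s_def)
        then show ?thesis using KV V by auto
      qed (simp add: \<psi>_def off)
    qed
    have cl: "integrable lebesgue (\<lambda>\<xi>. c * \<psi> \<xi>)" "integral\<^sup>L lebesgue (\<lambda>\<xi>. c * \<psi> \<xi>) = c * m"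
    proof -
      have i: "integrable lborel (\<lambda>\<xi>. c * \<psi> \<xi>)" using \<psi>i by auto
      then show "integrable lebesgue (\<lambda>\<xi>. c * \<psi> \<xi>)"
        using borel_measurable_integrable[OF i] by (simp add: integrable_completion del: integrable_mult_left_iff)
      show "integral\<^sup>L lebesgue (\<lambda>\<xi>. c * \<psi> \<xi>) = c * m"
        using integral_completion[OF borel_measurable_integrable[OF i]] \<psi>i by simp
    qed
    have "integral\<^sup>L (lebesgue_on \<Omega>) (\<lambda>\<xi>. (g \<xi> \<bullet> v) * \<psi> \<xi>) \<le> integral\<^sup>L (lebesgue_on \<Omega>) (\<lambda>\<xi>. c * \<psi> \<xi>)"
    proof (rule integral_mono_AE)
      show "integrable (lebesgue_on \<Omega>) (\<lambda>\<xi>. (g \<xi> \<bullet> v) * \<psi> \<xi>)"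
        by (rule integrable_L1_loc_times_test[OF \<Omega> L1_loc_inner[OF gL] \<psi>t])
      show "integrable (lebesgue_on \<Omega>) (\<lambda>\<xi>. c * \<psi> \<xi>)"
        using cl integrable_restrict_space[OF \<Omega>s, of "\<lambda>\<xi>. c * \<psi> \<xi>"] unfolding ind by blast
      have Vs: "V \<inter> space lebesgue \<in> sets lebesgue" using V by auto
      have "AE y in lebesgue. y \<in> V \<longrightarrow> g y \<bullet> v \<le> c"
        using bound by (subst (asm) AE_restrict_space_iff[OF Vs])
      then have "AE y in lebesgue. y \<in> \<Omega> \<longrightarrow> (g y \<bullet> v) * \<psi> y \<le> c * \<psi> y"
      proof eventually_elim
        case (elim y)
        show ?case
        proof (cases "y - s \<in> cbox a b")
          case True
          then have "y \<in> V" using insupp[OF t] KV by (auto simp: s_def)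
          then show ?thesis using elim by (auto intro!: mult_right_mono simp: \<psi> bump_nonneg)
        qed (simp add: \<psi>_def off)
      qed
      then show "AE y in lebesgue_on \<Omega>. (g y \<bullet> v) * \<psi> y \<le> c * \<psi> y"
        by (subst AE_restrict_space_iff[OF \<Omega>s])
    qed
    also have "\<dots> = c * m"
      using cl unfolding integral_restrict_space[OF \<Omega>s] ind by simp
    finally show ?thesis using eq by (simp add: s_def)
  qed
  have F01: "F 1 - F 0 \<le> c * m"
  proof -
    obtain t where t: "0 < t" "t < 1"
      "F 1 - F 0 = (1 - 0) * - (\<integral>\<xi>. w \<xi> * frechet_derivative \<phi> (at (\<xi> - (x + t *\<^sub>R v))) v \<partial>lborel)"
      using MVT2[OF zero_less_one, of F "\<lambda>t. - (\<integral>\<xi>. w \<xi> * frechet_derivative \<phi> (at (\<xi> - (x + t *\<^sub>R v))) v \<partial>lborel)"] F' by blast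
    then show ?thesis using deriv_le[of t] by simp
  qed
  have Fu: "\<bar>F t - u (x + t *\<^sub>R v) * m\<bar> \<le> \<eta> / 2 * m" if t: "0 \<le> t" "t \<le> 1" for t
  proof -
    define s where "s = x + t *\<^sub>R v"
    have sK: "s \<in> K" using inseg[OF t] e(1) by (force simp: K_def s_def)
    have le: "\<bar>w \<xi> * \<phi> (\<xi> - s) - u s * \<phi> (\<xi> - s)\<bar> \<le> \<eta> / 2 * \<phi> (\<xi> - s)" for \<xi>
    proof (cases "\<xi> - s \<in> cbox a b")
      case True
      then have "\<xi> \<in> K" "dist \<xi> s < d" using insupp[OF t] \<rho> by (force simp: s_def)+
      then have "\<bar>u \<xi> - u s\<bar> \<le> \<eta> / 2" using d(2)[OF sK, of \<xi>] by (simp add: dist_real_def)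
      then have "\<bar>u \<xi> - u s\<bar> * \<phi> (\<xi> - s) \<le> \<eta> / 2 * \<phi> (\<xi> - s)"
        by (intro mult_right_mono) (auto simp: \<phi>_def bump_nonneg)
      moreover have "\<bar>w \<xi> * \<phi> (\<xi> - s) - u s * \<phi> (\<xi> - s)\<bar> = \<bar>u \<xi> - u s\<bar> * \<phi> (\<xi> - s)"
        using \<open>\<xi> \<in> K\<close> by (simp add: w_def left_diff_distrib[symmetric] abs_mult \<phi>_def bump_nonneg)
      ultimately show ?thesis by simp
    qed (simp add: off)
    have wpi: "integrable lborel (\<lambda>\<xi>. w \<xi> * \<phi> (\<xi> - s))"
    proof (rule Bochner_Integration.integrable_bound[OF wi])
      have "(\<lambda>\<xi>. \<phi> (\<xi> - s)) \<in> borel_measurable borel"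
        by (rule borel_measurable_continuous_onI, rule continuous_on_compose2[OF c\<phi>]) (auto intro!: continuous_intros)
      then show "(\<lambda>\<xi>. w \<xi> * \<phi> (\<xi> - s)) \<in> borel_measurable lborel"
        using borel_measurable_integrable[OF wi] by (intro borel_measurable_times) auto
      show "AE \<xi> in lborel. norm (w \<xi> * \<phi> (\<xi> - s)) \<le> norm (w \<xi>)"
        unfolding \<phi>_def real_norm_def abs_mult abs_of_nonneg[OF bump_nonneg]
        by (intro AE_I2 mult_right_le_one_le bump_nonneg bump_le_1) auto
    qed
    have "F t - u s * m = (\<integral>\<xi>. w \<xi> * \<phi> (\<xi> - s) - u s * \<phi> (\<xi> - s) \<partial>lborel)"
      using wpi shift[of s] by (simp add: F_def s_def)
    also have "\<bar>\<dots>\<bar> \<le> (\<integral>\<xi>. \<bar>w \<xi> * \<phi> (\<xi> - s) - u s * \<phi> (\<xi> - s)\<bar> \<partial>lborel)"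
      by (rule integral_abs_bound)
    also have "\<dots> \<le> (\<integral>\<xi>. \<eta> / 2 * \<phi> (\<xi> - s) \<partial>lborel)"
      using wpi shift[of s] le by (intro integral_mono) auto
    also have "\<dots> = \<eta> / 2 * m" using shift[of s] by simp
    finally show ?thesis by (simp add: s_def)
  qed
  have "F 0 - u x * m \<le> \<eta> / 2 * m" using abs_le_D1[OF Fu[of 0]] by simp
  moreover have "u (x + v) * m - F 1 \<le> \<eta> / 2 * m" using abs_le_D2[OF Fu[of 1]] by simp
  ultimately have "u (x + v) * m - u x * m \<le> (c + \<eta>) * m"
    using F01 by (simp add: field_simps)
  then have "(u (x + v) - u x) * m \<le> (c + \<eta>) * m" by (simp add: algebra_simps)
  then show "u (x + v) - u x \<le> c + \<eta>" using mpos by simp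
qed

section \<open>Support functions of sublevel sets\<close>

definition support :: "('a::euclidean_space \<Rightarrow> real) \<Rightarrow> real \<Rightarrow> 'a \<Rightarrow> real" where
  "support H k y = (SUP p\<in>{p. H p \<le> k}. p \<bullet> y)"

text \<open>
  A maximizer in the definition of the support function. It will turn out to be unique for
  \<open>y \<noteq> 0\<close>, and to be the gradient at \<open>y\<close>.
\<close>

definition support_grad :: "('a::euclidean_space \<Rightarrow> real) \<Rightarrow> real \<Rightarrow> 'a \<Rightarrow> 'a" where
  "support_grad H k y = (SOME p. H p \<le> k \<and> p \<bullet> y = support H k y)"

locale hamiltonian =
  fixes H :: "'a::euclidean_space \<Rightarrow> real"
  assumes cont: "continuous_on UNIV H" and conv: "convex_on UNIV H" and superlinear: "superlinear H"
    and H_0: "H 0 = 0" and H_nonneg: "H p \<ge> 0"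
    and no_segment: "\<not> has_line_segment (H -` {c})"
begin

abbreviation "C \<equiv> support H"

lemma H_convex: "0 \<le> t \<Longrightarrow> t \<le> 1 \<Longrightarrow> H ((1 - t) *\<^sub>R p + t *\<^sub>R q) \<le> (1 - t) * H p + t * H q"
  using convex_onD[OF conv, of t p q] by auto

lemma compact_sublevel: "compact {p. H p \<le> k}"
proof -
  have "closed {p. H p \<le> k}"
    using continuous_closed_vimage[of "{..k}" H] cont continuous_on_eq_continuous_at[OF open_UNIV]
    by (auto simp: vimage_def)
  moreover have "bounded {p. H p \<le> k}"
  proof -
    have "eventually (\<lambda>p. \<bar>k\<bar> + 1 \<le> H p / norm p) at_infinity"
      using superlinear unfolding superlinear_def filterlim_at_top by blast
    then obtain b where b: "\<And>p. norm p \<ge> b \<Longrightarrow> \<bar>k\<bar> + 1 \<le> H p / norm p"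
      by (auto simp: eventually_at_infinity)
    have "norm p \<le> max b 1" if "H p \<le> k" for p
    proof (rule ccontr)
      assume "\<not> norm p \<le> max b 1"
      then have p: "norm p > 1" "norm p \<ge> b" by auto
      then have "(\<bar>k\<bar> + 1) * norm p \<le> H p" using b[of p] pos_le_divide_eq[of "norm p" "\<bar>k\<bar> + 1" "H p"] by linarith
      moreover have "(\<bar>k\<bar> + 1) * norm p \<ge> (\<bar>k\<bar> + 1) * 1" using p by (intro mult_left_mono) auto
      ultimately have "\<bar>k\<bar> + 1 \<le> H p" by (metis mult_1_right order_trans)
      then show False using that abs_ge_self[of k] by linarith
    qed
    then show ?thesis by (auto simp: bounded_iff)
  qed
  ultimately show ?thesis by (simp add: compact_eq_bounded_closed)
qed

lemma support_ge: "H p \<le> k \<Longrightarrow> p \<bullet> y \<le> C k y"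
  unfolding support_def
proof (rule cSUP_upper)
  have "compact ((\<lambda>p. p \<bullet> y) ` {p. H p \<le> k})"
    by (intro compact_continuous_image compact_sublevel continuous_intros)
  then show "bdd_above ((\<lambda>p. p \<bullet> y) ` {p. H p \<le> k})"
    by (simp add: bounded_imp_bdd_above compact_imp_bounded)
qed auto

lemma support_attained:
  assumes "k \<ge> 0"
  obtains p where "H p \<le> k" "C k y = p \<bullet> y"
proof -
  have "\<exists>p\<in>{p. H p \<le> k}. \<forall>q\<in>{p. H p \<le> k}. q \<bullet> y \<le> p \<bullet> y"
    using assms H_0 by (intro continuous_attains_sup compact_sublevel continuous_intros) (auto intro!: exI[of _ 0])
  then obtain p where p: "H p \<le> k" "\<And>q. H q \<le> k \<Longrightarrow> q \<bullet> y \<le> p \<bullet> y" by auto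
  have "C k y \<le> p \<bullet> y" unfolding support_def using p by (intro cSUP_least) auto
  then show ?thesis using that p(1) support_ge[OF p(1)] by (metis order_antisym)
qed

lemma support_mono: "0 \<le> k \<Longrightarrow> k \<le> k' \<Longrightarrow> C k y \<le> C k' y"
  by (metis support_attained support_ge order_trans)

lemma support_add: "k \<ge> 0 \<Longrightarrow> C k (x + y) \<le> C k x + C k y"
  by (metis support_attained support_ge inner_add_right add_mono)

lemma support_scaleR:
  assumes "k \<ge> 0" "t \<ge> 0" shows "C k (t *\<^sub>R y) = t * C k y"
proof (rule antisym)
  obtain p where "H p \<le> k" "C k (t *\<^sub>R y) = p \<bullet> (t *\<^sub>R y)" using support_attained assms by metis
  then show "C k (t *\<^sub>R y) \<le> t * C k y" using support_ge[of p k y] assms by (simp add: mult_left_mono)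
  obtain p where "H p \<le> k" "C k y = p \<bullet> y" using support_attained assms by metis
  then show "t * C k y \<le> C k (t *\<^sub>R y)" using support_ge[of p k "t *\<^sub>R y"] by simp
qed

lemma support_zero: "k \<ge> 0 \<Longrightarrow> C k 0 = 0"
  using support_scaleR[of k 0 0] by simp

lemma support_ball:
  assumes "\<And>h. norm h \<le> r \<Longrightarrow> H (f + h) \<le> k" "r \<ge> 0"
  shows "C k y \<ge> f \<bullet> y + r * norm y"
proof (cases "y = 0")
  case True
  then show ?thesis using support_ge[of f k 0] assms(1)[of 0] assms(2) by simp
next
  case False
  then have "H (f + (r / norm y) *\<^sub>R y) \<le> k" using assms by (intro assms(1)) auto
  from support_ge[OF this, of y] False show ?thesis
    by (simp add: inner_add_left dot_square_norm power2_eq_square)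
qed

lemma H_unif:
  assumes "e > 0"
  obtains r where "r > 0" "\<And>p q. norm p \<le> R \<Longrightarrow> norm (q - p) \<le> r \<Longrightarrow> \<bar>H q - H p\<bar> \<le> e"
proof -
  have "uniformly_continuous_on (cball 0 (R + 1)) H"
    by (intro compact_uniformly_continuous continuous_on_subset[OF cont]) auto
  then obtain d where d: "d > 0" "\<And>p q. norm p \<le> R + 1 \<Longrightarrow> norm q \<le> R + 1 \<Longrightarrow> dist q p < d \<Longrightarrow> dist (H q) (H p) < e"
    unfolding uniformly_continuous_on_def using assms by (metis mem_cball_0)
  show ?thesis
  proof (rule that[of "min (d / 2) 1"])
    fix p q :: 'a assume pq: "norm p \<le> R" "norm (q - p) \<le> min (d / 2) 1"
    have "norm q \<le> norm p + norm (q - p)" by (metis add_diff_cancel_left' diff_add_cancel norm_triangle_ineq add.commute)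
    then have "norm q \<le> R + 1" using pq by linarith
    moreover have "dist q p < d" using pq d(1) by (simp add: dist_norm)
    ultimately have "dist (H q) (H p) < e" using d(2)[of p q] pq by simp
    then show "\<bar>H q - H p\<bar> \<le> e" by (simp add: dist_real_def)
  qed (use d in auto)
qed

lemma sublevel_bound:
  obtains R where "R > 0" "\<And>p. H p \<le> k \<Longrightarrow> norm p \<le> R"
proof -
  have "bounded {p. H p \<le> k}" using compact_sublevel by (rule compact_imp_bounded)
  then show ?thesis using that unfolding bounded_pos by auto
qed

text \<open>
  A maximizer for level \<open>k\<close> can be moved by a fixed distance in any direction without leaving
  \<open>{H \<le> k'}\<close>, because \<open>H\<close> is uniformly continuous on compact sets.
\<close>

lemma support_strict_mono:
  assumes "0 \<le> k" "k < k'"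
  obtains r where "r > 0" "\<And>y. C k' y \<ge> C k y + r * norm y"
proof -
  obtain R where R: "\<And>p. H p \<le> k \<Longrightarrow> norm p \<le> R" using sublevel_bound by metis
  obtain r where r: "r > 0" "\<And>p q. norm p \<le> R \<Longrightarrow> norm (q - p) \<le> r \<Longrightarrow> \<bar>H q - H p\<bar> \<le> k' - k"
    using H_unif[of "k' - k" R] assms by auto
  have "C k' y \<ge> C k y + r * norm y" for y
  proof -
    obtain p where p: "H p \<le> k" "C k y = p \<bullet> y" using support_attained assms by metis
    have "H (p + h) \<le> k'" if "norm h \<le> r" for h :: 'a
      using r(2)[of p "p + h"] R[OF p(1)] p(1) that by auto
    from support_ball[OF this, where y = y] show ?thesis using r(1) p(2) by simp
  qed
  then show ?thesis using that r(1) by blast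
qed

text \<open>
  Convexity and \<open>H 0 = 0\<close> show that scaling by \<open>k' / k\<close> maps \<open>{H \<le> k}\<close> into \<open>{H \<le> k'}\<close>. This
  bounds how fast \<open>C k\<close> grows with \<open>k\<close>.
\<close>

lemma support_ratio:
  assumes "0 \<le> k'" "k' \<le> k" "0 < k"
  shows "C k' y \<ge> (k' / k) * C k y"
proof -
  obtain p where p: "H p \<le> k" "C k y = p \<bullet> y" using support_attained assms by (metis less_imp_le)
  have "H ((k' / k) *\<^sub>R p) \<le> (k' / k) * H p"
    using H_convex[of "k' / k" 0 p] assms H_0 by simp
  also have "\<dots> \<le> (k' / k) * k" using p assms by (intro mult_left_mono) auto
  finally have "H ((k' / k) *\<^sub>R p) \<le> k'" using assms by simp
  from support_ge[OF this, of y] show ?thesis using p by simp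
qed

lemma support_le_norm:
  assumes "k \<ge> 0" "\<And>p. H p \<le> k \<Longrightarrow> norm p \<le> R"
  shows "C k y \<le> R * norm y"
proof -
  obtain p where p: "H p \<le> k" "C k y = p \<bullet> y" using support_attained assms by metis
  have "p \<bullet> y \<le> norm p * norm y" by (rule norm_cauchy_schwarz)
  also have "\<dots> \<le> R * norm y" using assms p by (intro mult_right_mono) auto
  finally show ?thesis using p by simp
qed

lemma support_lipschitz:
  assumes "k \<ge> 0" "\<And>p. H p \<le> k \<Longrightarrow> norm p \<le> R"
  shows "\<bar>C k x - C k y\<bar> \<le> R * norm (x - y)"
  using support_add[of k "x - y" y] support_add[of k "y - x" x] assms
    support_le_norm[OF assms, of "x - y"] support_le_norm[OF assms, of "y - x"]
  by (simp add: norm_minus_commute)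

lemma continuous_support: "k \<ge> 0 \<Longrightarrow> continuous_on A (C k)"
proof -
  assume k: "k \<ge> 0"
  obtain R where R: "R > 0" "\<And>p. H p \<le> k \<Longrightarrow> norm p \<le> R" using sublevel_bound by metis
  have "R-lipschitz_on A (C k)"
    using support_lipschitz[OF k R(2)] R(1) by (intro lipschitz_onI) (auto simp: dist_norm)
  then show ?thesis by (rule lipschitz_on_continuous_on)
qed

text \<open>
  Sublevel sets exhaust the space, so cones can be made arbitrarily steep.
\<close>

lemma support_large:
  obtains k where "k > 0" "\<And>y. C k y \<ge> M * norm y"
proof -
  have "compact (H ` cball 0 \<bar>M\<bar>)" by (intro compact_continuous_image continuous_on_subset[OF cont]) auto
  then have "bounded (H ` cball 0 \<bar>M\<bar>)" by (rule compact_imp_bounded)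
  then obtain k where k: "k > 0" "\<And>p. norm p \<le> \<bar>M\<bar> \<Longrightarrow> \<bar>H p\<bar> \<le> k" unfolding bounded_pos by auto
  have "C k y \<ge> M * norm y" for y
  proof -
    have "C k y \<ge> 0 \<bullet> y + \<bar>M\<bar> * norm y" using k by (intro support_ball) (auto simp: abs_le_iff)
    moreover have "M * norm y \<le> \<bar>M\<bar> * norm y" by (intro mult_right_mono) auto
    ultimately show ?thesis by simp
  qed
  then show ?thesis using that k(1) by blast
qed

lemma support_grad:
  assumes "k \<ge> 0"
  shows "H (support_grad H k y) \<le> k" "support_grad H k y \<bullet> y = C k y"
proof -
  have "\<exists>p. H p \<le> k \<and> p \<bullet> y = C k y" using support_attained[OF assms] by metis
  from someI_ex[OF this] show "H (support_grad H k y) \<le> k" "support_grad H k y \<bullet> y = C k y"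
    unfolding support_grad_def by auto
qed

text \<open>
  On the segment between two maximizers all points maximize. Some point of it is not on the level
  \<open>k\<close>, so it lies strictly inside the sublevel set and can be moved in direction \<open>y\<close>.
\<close>

lemma support_maximizer_unique:
  assumes k: "k > 0" and y: "y \<noteq> 0" and p: "H p \<le> k" "p \<bullet> y = C k y" and q: "H q \<le> k" "q \<bullet> y = C k y"
  shows "p = q"
proof (rule ccontr)
  assume "p \<noteq> q"
  then obtain m where m: "m \<in> closed_segment p q" "H m \<noteq> k"
    using no_segment[of k] by (auto simp: has_line_segment_def subset_iff vimage_def)
  then obtain t where t: "0 \<le> t" "t \<le> 1" "m = (1 - t) *\<^sub>R p + t *\<^sub>R q" by (auto simp: in_segment)
  have "(1 - t) * H p + t * H q \<le> (1 - t) * k + t * k" using t p q by (intro add_mono mult_left_mono) auto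
  moreover have "(1 - t) * k + t * k = k" by (simp add: algebra_simps)
  ultimately have "H m \<le> k" using H_convex[of t p q, folded t(3)] t by linarith
  then have mk: "H m < k" using m by simp
  have my: "m \<bullet> y = C k y" unfolding t(3) inner_add_left inner_scaleR_left p(2) q(2) by (simp add: algebra_simps)
  obtain r where r: "r > 0" "\<And>y. C k y \<ge> C (H m) y + r * norm y"
    using support_strict_mono[OF H_nonneg mk] by blast
  have "C (H m) y \<ge> m \<bullet> y" by (rule support_ge) simp
  moreover have "r * norm y > 0" using r y by simp
  ultimately show False using r(2)[of y] my by linarith
qed

text \<open>
  Away from the unique maximizer \<open>support_grad H k y\<close> the values \<open>p \<bullet> y\<close> stay below the maximum by a
  definite amount, which a small change of \<open>y\<close> cannot make up for.
\<close>

lemma continuous_support_grad: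
  assumes k: "k > 0"
  shows "continuous_on (- {0}) (support_grad H k)"
proof (rule continuous_at_imp_continuous_on, rule ballI)
  fix y :: 'a assume "y \<in> - {0}"
  then have y: "y \<noteq> 0" by simp
  let ?p = "support_grad H k y"
  obtain R where R: "R > 0" "\<And>p. H p \<le> k \<Longrightarrow> norm p \<le> R" using sublevel_bound by metis
  show "isCont (support_grad H k) y"
    unfolding continuous_at_eps_delta
  proof (intro allI impI)
    fix e :: real assume e: "e > 0"
    let ?T = "{p. H p \<le> k} - ball ?p e"
    have cT: "compact ?T" by (intro compact_diff compact_sublevel) auto
    obtain \<mu> where \<mu>: "\<mu> > 0" "\<And>p. p \<in> ?T \<Longrightarrow> p \<bullet> y \<le> C k y - \<mu>"
    proof (cases "?T = {}")
      case True show ?thesis by (rule that[of 1], simp, simp only: True empty_iff)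
    next
      case False
      obtain q where q: "q \<in> ?T" "\<And>p. p \<in> ?T \<Longrightarrow> p \<bullet> y \<le> q \<bullet> y"
      proof -
        have "continuous_on ?T (\<lambda>p. p \<bullet> y)" by (intro continuous_intros)
        from continuous_attains_sup[OF cT False this] show ?thesis using that by blast
      qed
      have "q \<bullet> y \<noteq> C k y"
        using support_maximizer_unique[OF k y, of q ?p] support_grad[of k y] k q(1) e by auto
      then have "q \<bullet> y < C k y" using support_ge[of q k y] q(1) by auto
      then show ?thesis using that[of "C k y - q \<bullet> y"] q by auto
    qed
    show "\<exists>d>0. \<forall>x'. dist x' y < d \<longrightarrow> dist (support_grad H k x') ?p < e"
    proof (intro exI conjI allI impI)
      show "\<mu> / (2 * R) > 0" using \<mu> R by simp
      fix x' assume x': "dist x' y < \<mu> / (2 * R)"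
      let ?q = "support_grad H k x'"
      have q: "H ?q \<le> k" "?q \<bullet> x' = C k x'" using support_grad k by auto
      have "\<bar>?q \<bullet> (x' - y)\<bar> \<le> norm ?q * norm (x' - y)" by (rule Cauchy_Schwarz_ineq2)
      also have "\<dots> \<le> R * norm (x' - y)" using R q by (intro mult_right_mono) auto
      finally have a: "\<bar>?q \<bullet> (x' - y)\<bar> \<le> R * norm (x' - y)" .
      have "C k x' \<ge> C k y - R * norm (x' - y)" using support_lipschitz[OF _ R(2), of k x' y] k by auto
      then have "?q \<bullet> y \<ge> C k y - 2 * (R * norm (x' - y))"
        using a q by (auto simp: inner_diff_right)
      moreover have "2 * (R * norm (x' - y)) < \<mu>"
        using x' R by (simp add: dist_norm field_simps)
      ultimately have "?q \<notin> ?T" using \<mu>(2)[of ?q] by auto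
      then show "dist ?q ?p < e" using q by (auto simp: dist_commute)
    qed
  qed
qed

text \<open>
  Comparing the maximizers at \<open>y\<close> and at \<open>y + h\<close> bounds the error of linear approximation by
  the variation of \<open>support_grad\<close>, which is continuous.
\<close>

lemma has_derivative_support:
  assumes k: "k > 0" and y: "y \<noteq> 0"
  shows "(C k has_derivative (\<lambda>h. support_grad H k y \<bullet> h)) (at y)"
  unfolding has_derivative_at
proof (intro conjI)
  show "bounded_linear (\<lambda>h. support_grad H k y \<bullet> h)" by (rule bounded_linear_inner_right)
  let ?g = "support_grad H k"
  have "(\<lambda>h. ?g (y + h)) \<midarrow>0\<rightarrow> ?g y"
  proof -
    have "isCont ?g y"
      using continuous_support_grad[OF k] y continuous_on_eq_continuous_at[of "- {0}" ?g] by (simp add: open_Compl)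
    then show ?thesis by (simp add: isCont_iff)
  qed
  then have A: "(\<lambda>h. norm (?g (y + h) - ?g y)) \<midarrow>0\<rightarrow> 0"
    using tendsto_norm_zero LIM_zero by blast
  have B: "norm (C k (y + h) - C k y - ?g y \<bullet> h) / norm h \<le> norm (?g (y + h) - ?g y)" for h
  proof (cases "h = 0")
    case False
    have lower: "C k (y + h) \<ge> ?g y \<bullet> (y + h)" using support_ge support_grad k by (simp add: less_imp_le)
    have "C k y \<ge> ?g (y + h) \<bullet> y" using support_ge support_grad k by (simp add: less_imp_le)
    then have "C k (y + h) - C k y - ?g y \<bullet> h \<le> (?g (y + h) - ?g y) \<bullet> h"
      using support_grad(2)[of k "y + h"] k by (simp add: inner_add_right inner_diff_left)
    also have "\<dots> \<le> norm (?g (y + h) - ?g y) * norm h" by (rule norm_cauchy_schwarz)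
    finally have "norm (C k (y + h) - C k y - ?g y \<bullet> h) \<le> norm (?g (y + h) - ?g y) * norm h"
      using lower support_grad(2)[of k y] k by (simp add: inner_add_right)
    then show ?thesis using False by (simp add: divide_le_eq)
  qed simp
  show "(\<lambda>h. norm (C k (y + h) - C k y - ?g y \<bullet> h) / norm h) \<midarrow>0\<rightarrow> 0"
  proof (rule Lim_null_comparison[OF _ A])
    have "norm (norm (C k (y + h) - C k y - ?g y \<bullet> h) / norm h) \<le> norm (?g (y + h) - ?g y)" for h
      using B[of h] by simp
    then show "\<forall>\<^sub>F h in at 0. norm (norm (C k (y + h) - C k y - ?g y \<bullet> h) / norm h) \<le> norm (?g (y + h) - ?g y)"
      by (simp only: always_eventually simp_thms)
  qed
qed

end

text \<open>
  If \<open>u\<close> minimizes for \<open>H\<close>, then \<open>-u\<close> minimizes for the reflected Hamiltonian. All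
  one-sided statements are proved for \<open>u\<close> and transferred along this symmetry.
\<close>

lemma (in hamiltonian) hamiltonian_reflect: "hamiltonian (\<lambda>p. H (- p))"
proof
  show "continuous_on UNIV (\<lambda>p. H (- p))"
    by (intro continuous_on_compose2[OF cont] continuous_intros) auto
  show "convex_on UNIV (\<lambda>p. H (- p))"
  proof (rule convex_onI)
    fix t :: real and x y :: 'a assume "0 < t" "t < 1"
    then show "H (- ((1 - t) *\<^sub>R x + t *\<^sub>R y)) \<le> (1 - t) * H (- x) + t * H (- y)"
      using H_convex[of t "- x" "- y"] by (simp add: algebra_simps)
  qed auto
  have "filterlim (\<lambda>p::'a. - p) at_infinity at_infinity"
    by (rule filterlim_norm_at_top_imp_at_infinity) (simp add: filterlim_at_infinity_imp_norm_at_top filterlim_ident)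
  from filterlim_compose[OF superlinear[unfolded superlinear_def] this]
  show "superlinear (\<lambda>p. H (- p))" by (simp add: superlinear_def)
  show "\<not> has_line_segment ((\<lambda>p. H (- p)) -` {c})" for c
  proof
    assume "has_line_segment ((\<lambda>p. H (- p)) -` {c})"
    then obtain a b where ab: "a \<noteq> b" "closed_segment a b \<subseteq> (\<lambda>p. H (- p)) -` {c}"
      by (auto simp: has_line_segment_def)
    have "closed_segment (- a) (- b) \<subseteq> H -` {c}"
    proof
      fix p assume "p \<in> closed_segment (- a) (- b)"
      then obtain t where "0 \<le> t" "t \<le> 1" "p = (1 - t) *\<^sub>R (- a) + t *\<^sub>R (- b)" by (auto simp: in_segment)
      then have "- p \<in> closed_segment a b" by (auto simp: in_segment)
      then show "p \<in> H -` {c}" using ab by auto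
    qed
    then show False using no_segment[of c] ab unfolding has_line_segment_def by (metis neg_equal_iff_equal)
  qed
qed (auto simp: H_0 H_nonneg)

lemma support_reflect: "support (\<lambda>p. H (- p)) k y = support H k (- y)"
proof -
  have "(\<lambda>p. p \<bullet> y) ` {p. H (- p) \<le> k} = (\<lambda>p. p \<bullet> (- y)) ` {p. H p \<le> k}"
  proof (intro set_eqI iffI)
    fix t assume "t \<in> (\<lambda>p. p \<bullet> y) ` {p. H (- p) \<le> k}"
    then obtain p where "H (- p) \<le> k" "t = p \<bullet> y" by auto
    then show "t \<in> (\<lambda>p. p \<bullet> (- y)) ` {p. H p \<le> k}" by (intro image_eqI[of _ _ "- p"]) auto
  next
    fix t assume "t \<in> (\<lambda>p. p \<bullet> (- y)) ` {p. H p \<le> k}"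
    then obtain p where "H p \<le> k" "t = p \<bullet> (- y)" by auto
    then show "t \<in> (\<lambda>p. p \<bullet> y) ` {p. H (- p) \<le> k}" by (intro image_eqI[of _ _ "- p"]) auto
  qed
  then show ?thesis by (simp add: support_def)
qed

section \<open>Absolute minimizers and comparison with cones\<close>

text \<open>
  A continuously differentiable competitor \<open>G\<close> with \<open>H (DG) \<le> k\<close> forces \<open>H (Du) \<le> k\<close> almost
  everywhere on \<open>V\<close>, so that \<open>Du \<bullet> (y - x) \<le> C k (y - x)\<close> almost everywhere.
\<close>

lemma AM_increment_le:
  fixes H :: "'a::euclidean_space \<Rightarrow> real"
  assumes ham: "hamiltonian H" and \<Omega>: "open \<Omega>" and u: "u \<in> AM H \<Omega>"
    and V: "open V" "compact (closure V)" "closure V \<subseteq> \<Omega>"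
    and D: "\<And>x. x \<in> V \<Longrightarrow> (G has_derivative (\<lambda>h. DG x \<bullet> h)) (at x)"
    and contD: "continuous_on V DG" and contG: "continuous_on (closure V) G"
    and k: "\<And>x. x \<in> V \<Longrightarrow> H (DG x) \<le> k"
    and bd: "\<And>x. x \<in> frontier V \<Longrightarrow> G x = u x"
    and seg: "closed_segment x y \<subseteq> V"
  shows "u y - u x \<le> support H k (y - x)"
proof -
  interpret hamiltonian H by (rule ham)
  have cV: "continuous_on V G" by (rule continuous_on_subset[OF contG closure_subset])
  have wG: "has_weak_gradient V G DG" by (rule has_weak_gradient_C1[OF V(1) D contD])
  then have "has_weak_gradient V G (weak_gradient V G)"
    unfolding weak_gradient_def by (rule someI[of "has_weak_gradient V G"])
  note gw = this weak_gradient_unique[OF V(1) this wG]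
  have G1: "G \<in> W1inf_loc V"
    using wG Linf_loc_continuous[OF V(1) cV] Linf_loc_continuous[OF V(1) contD] by (auto simp: W1inf_loc_def)
  have Vs: "V \<inter> space lebesgue \<in> sets lebesgue" using V by auto
  have "esssup (lebesgue_on V) (\<lambda>x. ereal (H (weak_gradient V G x))) \<le> ereal k"
  proof (rule esssup_I)
    have m: "weak_gradient V G \<in> borel_measurable (lebesgue_on V)"
      using gw(1) by (auto simp: has_weak_gradient_def L1_loc_def)
    have "H \<in> borel_measurable borel" using cont by (rule borel_measurable_continuous_onI)
    from measurable_compose[OF m this] show "(\<lambda>x. ereal (H (weak_gradient V G x))) \<in> borel_measurable (lebesgue_on V)"
      by measurable
    have "AE x in lebesgue_on V. x \<in> V" using AE_space[of "lebesgue_on V"] by (simp add: space_restrict_space)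
    with gw(2) show "AE x in lebesgue_on V. ereal (H (weak_gradient V G x)) \<le> ereal k"
      by eventually_elim (simp add: k)
  qed
  moreover have "esssup (lebesgue_on V) (\<lambda>x. ereal (H (weak_gradient \<Omega> u x)))
      \<le> esssup (lebesgue_on V) (\<lambda>x. ereal (H (weak_gradient V G x)))"
    using u V G1 contG bd unfolding AM_def by blast
  ultimately have "esssup (lebesgue_on V) (\<lambda>x. ereal (H (weak_gradient \<Omega> u x))) \<le> ereal k"
    by (rule order_trans[rotated])
  then have "ereal (H (weak_gradient \<Omega> u x)) \<le> ereal k"
    if "ereal (H (weak_gradient \<Omega> u x)) \<le> esssup (lebesgue_on V) (\<lambda>x. ereal (H (weak_gradient \<Omega> u x)))" for x
    using that by (rule order_trans[rotated])
  with esssup_AE[of "\<lambda>x. ereal (H (weak_gradient \<Omega> u x))" "lebesgue_on V"]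
  have Hk: "AE x in lebesgue_on V. ereal (H (weak_gradient \<Omega> u x)) \<le> ereal k"
    by (rule eventually_mono)
  have "\<exists>g. has_weak_gradient \<Omega> u g" using u by (auto simp: AM_def W1inf_loc_def)
  then have wu: "has_weak_gradient \<Omega> u (weak_gradient \<Omega> u)"
    unfolding weak_gradient_def by (rule someI_ex)
  have uc: "continuous_on \<Omega> u" using u by (simp add: AM_def)
  have VO: "V \<subseteq> \<Omega>" using V closure_subset by blast
  have "u (x + (y - x)) - u x \<le> support H k (y - x)"
  proof (rule increment_le_of_weak_gradient[OF \<Omega> wu uc V(1) VO])
    show "AE z in lebesgue_on V. weak_gradient \<Omega> u z \<bullet> (y - x) \<le> support H k (y - x)"
      using Hk by eventually_elim (simp add: support_ge)
  qed (use seg in simp)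
  then show ?thesis by simp
qed

text \<open>
  The conclusion of the previous lemma, isolated because it is stable under the reflection
  \<open>(H, u) \<mapsto> (p \<mapsto> H (-p), -u)\<close> without any reference to weak gradients.
\<close>

definition increment_bound :: "('a::euclidean_space \<Rightarrow> real) \<Rightarrow> 'a set \<Rightarrow> ('a \<Rightarrow> real) \<Rightarrow> bool" where
  "increment_bound H \<Omega> u \<longleftrightarrow> continuous_on \<Omega> u \<and>
    (\<forall>V G DG k x y. open V \<and> compact (closure V) \<and> closure V \<subseteq> \<Omega> \<and>
       (\<forall>x\<in>V. (G has_derivative (\<lambda>h. DG x \<bullet> h)) (at x) \<and> H (DG x) \<le> k) \<and>
       continuous_on V DG \<and> continuous_on (closure V) G \<and> (\<forall>x\<in>frontier V. G x = u x) \<and>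
       closed_segment x y \<subseteq> V \<longrightarrow> u y - u x \<le> support H k (y - x))"

lemma increment_bound_reflect:
  assumes "increment_bound H \<Omega> u"
  shows "increment_bound (\<lambda>p. H (- p)) \<Omega> (\<lambda>x. - u x)"
  unfolding increment_bound_def
proof (intro conjI allI impI, goal_cases)
  case 1
  then show ?case using assms by (auto simp: increment_bound_def intro: continuous_on_minus)
next
  case (2 V G DG k x y)
  have "u x - u y \<le> support H k (x - y)"
  proof (rule assms[unfolded increment_bound_def, THEN conjunct2, rule_format,
        of V "\<lambda>x. - G x" "\<lambda>x. - DG x"], intro conjI ballI)
    fix x assume x: "x \<in> V"
    have "((\<lambda>x. - G x) has_derivative (\<lambda>h. - (DG x \<bullet> h))) (at x)"
      using 2 x by (intro has_derivative_minus) blast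
    then show "((\<lambda>x. - G x) has_derivative (\<lambda>h. - DG x \<bullet> h)) (at x)" by simp
    show "H (- DG x) \<le> k" using 2 x by blast
  next
    show "closed_segment y x \<subseteq> V" using 2 by (simp add: closed_segment_commute)
    show "continuous_on V (\<lambda>x. - DG x)" "continuous_on (closure V) (\<lambda>x. - G x)"
      using 2 by (auto intro: continuous_on_minus)
  qed (use 2 in auto)
  then show ?case by (simp add: support_reflect)
qed

text \<open>
  Comparison with cones from above. Comparison from below is the same property of \<open>-u\<close> for the
  reflected Hamiltonian.
\<close>

definition cone_comparison :: "('a::euclidean_space \<Rightarrow> real) \<Rightarrow> 'a set \<Rightarrow> ('a \<Rightarrow> real) \<Rightarrow> bool" where
  "cone_comparison H \<Omega> u \<longleftrightarrow> continuous_on \<Omega> u \<and>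
    (\<forall>V z c k. open V \<and> compact (closure V) \<and> closure V \<subseteq> \<Omega> \<and> z \<notin> V \<and> k > 0 \<and>
       (\<forall>x\<in>frontier V. u x \<le> c + support H k (x - z)) \<longrightarrow>
       (\<forall>x\<in>V. u x \<le> c + support H k (x - z)))"

lemma segment_exit_point:
  fixes x z :: "'a::euclidean_space"
  assumes "open W" "x \<in> W" "z \<notin> W"
  obtains y where "y \<in> frontier W" "y \<in> closed_segment x z" "open_segment x y \<subseteq> W"
proof -
  let ?S = "closed_segment x z - W"
  have cS: "compact ?S" by (intro compact_diff compact_segment assms(1))
  have "z \<in> ?S" using assms by simp
  then obtain y where y: "y \<in> ?S" "\<And>w. w \<in> ?S \<Longrightarrow> dist x y \<le> dist x w"
    using distance_attains_inf[of ?S x] compact_imp_closed[OF cS] by blast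
  have oW: "w \<in> W" if "w \<in> open_segment x y" for w
  proof (rule ccontr)
    assume "w \<notin> W"
    have "w \<in> closed_segment x z"
      using that y(1) by (meson DiffD1 ends_in_segment(1) open_closed_segment subset_closed_segment subsetD)
    then have "dist x y \<le> dist x w" using y(2) \<open>w \<notin> W\<close> by blast
    moreover have "dist x w < dist x y" using dist_in_open_segment[OF that] by (simp add: dist_commute)
    ultimately show False by simp
  qed
  have xy: "x \<noteq> y" using y assms by auto
  have "y \<in> closure (open_segment x y)" using xy by (simp add: closure_open_segment)
  then have "y \<in> closure W" using oW closure_mono[of "open_segment x y" W] by blast
  then have "y \<in> frontier W" using y(1) assms(1) by (simp add: frontier_def interior_open)
  then show ?thesis using that y(1) oW by blast
qed

text \<open>
  Where \<open>u\<close> exceeds the cone, the cone itself is a competitor with the same boundary values. Hence on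
  that set \<open>u\<close> grows by at most \<open>C k\<close>; going from an excess point \<open>x\<close> towards the vertex \<open>z\<close> until
  the set is left, \<open>u\<close> cannot decrease more than the cone does, because \<open>C k\<close> is additive along rays.
  The vertex is outside the set, so the cone is continuously differentiable there.
\<close>

lemma (in hamiltonian) increment_bound_imp_cone_comparison:
  assumes \<Omega>: "open \<Omega>" and u: "increment_bound H \<Omega> u"
  shows "cone_comparison H \<Omega> u"
  unfolding cone_comparison_def
proof (intro conjI allI impI ballI)
  show uc: "continuous_on \<Omega> u" using u by (simp add: increment_bound_def)
  fix V z c k x
  assume *: "open V \<and> compact (closure V) \<and> closure V \<subseteq> \<Omega> \<and> z \<notin> V \<and> 0 < k \<and>
    (\<forall>x\<in>frontier V. u x \<le> c + C k (x - z))" and x: "x \<in> V"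
  then have V: "open V" "compact (closure V)" "closure V \<subseteq> \<Omega>" "z \<notin> V" and k: "k > 0"
    and bd: "\<And>x. x \<in> frontier V \<Longrightarrow> u x \<le> c + C k (x - z)" by auto
  let ?G = "\<lambda>x. c + C k (x - z)"
  have Gc: "continuous_on A ?G" for A
    using k by (intro continuous_intros continuous_on_compose2[OF continuous_support[of k UNIV]]) auto
  define W where "W = {x \<in> V. ?G x < u x}"
  have VO: "V \<subseteq> \<Omega>" using V closure_subset by blast
  have oW: "open W"
  proof -
    obtain A where "open A" "A \<inter> V = W"
      using open_Collect_less_Int[OF Gc continuous_on_subset[OF uc VO]] unfolding W_def by blast
    then show ?thesis using V(1) open_Int by metis
  qed
  have clW: "closure W \<subseteq> closure V" by (rule closure_mono) (auto simp: W_def)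
  have cW: "compact (closure W)" using compact_Int_closed[OF V(2) closed_closure[of W]] clW by (simp add: Int_absorb1)
  have eq: "?G y = u y" if y: "y \<in> frontier W" for y
  proof -
    have ycl: "y \<in> closure W" and yW: "y \<notin> W" using y oW by (auto simp: frontier_def interior_open)
    have "closure W \<subseteq> {x \<in> closure V. ?G x \<le> u x}"
    proof (rule closure_minimal)
      show "W \<subseteq> {x \<in> closure V. ?G x \<le> u x}" using closure_subset by (auto simp: W_def)
      show "closed {x \<in> closure V. ?G x \<le> u x}"
        by (intro continuous_on_closed_Collect_le Gc continuous_on_subset[OF uc V(3)]) auto
    qed
    then have le: "y \<in> closure V" "?G y \<le> u y" using ycl by auto
    show ?thesis
    proof (cases "y \<in> V")
      case True
      then show ?thesis using yW le by (auto simp: W_def)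
    next
      case False
      then have "y \<in> frontier V" using le V(1) by (simp add: frontier_def interior_open)
      then show ?thesis using bd le by fastforce
    qed
  qed
  show "u x \<le> ?G x"
  proof (rule ccontr)
    assume "\<not> u x \<le> ?G x"
    then have xW: "x \<in> W" using x by (simp add: W_def)
    have zW: "z \<notin> W" using V(4) by (simp add: W_def)
    obtain y where y: "y \<in> frontier W" "y \<in> closed_segment x z" "open_segment x y \<subseteq> W"
      using segment_exit_point[OF oW xW zW] by blast
    have inc: "u x - u w \<le> C k (x - w)" if w: "w \<in> open_segment x y" for w
    proof (rule u[unfolded increment_bound_def, THEN conjunct2, rule_format,
          of W ?G "\<lambda>x. support_grad H k (x - z)"], intro conjI ballI)
      show "open W" "compact (closure W)" by (rule oW, rule cW)
      show "closure W \<subseteq> \<Omega>" using clW V(3) by blast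
      show "(?G has_derivative (\<lambda>h. support_grad H k (x - z) \<bullet> h)) (at x)" if "x \<in> W" for x
      proof -
        have nz: "x - z \<noteq> 0" using that zW by auto
        have "((\<lambda>x. C k (x - z)) has_derivative (\<lambda>h. support_grad H k (x - z) \<bullet> h)) (at x)"
          by (rule has_derivative_compose[where f = "\<lambda>x. x - z" and f' = "\<lambda>h. h" and g = "C k"
                and g' = "\<lambda>h. support_grad H k (x - z) \<bullet> h"])
             (auto intro!: derivative_eq_intros has_derivative_support[OF k nz])
        then show ?thesis by (auto intro!: derivative_eq_intros)
      qed
      show "continuous_on W (\<lambda>x. support_grad H k (x - z))"
        by (rule continuous_on_compose2[OF continuous_support_grad[OF k]]) (use zW in \<open>auto intro!: continuous_intros\<close>)
      show "H (support_grad H k (x - z)) \<le> k" for x using support_grad k by simp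
      show "continuous_on (closure W) ?G" by (rule Gc)
      show "?G x = u x" if "x \<in> frontier W" for x using eq that by simp
      show "closed_segment w x \<subseteq> W"
      proof -
        have "w \<in> closed_segment x y" using w by (auto simp: open_segment_def)
        have "closed_segment w x \<subseteq> insert x (open_segment x y)"
        proof
          fix p assume "p \<in> closed_segment w x"
          then obtain t where t: "0 \<le> t" "t \<le> 1" "p = (1 - t) *\<^sub>R w + t *\<^sub>R x" by (auto simp: in_segment)
          obtain s where s: "0 < s" "s < 1" "w = (1 - s) *\<^sub>R x + s *\<^sub>R y" "x \<noteq> y"
            using w unfolding in_segment(2) by blast
          have p: "p = (1 - (1 - t) * s) *\<^sub>R x + ((1 - t) * s) *\<^sub>R y" by (simp add: t s algebra_simps)
          show "p \<in> insert x (open_segment x y)"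
          proof (cases "t = 1")
            case False
            then have "0 < (1 - t) * s" using t s by simp
            moreover have "(1 - t) * s < 1" using t s by (smt (verit) mult_left_le_one_le)
            ultimately show ?thesis unfolding p using s(4) by (auto simp: in_segment)
          qed (simp add: t)
        qed
        then show ?thesis using y(3) xW by blast
      qed
    qed
    have xy: "x \<noteq> y" using y(1) xW oW by (auto simp: frontier_def interior_open)
    \<comment> \<open>The exit point \<open>y\<close> itself is reached by continuity.\<close>
    have "u x - u y \<le> C k (x - y)"
    proof -
      define s where "s n = y + inverse (real (Suc (Suc n))) *\<^sub>R (x - y)" for n
      have sl: "s \<longlonglongrightarrow> y"
      proof -
        have "(\<lambda>n. inverse (real (Suc (Suc n)))) \<longlonglongrightarrow> 0"
          using LIMSEQ_inverse_real_of_nat by (rule LIMSEQ_Suc)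
        then have "s \<longlonglongrightarrow> y + 0 *\<^sub>R (x - y)" unfolding s_def by (intro tendsto_intros)
        then show ?thesis by simp
      qed
      have so: "s n \<in> open_segment x y" for n
      proof -
        have "0 < inverse (real (Suc (Suc n)))" "inverse (real (Suc (Suc n))) < 1" by (auto simp: field_simps)
        moreover have "s n = (1 - (1 - inverse (real (Suc (Suc n))))) *\<^sub>R x + (1 - inverse (real (Suc (Suc n)))) *\<^sub>R y"
          by (simp add: s_def algebra_simps)
        ultimately show ?thesis using xy unfolding in_segment(2) by (metis diff_gt_0_iff_gt diff_less_eq less_add_same_cancel1)
      qed
      have yO: "y \<in> \<Omega>" using y(1) clW V(3) by (auto simp: frontier_def)
      have "isCont u y" using uc \<Omega> yO by (simp add: continuous_on_eq_continuous_at)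
      from isCont_tendsto_compose[OF this sl]
      have "(\<lambda>n. u x - u (s n)) \<longlonglongrightarrow> u x - u y" by (rule tendsto_diff[OF tendsto_const])
      moreover have cC: "isCont (C k) (x - y)"
        using continuous_support[of k UNIV] k by (simp add: continuous_on_eq_continuous_at)
      have "(\<lambda>n. C k (x - s n)) \<longlonglongrightarrow> C k (x - y)"
        by (rule isCont_tendsto_compose[OF cC tendsto_diff[OF tendsto_const sl]])
      ultimately show ?thesis
        by (rule LIMSEQ_le) (use inc so in auto)
    qed
    moreover have "u y = ?G y" using eq[OF y(1)] by simp
    moreover have "C k (x - z) = C k (x - y) + C k (y - z)"
    proof -
      obtain t where t: "0 \<le> t" "t \<le> 1" "y = (1 - t) *\<^sub>R x + t *\<^sub>R z" using y(2) by (auto simp: in_segment)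
      have e: "x - y = t *\<^sub>R (x - z)" "y - z = (1 - t) *\<^sub>R (x - z)" by (simp_all add: t algebra_simps)
      have "C k (x - y) = t * C k (x - z)" unfolding e(1) using t k by (intro support_scaleR) auto
      moreover have "C k (y - z) = (1 - t) * C k (x - z)" unfolding e(2) using t k by (intro support_scaleR) auto
      ultimately show ?thesis by (simp add: left_diff_distrib)
    qed
    ultimately show False using \<open>\<not> u x \<le> ?G x\<close> by linarith
  qed
qed

lemma (in hamiltonian) AM_imp_cone_comparison:
  assumes \<Omega>: "open \<Omega>" and u: "u \<in> AM H \<Omega>"
  shows "cone_comparison H \<Omega> u" "cone_comparison (\<lambda>p. H (- p)) \<Omega> (\<lambda>x. - u x)"
proof -
  have "continuous_on \<Omega> u" using u by (simp add: AM_def)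
  then have b: "increment_bound H \<Omega> u"
    using AM_increment_le[OF hamiltonian_axioms \<Omega> u] unfolding increment_bound_def by blast
  then show "cone_comparison H \<Omega> u" by (rule increment_bound_imp_cone_comparison[OF \<Omega>])
  show "cone_comparison (\<lambda>p. H (- p)) \<Omega> (\<lambda>x. - u x)"
    by (rule hamiltonian.increment_bound_imp_cone_comparison[OF hamiltonian_reflect \<Omega> increment_bound_reflect[OF b]])
qed

section \<open>Steep points\<close>

context hamiltonian begin

text \<open>
  \<open>f\<close> lies on the boundary of the convex body \<open>{H \<le> H f}\<close>, since \<open>H\<close> increases strictly along the
  ray from \<open>0\<close> through \<open>f\<close>; the direction \<open>a\<close> is an outer normal there.
\<close>

lemma support_normal:
  assumes k: "H f > 0"
  obtains a where "norm a = 1" "C (H f) a = f \<bullet> a"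
proof -
  let ?S = "{p. H p \<le> H f}"
  have cS: "convex ?S"
  proof (rule convexI)
    fix x y and u v :: real assume *: "x \<in> ?S" "y \<in> ?S" "0 \<le> u" "0 \<le> v" "u + v = 1"
    then have "u = 1 - v" by simp
    then have "H (u *\<^sub>R x + v *\<^sub>R y) \<le> u * H x + v * H y" unfolding \<open>u = 1 - v\<close> using H_convex[of v x y] * by simp
    also have "\<dots> \<le> u * H f + v * H f" using * by (intro add_mono mult_left_mono) auto
    also have "\<dots> = H f" using * by (simp flip: distrib_right)
    finally show "u *\<^sub>R x + v *\<^sub>R y \<in> ?S" by simp
  qed
  have clS: "closed ?S" using compact_sublevel compact_imp_closed by blast
  have f0: "f \<noteq> 0" using k H_0 by auto
  have "f \<notin> interior ?S"
  proof
    assume "f \<in> interior ?S"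
    then obtain e where e: "e > 0" "cball f e \<subseteq> ?S" by (auto simp: mem_interior_cball)
    define t where "t = e / norm f"
    have t: "t > 0" using e f0 by (simp add: t_def)
    have "(1 + t) *\<^sub>R f \<in> cball f e" using f0 e by (simp add: dist_norm t_def scaleR_add_left)
    then have le: "H ((1 + t) *\<^sub>R f) \<le> H f" using e by auto
    have "H f \<le> (1 / (1 + t)) * H ((1 + t) *\<^sub>R f)"
      using H_convex[of "1 / (1 + t)" 0 "(1 + t) *\<^sub>R f"] t H_0 by simp
    also have "\<dots> \<le> (1 / (1 + t)) * H f" using le t by (intro mult_left_mono) auto
    finally show False using t k mult_pos_pos[OF t k] by (simp add: field_simps)
  qed
  moreover have "0 \<in> interior ?S"
  proof -
    have "open {p. H p < H f}"
      using cont by (intro open_Collect_less continuous_on_const)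
    then have "{p. H p < H f} \<subseteq> interior ?S" by (intro interior_maximal) auto
    then show ?thesis using k H_0 by auto
  qed
  then have "rel_interior ?S = interior ?S" by (intro rel_interior_nonempty_interior) auto
  ultimately have "f \<notin> rel_interior ?S" by simp
  moreover have "f \<in> closure ?S" using closure_subset by fastforce
  ultimately obtain b where b: "b \<noteq> 0" "\<And>y. y \<in> closure ?S \<Longrightarrow> b \<bullet> f \<le> b \<bullet> y"
    using supporting_hyperplane_rel_boundary[OF cS] clS
    by (metis (no_types, lifting) closure_closed supporting_hyperplane_relative_frontier cS)
  define a where "a = - (1 / norm b) *\<^sub>R b"
  have "p \<bullet> a \<le> f \<bullet> a" if "H p \<le> H f" for p
    using b(2)[of p] b(1) that closure_subset[of ?S] by (auto simp: a_def inner_commute divide_right_mono)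
  moreover obtain p where "H p \<le> H f" "C (H f) a = p \<bullet> a" using support_attained[OF H_nonneg] by metis
  ultimately have "C (H f) a = f \<bullet> a" using support_ge[of f "H f" a] by fastforce
  moreover have "norm a = 1" using b by (simp add: a_def)
  ultimately show ?thesis using that by blast
qed

end

locale cone_subsolution = hamiltonian H for H :: "'a::euclidean_space \<Rightarrow> real" +
  fixes \<Omega> :: "'a set" and u :: "'a \<Rightarrow> real"
  assumes \<Omega>: "open \<Omega>" and comparison: "cone_comparison H \<Omega> u"
begin

lemma u_cont: "continuous_on \<Omega> u"
  using comparison by (simp add: cone_comparison_def)

lemma compare_cone:
  assumes "open V" "compact (closure V)" "closure V \<subseteq> \<Omega>" "z \<notin> V" "k > 0"
    "\<And>x. x \<in> frontier V \<Longrightarrow> u x \<le> c + C k (x - z)" "x \<in> V"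
  shows "u x \<le> c + C k (x - z)"
  using comparison assms unfolding cone_comparison_def by blast

text \<open>
  The vertex may lie inside the ball: remove it, and treat it as a boundary point.
\<close>

lemma compare_cone_ball:
  assumes sub: "cball x r \<subseteq> \<Omega>" and k: "k > 0"
    and bd: "\<And>y. y \<in> sphere x r \<Longrightarrow> u y \<le> c + C k (y - z)" and z: "u z \<le> c"
    and y: "y \<in> cball x r"
  shows "u y \<le> c + C k (y - z)"
proof -
  consider "y = z" | "y \<in> sphere x r" | "y \<in> ball x r - {z}" using y by force
  then show ?thesis
  proof cases
    case 1 then show ?thesis using z support_zero k by simp
  next
    case 2 then show ?thesis using bd by simp
  next
    case 3
    let ?V = "ball x r - {z}"
    have cl: "closure ?V \<subseteq> cball x r" by (rule closure_minimal) auto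
    have fr: "frontier ?V \<subseteq> insert z (sphere x r)"
    proof
      fix p assume p: "p \<in> frontier ?V"
      then have "p \<in> cball x r" "p \<notin> ?V" using cl by (auto simp: frontier_def interior_open open_delete)
      then show "p \<in> insert z (sphere x r)" by auto
    qed
    show ?thesis
    proof (rule compare_cone[of ?V])
      show "open ?V" by (simp add: open_delete)
      show "compact (closure ?V)" using compact_Int_closed[OF compact_cball closed_closure, of x r ?V] cl by (simp add: Int_absorb1)
      show "closure ?V \<subseteq> \<Omega>" using cl sub by blast
      show "u p \<le> c + C k (p - z)" if "p \<in> frontier ?V" for p
        using fr that bd z k support_zero by fastforce
    qed (use 3 k in auto)
  qed
qed

text \<open>
  At a steep point, \<open>u\<close> grows at the rate of the cone of level \<open>k\<close> in some direction, as measured at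
  distance \<open>s\<close>.
\<close>

definition steep :: "'a \<Rightarrow> real \<Rightarrow> real \<Rightarrow> bool" where
  "steep x s k \<longleftrightarrow> (\<exists>y\<in>sphere x s. u x + C k (y - x) \<le> u y)"

text \<open>
  Steepness propagates. Let \<open>y\<close> maximize \<open>u - C k (\<cdot> - x)\<close> over the sphere. By comparison \<open>u\<close> is at
  most \<open>c + C k (\<cdot> - x)\<close> in the ball, with equality at \<open>y\<close>, so \<open>u\<close> falls off from \<open>y\<close> towards \<open>x\<close> at
  least as fast as \<open>C k\<close>. If \<open>y\<close> were not steep at distance \<open>s'\<close>, then \<open>u\<close> would stay strictly below
  \<open>u y + C k (\<cdot> - y)\<close> on the sphere around \<open>y\<close>. There is then room for a cone of slightly smaller level
  \<open>k'\<close> with vertex \<open>X t\<close> slightly behind \<open>y\<close>, and comparison with it contradicts the fall-off.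
\<close>

lemma steep_step:
  assumes k: "k > 0" and s: "s > 0" and sub: "cball x s \<subseteq> \<Omega>" and st: "steep x s k"
  obtains y where "y \<in> sphere x s" "u x + C k (y - x) \<le> u y"
    "\<And>s'. s' > 0 \<Longrightarrow> cball y s' \<subseteq> \<Omega> \<Longrightarrow> steep y s' k"
proof -
  have subs: "sphere x s \<subseteq> \<Omega>" using sub sphere_cball by blast
  have cc: "continuous_on A (\<lambda>y. C k (y - p))" for A p
    using k by (intro continuous_on_compose2[OF continuous_support[of k UNIV]] continuous_intros) auto
  have ne: "sphere x s \<noteq> {}" using st by (auto simp: steep_def)
  obtain y where y: "y \<in> sphere x s" "\<And>p. p \<in> sphere x s \<Longrightarrow> u p - C k (p - x) \<le> u y - C k (y - x)"
  proof -
    have "continuous_on (sphere x s) (\<lambda>p. u p - C k (p - x))"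
      by (intro continuous_on_diff cc continuous_on_subset[OF u_cont subs])
    from continuous_attains_sup[OF compact_sphere ne this] show ?thesis using that by blast
  qed
  define c where "c = u y - C k (y - x)"
  have cx: "u x \<le> c" using st y(2) by (force simp: steep_def c_def)
  have up: "u p \<le> c + C k (p - x)" if "p \<in> cball x s" for p
    by (rule compare_cone_ball[OF sub k _ cx that]) (use y(2) in \<open>fastforce simp: c_def\<close>)
  define X where "X t = y + t *\<^sub>R (x - y)" for t :: real
  have nxy: "norm (y - x) = s" using y(1) by (simp add: dist_norm norm_minus_commute)
  have Xup: "u (X t) + C k (y - X t) \<le> u y" if t: "0 \<le> t" "t \<le> 1" for t
  proof -
    have e: "X t - x = (1 - t) *\<^sub>R (y - x)" "y - X t = t *\<^sub>R (y - x)" by (simp_all add: X_def algebra_simps)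
    have "norm (X t - x) = (1 - t) * s" unfolding e norm_scaleR nxy using t by simp
    then have "X t \<in> cball x s" using t s by (simp add: dist_norm norm_minus_commute mult_left_le_one_le)
    from up[OF this] have "u (X t) \<le> c + (1 - t) * C k (y - x)" unfolding e using t k by (simp add: support_scaleR)
    moreover have "C k (y - X t) = t * C k (y - x)" unfolding e using t k by (simp add: support_scaleR)
    ultimately show ?thesis by (simp add: c_def algebra_simps)
  qed
  have "steep y s' k" if s': "s' > 0" and sub': "cball y s' \<subseteq> \<Omega>" for s'
  proof (rule ccontr)
    assume "\<not> steep y s' k"
    then have lt: "u p < u y + C k (p - y)" if "p \<in> sphere y s'" for p using that by (force simp: steep_def)
    have subs': "sphere y s' \<subseteq> \<Omega>" using sub' sphere_cball by blast
    obtain \<mu> where \<mu>: "\<mu> > 0" "\<And>p. p \<in> sphere y s' \<Longrightarrow> u p \<le> u y + C k (p - y) - \<mu>"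
    proof (cases "sphere y s' = {}")
      case True show ?thesis by (rule that[of 1], simp, simp only: True empty_iff)
    next
      case False
      have "continuous_on (sphere y s') (\<lambda>p. u p - C k (p - y))"
        by (intro continuous_on_diff cc continuous_on_subset[OF u_cont subs'])
      from continuous_attains_sup[OF compact_sphere False this]
      obtain q where q: "q \<in> sphere y s'" "\<And>p. p \<in> sphere y s' \<Longrightarrow> u p - C k (p - y) \<le> u q - C k (q - y)" by blast
      show ?thesis
        by (rule that[of "u y + C k (q - y) - u q"]) (use lt[OF q(1)] q(2) in force)+
    qed
    obtain R where R: "R > 0" "\<And>p. H p \<le> k \<Longrightarrow> norm p \<le> R" using sublevel_bound by metis
    have k0: "k \<ge> 0" using k by simp
    have yO: "y \<in> \<Omega>" using sub' s' by auto
    have "isCont u y" using u_cont \<Omega> yO by (simp add: continuous_on_eq_continuous_at)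
    then obtain d where d: "d > 0" "\<And>p. dist p y < d \<Longrightarrow> \<bar>u p - u y\<bar> < \<mu> / 4"
      unfolding continuous_at_eps_delta using \<mu>(1) by (metis dist_real_def divide_pos_pos zero_less_numeral)
    \<comment> \<open>The shift of the vertex may cost \<open>\<mu> / 4\<close> in the value of \<open>u\<close> and \<open>\<mu> / 4\<close> in the value of the cone,
      and the vertex has to stay in the ball of radius \<open>s'\<close>.\<close>
    define t where "t = min 1 (min (d / (2 * s)) (min (\<mu> / (4 * R * s)) (s' / s)))"
    have t: "t > 0" "t \<le> 1" "t * s < d" "R * (t * s) \<le> \<mu> / 4" "t * s \<le> s'"
    proof -
      show "t > 0" "t \<le> 1" using d \<mu> R s s' by (auto simp: t_def)
      have "t \<le> d / (2 * s)" "t \<le> \<mu> / (4 * R * s)" "t \<le> s' / s" by (auto simp: t_def)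
      then show "t * s < d" "R * (t * s) \<le> \<mu> / 4" "t * s \<le> s'" using s d R by (simp_all add: field_simps)
    qed
    \<comment> \<open>The relative decrease of the level; on the sphere it costs at most \<open>\<mu> / 4\<close>.\<close>
    define \<tau> where "\<tau> = min (1/2) (\<mu> / (8 * R * s'))"
    have \<tau>: "\<tau> > 0" "\<tau> < 1" "\<tau> * (R * (2 * s')) \<le> \<mu> / 4"
    proof -
      show "\<tau> > 0" "\<tau> < 1" using \<mu> R s' by (auto simp: \<tau>_def)
      have "\<tau> \<le> \<mu> / (8 * R * s')" by (simp add: \<tau>_def)
      then show "\<tau> * (R * (2 * s')) \<le> \<mu> / 4" using R s' by (simp add: field_simps)
    qed
    define k' where "k' = (1 - \<tau>) * k"
    have k': "k' > 0" "k' < k" using \<tau> k by (auto simp: k'_def)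
    have nX: "norm (y - X t) = t * s"
    proof -
      have "y - X t = t *\<^sub>R (y - x)" by (simp add: X_def algebra_simps)
      then show ?thesis using nxy t by simp
    qed
    have uX: "\<bar>u (X t) - u y\<bar> < \<mu> / 4" using d(2)[of "X t"] nX t by (simp add: dist_norm norm_minus_commute)
    have "u y \<le> u (X t) + C k' (y - X t)"
    proof (rule compare_cone_ball[OF sub' k'(1)])
      fix p assume p: "p \<in> sphere y s'"
      have "norm (p - X t) \<le> norm (p - y) + norm (y - X t)" by (metis diff_add_cancel add_diff_eq norm_triangle_ineq)
      then have np: "norm (p - X t) \<le> 2 * s'" using p nX t by (simp add: dist_norm norm_minus_commute)
      have "C k (p - X t) \<le> R * norm (p - X t)" by (rule support_le_norm[OF k0 R(2)])
      also have "\<dots> \<le> R * (2 * s')" using np R by (intro mult_left_mono) auto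
      finally have "\<tau> * C k (p - X t) \<le> \<tau> * (R * (2 * s'))" using \<tau> by (intro mult_left_mono) auto
      then have a: "\<tau> * C k (p - X t) \<le> \<mu> / 4" using \<tau> by linarith
      have "C k' (p - X t) \<ge> (k' / k) * C k (p - X t)" using k' k by (intro support_ratio) auto
      then have b: "C k' (p - X t) \<ge> C k (p - X t) - \<tau> * C k (p - X t)"
      proof -
        have "k' / k = 1 - \<tau>" using k by (simp add: k'_def)
        then show ?thesis using \<open>C k' (p - X t) \<ge> (k' / k) * C k (p - X t)\<close> by (simp add: left_diff_distrib)
      qed
      have "\<bar>C k (p - y) - C k (p - X t)\<bar> \<le> R * norm ((p - y) - (p - X t))" by (rule support_lipschitz[OF k0 R(2)])
      also have "\<dots> = R * (t * s)" using nX by (simp add: norm_minus_commute)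
      finally have "C k (p - y) \<le> C k (p - X t) + \<mu> / 4" using t by linarith
      then show "u p \<le> u (X t) + C k' (p - X t)" using \<mu>(2)[OF p] a b uX by linarith
    qed (use s' in auto)
    moreover have "C k' (y - X t) < C k (y - X t)"
    proof -
      obtain r where r: "r > 0" "\<And>y. C k y \<ge> C k' y + r * norm y" using support_strict_mono[of k' k] k' by auto
      have "r * norm (y - X t) > 0" using r nX t s by simp
      then show ?thesis using r(2)[of "y - X t"] by linarith
    qed
    ultimately show False using Xup[of t] t by linarith
  qed
  moreover have "u x + C k (y - x) \<le> u y" using cx by (simp add: c_def)
  ultimately show ?thesis using that y(1) by blast
qed

text \<open>
  Among \<open>n\<close> equal pieces of a segment, one carries at least the average increment.
\<close>

lemma steep_point_on_segment:
  assumes inc: "L * C k v \<le> u (x + L *\<^sub>R v) - u x" and L: "L > 0" and k: "k \<ge> 0" and v: "norm v = 1" and n: "n > 0"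
  obtains t where "0 \<le> t" "t \<le> L" "steep (x + t *\<^sub>R v) (L / real n) k"
proof -
  define h where "h = L / real n"
  have h: "h > 0" "real n * h = L" using L n by (auto simp: h_def)
  define g where "g j = u (x + (real j * h) *\<^sub>R v)" for j
  have "\<exists>j<n. g j + h * C k v \<le> g (Suc j)"
  proof (rule ccontr)
    assume "\<not> ?thesis"
    then have lt: "g (Suc j) - g j < h * C k v" if "j < n" for j using that by force
    have "g n - g 0 = (\<Sum>j<n. g (Suc j) - g j)" by (simp add: sum_lessThan_telescope)
    also have "\<dots> < (\<Sum>j<n. h * C k v)" using n lt by (intro sum_strict_mono) auto
    also have "\<dots> = L * C k v" using h by simp
    finally show False using inc h by (simp add: g_def)
  qed
  then obtain j where j: "j < n" "g j + h * C k v \<le> g (Suc j)" by blast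
  show ?thesis
  proof (rule that[of "real j * h"])
    show "0 \<le> real j * h" using h by simp
    have "real j * h \<le> real n * h" using j h by (intro mult_right_mono) auto
    then show "real j * h \<le> L" using h by simp
    have e: "x + (real (Suc j) * h) *\<^sub>R v - (x + (real j * h) *\<^sub>R v) = h *\<^sub>R v" by (simp add: algebra_simps)
    have ck: "C k (h *\<^sub>R v) = h * C k v" using h k by (simp add: support_scaleR)
    show "steep (x + (real j * h) *\<^sub>R v) (L / real n) k"
      unfolding steep_def
    proof (rule bexI[of _ "x + (real (Suc j) * h) *\<^sub>R v"])
      show "u (x + (real j * h) *\<^sub>R v) + C k (x + (real (Suc j) * h) *\<^sub>R v - (x + (real j * h) *\<^sub>R v))
          \<le> u (x + (real (Suc j) * h) *\<^sub>R v)"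
        using j(2) unfolding e ck g_def .
      show "x + (real (Suc j) * h) *\<^sub>R v \<in> sphere (x + (real j * h) *\<^sub>R v) (L / real n)"
      proof -
        have "dist (x + (real j * h) *\<^sub>R v) (x + (real (Suc j) * h) *\<^sub>R v) = norm (h *\<^sub>R v)"
          unfolding e[symmetric] by (metis dist_commute dist_norm)
        then show ?thesis using h v by (simp add: h_def[symmetric])
      qed
    qed
  qed
qed

end

section \<open>Components of superlevel sets and ascending chains\<close>

lemma closure_component_Int:
  "x \<in> closure (connected_component_set S a) \<Longrightarrow> x \<in> S \<Longrightarrow> x \<in> connected_component_set S a"
proof -
  assume x: "x \<in> closure (connected_component_set S a)" "x \<in> S"
  have "closedin (top_of_set S) (connected_component_set S a)" by (rule closedin_connected_component)
  then obtain T where T: "closed T" "connected_component_set S a = S \<inter> T" by (auto simp: closedin_closed)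
  then have "closure (connected_component_set S a) \<subseteq> T" by (intro closure_minimal) auto
  then show ?thesis using x T by blast
qed

context cone_subsolution begin

text \<open>
  Deviation of \<open>u\<close> from the affine function of slope \<open>f\<close> that agrees with \<open>u\<close> at the origin.
\<close>

definition excess :: "'a \<Rightarrow> 'a \<Rightarrow> real" where
  "excess f x = u x - u 0 - f \<bullet> x"

definition above :: "'a \<Rightarrow> 'a set" where
  "above f = {x \<in> \<Omega>. excess f x > 0}"

lemma excess_cont: "continuous_on \<Omega> (excess f)"
  unfolding excess_def by (intro continuous_intros u_cont)

lemma open_above: "open (above f)"
proof -
  obtain A where "open A" "A \<inter> \<Omega> = {x \<in> \<Omega>. 0 < excess f x}"
    using open_Collect_less_Int[OF continuous_on_const excess_cont, of 0 f] by blast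
  then show ?thesis using \<Omega> open_Int unfolding above_def by metis
qed

abbreviation "component f x \<equiv> connected_component_set (above f) x"

text \<open>
  A maximum principle. On the boundary of a component that stays in the ball, \<open>u\<close> is below the affine
  function, hence below the cone of level \<open>H f\<close> that touches this affine function along a ray. Placing
  the vertex far behind \<open>x\<close> on the line through \<open>x\<close> with direction the normal \<open>a\<close>, the cone equals
  the affine function at \<open>x\<close>.
\<close>

lemma component_escapes:
  assumes r: "cball 0 r \<subseteq> \<Omega>" and f: "H f > 0" and x: "x \<in> above f"
  shows "\<not> component f x \<subseteq> ball 0 r"
proof
  assume sub: "component f x \<subseteq> ball 0 r"
  obtain a where a: "norm a = 1" "C (H f) a = f \<bullet> a" using support_normal[OF f] by blast
  have "x \<in> component f x" using x by simp
  then have xr: "x \<in> ball 0 r" using sub by blast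
  then have rpos: "r > 0" using norm_ge_zero[of x] by (auto simp del: norm_ge_zero)
  define z where "z = x - (2 * r) *\<^sub>R a"
  have cl: "closure (component f x) \<subseteq> cball 0 r" by (rule closure_minimal) (use sub in auto)
  have "u x \<le> (u 0 + f \<bullet> z) + C (H f) (x - z)"
  proof (rule compare_cone[of "component f x"])
    show "open (component f x)" by (intro open_connected_component open_above)
    show "compact (closure (component f x))"
      using compact_Int_closed[OF compact_cball closed_closure, of 0 r "component f x"] cl by (simp add: Int_absorb1)
    show "closure (component f x) \<subseteq> \<Omega>" using cl r by blast
    show "z \<notin> component f x"
    proof
      assume "z \<in> component f x"
      then have "norm z < r" using sub by auto
      moreover have "norm ((2 * r) *\<^sub>R a) \<le> norm x + norm z"
        unfolding z_def by (metis norm_triangle_ineq4 diff_diff_eq2 add_diff_cancel_left')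
      ultimately show False using a xr rpos by simp
    qed
    show "x \<in> component f x" using x by simp
    show "u p \<le> u 0 + f \<bullet> z + C (H f) (p - z)" if p: "p \<in> frontier (component f x)" for p
    proof -
      have "p \<in> \<Omega>" using p cl r by (auto simp: frontier_def)
      have "p \<notin> component f x" "p \<in> closure (component f x)"
        using p open_connected_component[OF open_above] by (auto simp: frontier_def interior_open)
      then have "p \<notin> above f" using closure_component_Int by blast
      then have "u p \<le> u 0 + f \<bullet> p" using \<open>p \<in> \<Omega>\<close> by (auto simp: above_def excess_def)
      moreover have "f \<bullet> (p - z) \<le> C (H f) (p - z)" by (rule support_ge) simp
      ultimately show ?thesis by (simp add: inner_diff_right)
    qed
  qed (use f in auto)
  moreover have "C (H f) (x - z) = f \<bullet> (x - z)"
    using a rpos by (simp add: z_def support_scaleR H_nonneg)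
  ultimately show False using x by (auto simp: above_def excess_def inner_diff_right)
qed

text \<open>
  Assume that the component \<open>U\<close> stays in \<open>{(e - f) \<bullet> y \<le> \<delta>}\<close>. Closeness to slope \<open>e\<close> then
  confines it to a strip, and the hypothesis on the midpoint slope makes cones of level \<open>H f\<close> grow
  definitely faster than \<open>f\<close> along the strip, in either direction. Therefore cones with vertex in \<open>U\<close>
  dominate \<open>u\<close> on \<open>U \<inter> ball 0 6\<close>. Applied along the normal \<open>a\<close> at \<open>f\<close>, where the cone grows like \<open>f\<close>,
  this shows that \<open>excess f\<close> does not decrease when going from \<open>x\<close> in direction \<open>-a\<close>, so this walk never
  leaves \<open>U\<close>. But \<open>-a\<close> points across the strip.
\<close>

lemma component_far_strict:
  assumes \<Omega>8: "\<Omega> = ball 0 8" and approx: "\<And>x. x \<in> ball 0 8 \<Longrightarrow> \<bar>u x - u 0 - e \<bullet> x\<bar> \<le> \<delta>" and \<delta>: "\<delta> > 0"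
    and f: "H f > 0" and \<rho>: "\<rho> > 0" and ball: "\<And>h. norm h \<le> \<rho> \<Longrightarrow> H (f + (1/2) *\<^sub>R (e - f) + h) \<le> H f"
    and small: "2 * \<delta> \<le> \<rho>" and x: "x \<in> above f" "x \<in> ball 0 1"
  shows "\<exists>y\<in>component f x. (e - f) \<bullet> y > \<delta>"
proof (rule ccontr)
  assume "\<not> ?thesis"
  then have near: "(e - f) \<bullet> y \<le> \<delta>" if "y \<in> component f x" for y using that by force
  define d where "d = e - f"
  define k where "k = H f"
  define U where "U = component f x"
  have ex: "\<bar>excess f y - d \<bullet> y\<bar> \<le> \<delta>" if "y \<in> ball 0 8" for y
    using approx[OF that] by (simp add: excess_def d_def inner_diff_left)
  have U: "open U" "x \<in> U" "U \<subseteq> above f"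
    unfolding U_def using open_connected_component[OF open_above] x(1) connected_component_subset[of "above f" x] by simp_all
  have clU: "y \<in> U" if "y \<in> closure U" "y \<in> above f" for y
    using closure_component_Int that unfolding U_def by blast
  have cond: "C k y \<ge> f \<bullet> y + (1/2) * (d \<bullet> y) + \<rho> * norm y" for y
    using support_ball[OF ball, where y = y] \<rho> by (simp add: k_def d_def inner_add_left)
  have k0: "k > 0" using f by (simp add: k_def)
  have Ud: "d \<bullet> y \<ge> - \<delta>" "d \<bullet> y \<le> \<delta>" "y \<in> ball 0 8" "excess f y > 0" if "y \<in> U" for y
  proof -
    have "y \<in> above f" using that U(3) by blast
    then have "y \<in> \<Omega>" and ey: "excess f y > 0" by (simp_all add: above_def)
    then show y8: "y \<in> ball 0 8" "excess f y > 0" using \<Omega>8 by blast+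
    then show "d \<bullet> y \<ge> - \<delta>" using ex[of y] by auto
    show "d \<bullet> y \<le> \<delta>" using near that by (simp add: U_def d_def)
  qed
  have dom: "u y \<le> u z + C k (y - z)" if z: "z \<in> U" "z \<in> ball 0 2" and y: "y \<in> U" "y \<in> ball 0 6" for y z
  proof (cases "y = z")
    case True then show ?thesis using support_zero k0 by simp
  next
    case False
    let ?V = "U \<inter> ball 0 6 - {z}"
    have oV: "open ?V" using U by (simp add: open_delete open_Int)
    have clV: "closure ?V \<subseteq> closure U \<inter> cball 0 6"
    proof
      fix p assume "p \<in> closure ?V"
      moreover have "closure ?V \<subseteq> closure U" by (rule closure_mono) auto
      moreover have "closure ?V \<subseteq> cball 0 6" by (rule closure_minimal) auto
      ultimately show "p \<in> closure U \<inter> cball 0 6" by blast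
    qed
    show ?thesis
    proof (rule compare_cone[of ?V])
      show "open ?V" by (rule oV)
      show "compact (closure ?V)"
        using compact_Int_closed[OF compact_cball closed_closure, of 0 6 ?V] clV by (simp add: Int_absorb1)
      show "closure ?V \<subseteq> \<Omega>" using clV \<Omega>8 by force
      show "y \<in> ?V" using y False by simp
      show "u p \<le> u z + C k (p - z)" if p: "p \<in> frontier ?V" for p
      proof (cases "p = z")
        case True then show ?thesis using support_zero k0 by simp
      next
        case pz: False
        have pcl: "p \<in> closure U" "norm p \<le> 6" "p \<notin> ?V"
          using p clV oV by (auto simp: frontier_def interior_open)
        then have p8: "p \<in> ball 0 8" by simp
        have ez: "excess f z > 0" using Ud z by blast
        have key: "u p - u z = f \<bullet> (p - z) + excess f p - excess f z"
          by (simp add: excess_def inner_diff_right)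
        show ?thesis
        proof (cases "norm p < 6")
          case True
          \<comment> \<open>Boundary points of \<open>U\<close> have no excess, while the vertex \<open>z\<close> has.\<close>
          then have "p \<notin> U" using pcl pz by auto
          then have "p \<notin> above f" using clU pcl by blast
          then have "\<not> (p \<in> \<Omega> \<and> excess f p > 0)" by (simp add: above_def)
          then have "excess f p \<le> 0" using p8 unfolding \<Omega>8 by linarith
          moreover have "f \<bullet> (p - z) \<le> C k (p - z)" by (rule support_ge) (simp add: k_def)
          ultimately show ?thesis using key ez by linarith
        next
          case False
          \<comment> \<open>On the outer sphere, at distance at least \<open>4\<close> from \<open>z\<close>, the excess is at most \<open>2 * \<delta>\<close> and the
            cone has gained at least \<open>4 * \<rho> - \<delta>\<close> over \<open>f\<close>.\<close>
          have "closure U \<subseteq> {q. d \<bullet> q \<in> {-\<delta>..\<delta>}}"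
          proof (rule closure_minimal)
            show "U \<subseteq> {q. d \<bullet> q \<in> {-\<delta>..\<delta>}}" using Ud by auto
            show "closed {q. d \<bullet> q \<in> {-\<delta>..\<delta>}}"
              using continuous_closed_vimage[of "{-\<delta>..\<delta>}" "\<lambda>q. d \<bullet> q"] by (simp add: vimage_def)
          qed
          then have dp: "d \<bullet> p \<ge> - \<delta>" "d \<bullet> p \<le> \<delta>" using pcl by auto
          have "norm p \<le> norm (p - z) + norm z" by (metis diff_add_cancel norm_triangle_ineq)
          then have "norm (p - z) \<ge> 4" using False z by simp
          then have "\<rho> * norm (p - z) \<ge> \<rho> * 4" using \<rho> by (intro mult_left_mono) auto
          moreover have "d \<bullet> (p - z) \<ge> - 2 * \<delta>" using dp Ud(2)[OF z(1)] by (simp add: inner_diff_right)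
          ultimately have "C k (p - z) \<ge> f \<bullet> (p - z) - \<delta> + 4 * \<rho>" using cond[of "p - z"] by linarith
          moreover have "excess f p \<le> 2 * \<delta>" using ex[OF p8] dp by linarith
          ultimately show ?thesis using key ez small \<delta> by linarith
        qed
      qed
    qed (use k0 in auto)
  qed
  obtain a where a: "norm a = 1" "C k a = f \<bullet> a" using support_normal[OF f] unfolding k_def by blast
  have da: "d \<bullet> a \<le> - 2 * \<rho>" using cond[of a] a by simp
  \<comment> \<open>After this time \<open>d \<bullet> X s\<close> has grown by at least \<open>4 * \<delta>\<close>, twice the width of the
    strip.\<close>
  define s1 where "s1 = 2 * \<delta> / \<rho>"
  have s1: "0 \<le> s1" "s1 \<le> 1" "s1 * \<rho> = 2 * \<delta>" using \<delta> \<rho> small by (auto simp: s1_def)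
  define X where "X s = x - s *\<^sub>R a" for s
  have X: "X s \<in> ball 0 2" if "s \<in> {0..s1}" for s
  proof -
    have "norm (X s) \<le> norm x + norm (s *\<^sub>R a)" unfolding X_def by (rule norm_triangle_ineq4)
    also have "\<dots> \<le> norm x + 1" using that s1 a by simp
    finally show ?thesis using x by simp
  qed
  have mono: "excess f (X s) \<ge> excess f x" if "s \<in> {0..s1}" "X s \<in> U" for s
  proof -
    have "u x \<le> u (X s) + C k (x - X s)" using dom[OF that(2) X[OF that(1)] U(2)] x by simp
    also have "C k (x - X s) = s * (f \<bullet> a)" using that a k0 by (simp add: X_def support_scaleR)
    finally show ?thesis by (simp add: excess_def X_def inner_diff_right)
  qed
  \<comment> \<open>The times spent in \<open>U\<close> form an open and closed subset of the interval.\<close>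
  define Z where "Z = {s \<in> {0..s1}. X s \<in> U}"
  have cX: "continuous_on {0..s1} X" unfolding X_def by (intro continuous_intros)
  have oZ: "openin (top_of_set {0..s1}) Z"
    using continuous_openin_preimage_gen[OF cX U(1)] by (simp add: Z_def vimage_def Int_def)
  have Zeq: "Z = {s \<in> {0..s1}. X s \<in> closure U} \<inter> {s \<in> {0..s1}. excess f x \<le> excess f (X s)}"
  proof (intro set_eqI iffI)
    fix s assume "s \<in> Z"
    then show "s \<in> {s \<in> {0..s1}. X s \<in> closure U} \<inter> {s \<in> {0..s1}. excess f x \<le> excess f (X s)}"
      using mono closure_subset by (auto simp: Z_def)
  next
    fix s assume s: "s \<in> {s \<in> {0..s1}. X s \<in> closure U} \<inter> {s \<in> {0..s1}. excess f x \<le> excess f (X s)}"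
    have "X s \<in> \<Omega>" using X[of s] s \<Omega>8 by force
    then have "X s \<in> above f" using s Ud(4)[OF U(2)] by (simp add: above_def)
    then show "s \<in> Z" using s clU by (auto simp: Z_def)
  qed
  have cE: "continuous_on {0..s1} (\<lambda>s. excess f (X s))"
  proof (rule continuous_on_compose2[OF excess_cont cX])
    show "X ` {0..s1} \<subseteq> \<Omega>" using X \<Omega>8 by force
  qed
  have cZ: "closedin (top_of_set {0..s1}) Z"
  proof -
    have "closedin (top_of_set {0..s1}) {s \<in> {0..s1}. X s \<in> closure U}"
      using continuous_closedin_preimage[OF cX closed_closure[of U]] by (simp add: vimage_def Int_def)
    moreover have "closedin (top_of_set {0..s1}) {s \<in> {0..s1}. excess f x \<le> excess f (X s)}"
      using continuous_closedin_preimage[OF cE closed_atLeast[of "excess f x"]] by (simp add: vimage_def Int_def)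
    ultimately show ?thesis unfolding Zeq by (rule closedin_Int)
  qed
  have "0 \<in> Z" using U s1 by (simp add: Z_def X_def)
  moreover have "Z = {} \<or> Z = {0..s1}"
    using connected_Icc[of 0 s1] oZ cZ unfolding connected_clopen by blast
  ultimately have "Z = {0..s1}" by blast
  then have "s1 \<in> Z" using s1 by simp
  then have "X s1 \<in> U" by (simp add: Z_def)
  then have "d \<bullet> X s1 \<le> \<delta>" by (rule Ud)
  moreover have "d \<bullet> X s1 = d \<bullet> x - s1 * (d \<bullet> a)" by (simp add: X_def inner_diff_right)
  moreover have "s1 * (d \<bullet> a) \<le> s1 * (- 2 * \<rho>)" using da s1 by (intro mult_left_mono) auto
  moreover have "d \<bullet> x \<ge> - \<delta>" using Ud U by blast
  ultimately show False using s1 \<delta> by (simp add: algebra_simps)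
qed

text \<open>
  Iterating \<open>steep_step\<close> gives a polygonal path along which \<open>excess f\<close> increases by \<open>\<rho> * s\<close> per edge.
  Edges are so short that the excess oscillates by less than \<open>m / 2\<close> on each of them; hence once the
  path has reached excess \<open>m\<close>, it stays in the positive set, and the point where this happens lies in the
  same component as the end of the path.
\<close>

lemma ascending_chain:
  assumes k: "k > 0" and s: "s > 0" and st: "steep x s k" and sub: "cball x ((real N + 1) * s) \<subseteq> \<Omega>"
    and \<rho>: "\<rho> > 0" and cond: "\<And>y. C k y \<ge> f \<bullet> y + \<rho> * norm y" and m: "m > 0"
    and osc: "\<And>p q. p \<in> cball x (real N * s) \<Longrightarrow> q \<in> cball x (real N * s) \<Longrightarrow> dist p q \<le> s \<Longrightarrow> \<bar>excess f p - excess f q\<bar> < m / 2"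
  shows "n \<le> N \<Longrightarrow> \<exists>\<Gamma> y. path \<Gamma> \<and> pathstart \<Gamma> = x \<and> pathfinish \<Gamma> = y \<and> path_image \<Gamma> \<subseteq> cball x (real n * s) \<and>
     excess f x + real n * \<rho> * s \<le> excess f y \<and> steep y s k \<and>
     (\<forall>p\<in>path_image \<Gamma>. m \<le> excess f p \<longrightarrow> m / 2 < excess f y \<and> y \<in> component f p)"
proof (induction n)
  case 0
  have "x \<in> \<Omega>" using sub s by auto
  then have "m \<le> excess f x \<Longrightarrow> x \<in> above f" using m by (simp add: above_def)
  then have last: "\<forall>p\<in>path_image (linepath x x). m \<le> excess f p \<longrightarrow> m / 2 < excess f x \<and> x \<in> component f p"
    using m by auto
  show ?case
    by (rule exI[of _ "linepath x x"], rule exI[of _ x],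
        intro conjI path_linepath pathstart_linepath pathfinish_linepath st last) simp_all
next
  case (Suc n)
  then obtain \<Gamma> y where \<Gamma>: "path \<Gamma>" "pathstart \<Gamma> = x" "pathfinish \<Gamma> = y" "path_image \<Gamma> \<subseteq> cball x (real n * s)"
    and y: "excess f x + real n * \<rho> * s \<le> excess f y" "steep y s k"
    and good: "\<And>p. p \<in> path_image \<Gamma> \<Longrightarrow> m \<le> excess f p \<Longrightarrow> m / 2 < excess f y \<and> y \<in> component f p" by auto
  have yx: "dist x y \<le> real n * s" using \<Gamma> pathfinish_in_path_image[of \<Gamma>] by auto
  have nN: "(real n + 1) * s \<le> real N * s" using Suc.prems s by (intro mult_right_mono) auto
  have suby: "cball y s \<subseteq> cball x (real N * s)"
  proof
    fix p assume "p \<in> cball y s"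
    then have "dist x p \<le> real n * s + s" using yx dist_triangle[of x p y] by (simp add: dist_commute)
    then show "p \<in> cball x (real N * s)" using nN by (simp add: algebra_simps)
  qed
  have NO: "cball x (real N * s) \<subseteq> \<Omega>"
  proof -
    have "real N * s \<le> (real N + 1) * s" using s by simp
    then show ?thesis using sub by (meson order_trans subset_cball)
  qed
  obtain z where z: "z \<in> sphere y s" "u y + C k (z - y) \<le> u z"
    "\<And>s'. s' > 0 \<Longrightarrow> cball z s' \<subseteq> \<Omega> \<Longrightarrow> steep z s' k"
    using steep_step[OF k s subset_trans[OF suby NO] y(2)] by blast
  have nzy: "norm (z - y) = s" using z(1) by (simp add: dist_norm norm_minus_commute)
  have zx: "dist x z \<le> real n * s + s" using yx z(1) dist_triangle[of x z y] by (simp add: dist_commute)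
  have "cball z s \<subseteq> \<Omega>"
  proof -
    have "cball z s \<subseteq> cball x ((real N + 1) * s)"
    proof
      fix p assume "p \<in> cball z s"
      then have "dist x p \<le> real n * s + s + s" using zx dist_triangle[of x p z] by (simp add: dist_commute)
      then show "p \<in> cball x ((real N + 1) * s)" using nN by (simp add: algebra_simps)
    qed
    then show ?thesis using sub by blast
  qed
  then have stz: "steep z s k" using z(3) s by blast
  have inc: "excess f y + \<rho> * s \<le> excess f z"
    using cond[of "z - y"] z(2) nzy by (simp add: excess_def inner_diff_right)
  have edge: "closed_segment y z \<subseteq> cball y s"
    using z(1) s by (intro closed_segment_subset) auto
  have dd: "dist p q \<le> s" if "p \<in> closed_segment y z" "q \<in> closed_segment y z" for p q
  proof -
    have "closed_segment y z \<subseteq> cball p s"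
      using dist_in_closed_segment[OF that(1)] nzy
      by (intro closed_segment_subset) (auto simp: dist_norm norm_minus_commute)
    then show ?thesis using that by auto
  qed
  have osc': "\<bar>excess f p - excess f q\<bar> < m / 2" if "p \<in> closed_segment y z" "q \<in> closed_segment y z" for p q
    using osc dd that edge suby by blast
  have pos: "closed_segment y z \<subseteq> component f p" if p: "p \<in> closed_segment y z" "m \<le> excess f p \<or> m / 2 < excess f p \<and> p = y" for p
  proof (rule connected_component_maximal)
    show "closed_segment y z \<subseteq> above f"
    proof
      fix q assume q: "q \<in> closed_segment y z"
      then have "excess f q > 0" using osc'[OF p(1) q] p(2) m by linarith
      then show "q \<in> above f" using q edge suby NO by (auto simp: above_def)
    qed
  qed (use p in auto)
  show ?case
  proof (intro exI conjI ballI impI)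
    let ?\<Gamma> = "\<Gamma> +++ linepath y z"
    show "path ?\<Gamma>" "pathstart ?\<Gamma> = x" "pathfinish ?\<Gamma> = z" using \<Gamma> by auto
    have im: "path_image ?\<Gamma> = path_image \<Gamma> \<union> closed_segment y z" using \<Gamma> by (simp add: path_image_join)
    have "closed_segment y z \<subseteq> cball x (real (Suc n) * s)"
    proof
      fix p assume "p \<in> closed_segment y z"
      then have "p \<in> cball y s" using edge by blast
      then show "p \<in> cball x (real (Suc n) * s)" using yx dist_triangle[of x p y] by (simp add: dist_commute algebra_simps)
    qed
    moreover have "cball x (real n * s) \<subseteq> cball x (real (Suc n) * s)" using s by (simp add: subset_cball algebra_simps)
    ultimately show "path_image ?\<Gamma> \<subseteq> cball x (real (Suc n) * s)" using \<Gamma>(4) unfolding im by blast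
    show "excess f x + real (Suc n) * \<rho> * s \<le> excess f z" using inc y(1) by (simp add: algebra_simps)
    show "steep z s k" by (rule stz)
    fix p assume p: "p \<in> path_image ?\<Gamma>" "m \<le> excess f p"
    have rs: "\<rho> * s > 0" using \<rho> s by simp
    show "m / 2 < excess f z"
    proof (cases "p \<in> path_image \<Gamma>")
      case True then show ?thesis using good[OF True p(2)] inc rs by linarith
    next
      case False
      then have "p \<in> closed_segment y z" using p im by blast
      from osc'[OF this ends_in_segment(2)] show ?thesis using p(2) by linarith
    qed
    show "z \<in> component f p"
    proof (cases "p \<in> path_image \<Gamma>")
      case True
      then have "y \<in> component f p" "m / 2 < excess f y" using good p by auto
      moreover have "z \<in> component f y" using pos[of y] calculation by auto
      ultimately show ?thesis by (metis connected_component_eq)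
    next
      case False
      then have "p \<in> closed_segment y z" using p im by blast
      then show ?thesis using pos[of p] p by auto
    qed
  qed
qed

end

section \<open>Components confined to a strip in the plane\<close>

lemma orthonormal_frame_norm:
  fixes n t x :: "real^2"
  assumes "norm n = 1" "norm t = 1" "n \<bullet> t = 0"
  shows "(norm x)\<^sup>2 = (t \<bullet> x)\<^sup>2 + (n \<bullet> x)\<^sup>2"
proof -
  have n: "(n$1)\<^sup>2 + (n$2)\<^sup>2 = 1" and t: "(t$1)\<^sup>2 + (t$2)\<^sup>2 = 1" and nt: "n$1 * t$1 + n$2 * t$2 = 0"
    using assms by (simp_all add: norm_eq_1 inner_vec_def UNIV_2 power2_eq_square)
  have e: "(t$1)\<^sup>2 + (n$1)\<^sup>2 = 1 \<and> (t$2)\<^sup>2 + (n$2)\<^sup>2 = 1 \<and> t$1 * t$2 + n$1 * n$2 = 0"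
  proof -
    have "(n$1 * t$2 - n$2 * t$1)\<^sup>2 = ((n$1)\<^sup>2 + (n$2)\<^sup>2) * ((t$1)\<^sup>2 + (t$2)\<^sup>2) - (n$1 * t$1 + n$2 * t$2)\<^sup>2" by algebra
    then have D2: "(n$1 * t$2 - n$2 * t$1)\<^sup>2 = 1" using n t nt by simp
    let ?D = "n$1 * t$2 - n$2 * t$1"
    have "t$1 = - ?D * n$2" "t$2 = ?D * n$1" using n nt by algebra+
    then have "(t$1)\<^sup>2 = (n$2)\<^sup>2" "(t$2)\<^sup>2 = (n$1)\<^sup>2" "t$1 * t$2 = - (n$1 * n$2)"
      using D2 by algebra+
    then show ?thesis using n by simp
  qed
  have "(t \<bullet> x)\<^sup>2 + (n \<bullet> x)\<^sup>2 = ((t$1)\<^sup>2 + (n$1)\<^sup>2) * (x$1)\<^sup>2 + ((t$2)\<^sup>2 + (n$2)\<^sup>2) * (x$2)\<^sup>2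
      + 2 * (t$1 * t$2 + n$1 * n$2) * x$1 * x$2"
    by (simp add: inner_vec_def UNIV_2) algebra
  also have "\<dots> = (x$1)\<^sup>2 + (x$2)\<^sup>2" using e by simp
  also have "\<dots> = (norm x)\<^sup>2"
    unfolding power2_norm_eq_inner by (simp add: inner_vec_def UNIV_2 power2_eq_square)
  finally show ?thesis by simp
qed

text \<open>
  Clamping the coordinates \<open>(t \<bullet> x, n \<bullet> x)\<close> to the rectangle
  \<open>[3/2, 9/2] \<times> [-2 * h, 2 * h]\<close> turns the paths into paths that join opposite sides of it, which meet
  by the Fashoda theorem. On the image of either path one coordinate is inside its clamping range, and this
  suffices to undo the clamping at the meeting point.
\<close>

lemma crossing_paths_in_strip:
  fixes P \<Gamma> :: "real \<Rightarrow> real^2"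
  assumes frame: "norm n = 1" "norm t = 1" "n \<bullet> t = 0" and h: "h > 0"
    and P: "path P" "\<And>x. x \<in> path_image P \<Longrightarrow> \<bar>n \<bullet> x\<bar> \<le> h" "t \<bullet> pathstart P \<le> 1" "t \<bullet> pathfinish P \<ge> 5"
    and \<Gamma>: "path \<Gamma>" "\<And>x. x \<in> path_image \<Gamma> \<Longrightarrow> 2 \<le> t \<bullet> x \<and> t \<bullet> x \<le> 4"
      "n \<bullet> pathstart \<Gamma> \<le> - 2 * h" "n \<bullet> pathfinish \<Gamma> \<ge> 2 * h"
  obtains x where "x \<in> path_image P" "x \<in> path_image \<Gamma>"
proof -
  define \<Phi> :: "real^2 \<Rightarrow> real^2" where
    "\<Phi> x = max (3/2) (min (9/2) (t \<bullet> x)) *\<^sub>R axis 1 1 + max (- 2 * h) (min (2 * h) (n \<bullet> x)) *\<^sub>R axis 2 1" for x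
  have \<Phi>12: "\<Phi> x $ 1 = max (3/2) (min (9/2) (t \<bullet> x))" "\<Phi> x $ 2 = max (- 2 * h) (min (2 * h) (n \<bullet> x))" for x
    by (simp_all add: \<Phi>_def axis_def)
  define a b :: "real^2" where "a = vector [3/2, - 2 * h]" and "b = vector [9/2, 2 * h]"
  have c\<Phi>: "continuous_on A \<Phi>" for A
    unfolding \<Phi>_def by (intro continuous_intros)
  have box: "\<Phi> x \<in> cbox a b" for x
    using h by (auto simp: mem_box_cart forall_2 a_def b_def \<Phi>12)
  obtain z where "z \<in> path_image (\<Phi> \<circ> P)" "z \<in> path_image (\<Phi> \<circ> \<Gamma>)"
  proof (rule fashoda[of "\<Phi> \<circ> P" "\<Phi> \<circ> \<Gamma>" a b])
    show "path (\<Phi> \<circ> P)" "path (\<Phi> \<circ> \<Gamma>)" by (auto intro!: path_continuous_image P \<Gamma> c\<Phi>)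
    show "path_image (\<Phi> \<circ> P) \<subseteq> cbox a b" "path_image (\<Phi> \<circ> \<Gamma>) \<subseteq> cbox a b"
      using box by (auto simp: path_image_compose)
    show "pathstart (\<Phi> \<circ> P) $ 1 = a $ 1" "pathfinish (\<Phi> \<circ> P) $ 1 = b $ 1"
      using P by (auto simp: pathstart_compose pathfinish_compose \<Phi>12 a_def b_def)
    show "pathstart (\<Phi> \<circ> \<Gamma>) $ 2 = a $ 2" "pathfinish (\<Phi> \<circ> \<Gamma>) $ 2 = b $ 2"
      using \<Gamma> h by (auto simp: pathstart_compose pathfinish_compose \<Phi>12 a_def b_def)
  qed
  then obtain x y where xy: "x \<in> path_image P" "y \<in> path_image \<Gamma>" "\<Phi> x = \<Phi> y" by (auto simp: path_image_compose)
  from xy(3) have e: "max (3/2) (min (9/2) (t \<bullet> x)) = max (3/2) (min (9/2) (t \<bullet> y))"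
    "max (- 2 * h) (min (2 * h) (n \<bullet> x)) = max (- 2 * h) (min (2 * h) (n \<bullet> y))"
    unfolding \<Phi>12[symmetric] by simp_all
  have "t \<bullet> x = t \<bullet> y" using e(1) \<Gamma>(2)[OF xy(2)] by (auto simp: max_def min_def split: if_splits)
  moreover have "n \<bullet> x = n \<bullet> y" using e(2) P(2)[OF xy(1)] h by (auto simp: max_def min_def abs_le_iff split: if_splits)
  ultimately have "(norm (x - y))\<^sup>2 = 0" unfolding orthonormal_frame_norm[OF frame] by (simp add: inner_diff_right)
  then show ?thesis using that xy by simp
qed

locale planar_cone_subsolution = cone_subsolution H "ball 0 8" u for H :: "real^2 \<Rightarrow> real" and u
begin

text \<open>
  Assume again that the component stays in \<open>{(e - f) \<bullet> y \<le> \<delta>}\<close>, hence in the strip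
  \<open>\<bar>n \<bullet> y\<bar> \<le> h\<close> with \<open>h = \<delta> / D\<close>. It escapes from \<open>ball 0 6\<close>, so it contains a path \<open>P\<close> running along
  the strip from \<open>x\<close> to distance \<open>5\<close>. Just before the strip, near the point \<open>3 *\<^sub>R t\<close>, there is a segment
  of length \<open>L\<close> in direction \<open>v\<close>, along which \<open>u\<close> increases at least as \<open>C k\<close> does, because slope \<open>e\<close>
  exceeds the level \<open>k\<close> in this direction. It contains a steep point, and the ascending chain from there
  gains \<open>\<rho>\<close> in excess per unit of length, so it crosses the strip on a short way and meets \<open>P\<close>. The end of
  the chain is then in the component, but beyond the strip.
\<close>

lemma component_far_below:
  assumes approx: "\<And>x. x \<in> ball 0 8 \<Longrightarrow> \<bar>u x - u 0 - e \<bullet> x\<bar> \<le> \<delta>" and \<delta>: "\<delta> > 0"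
    and f: "H f > 0" and k: "k > 0" and \<rho>: "\<rho> > 0" and ball: "\<And>h. norm h \<le> \<rho> \<Longrightarrow> H (f + h) \<le> k"
    and v: "norm v = 1" and c: "c > 0" "e \<bullet> v \<ge> C k v + c" and D: "D = norm (e - f)" "D > 0"
    and L: "L = 2 * \<delta> / c" and small: "\<delta> \<le> D" "8 * L + 8 * (\<delta> / D) \<le> 1" "4 * (2 * D * L + 6 * \<delta>) \<le> \<rho>"
    and x: "x \<in> above f" "x \<in> ball 0 1"
  shows "\<exists>y\<in>component f x. (e - f) \<bullet> y > \<delta>"
proof (rule ccontr)
  assume "\<not> ?thesis"
  then have near: "(e - f) \<bullet> y \<le> \<delta>" if "y \<in> component f x" for y using that by force
  define d where "d = e - f"
  define n where "n = (1 / D) *\<^sub>R d"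
  define h where "h = \<delta> / D"
  have h: "h > 0" "h \<le> 1" "D * h = \<delta>" using \<delta> D small by (auto simp: h_def)
  have dn: "d \<bullet> y = D * (n \<bullet> y)" for y using D by (simp add: n_def)
  have ex: "\<bar>excess f y - d \<bullet> y\<bar> \<le> \<delta>" if "y \<in> ball 0 8" for y
    using approx[OF that] by (simp add: excess_def d_def inner_diff_left)
  have cond: "C k y \<ge> f \<bullet> y + \<rho> * norm y" for y
    using support_ball[OF ball, where y = y] \<rho> by simp
  have n1: "norm n = 1" using D by (simp add: n_def d_def)
  define U where "U = component f x"
  have Uab: "U \<subseteq> above f" unfolding U_def by (rule connected_component_subset)
  have strip: "\<bar>n \<bullet> y\<bar> \<le> h" if "y \<in> U" for y
  proof -
    have "y \<in> ball 0 8" "excess f y > 0" using that Uab unfolding above_def by blast+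
    then have "D * (n \<bullet> y) \<ge> - (D * h)" using ex[of y] unfolding dn h by linarith
    moreover have "D * (n \<bullet> y) \<le> D * h" using near[of y] that unfolding U_def h d_def[symmetric] dn by simp
    ultimately have "- h \<le> n \<bullet> y" "n \<bullet> y \<le> h"
      using D(2) mult_le_cancel_left_pos[of D "-h" "n \<bullet> y"] by auto
    then show ?thesis by simp
  qed
  have xU: "x \<in> U" using x by (simp add: U_def)
  have "\<not> U \<subseteq> ball 0 6" unfolding U_def by (rule component_escapes[OF _ f x(1)]) auto
  then obtain y where y: "y \<in> U" "norm y \<ge> 6" by force
  have "path_connected U" unfolding U_def
    by (intro connected_open_path_connected open_connected_component open_above connected_connected_component)
  then obtain P where P: "path P" "path_image P \<subseteq> U" "pathstart P = x" "pathfinish P = y"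
    using xU y unfolding path_connected_def by blast
  define t0 :: "real^2" where "t0 = vector [- n$2, n$1]"
  have t0: "norm t0 = 1" "n \<bullet> t0 = 0"
    using n1 by (simp_all add: norm_eq_1 t0_def inner_vec_def UNIV_2 algebra_simps)
  have "(t0 \<bullet> y)\<^sup>2 \<ge> 5\<^sup>2"
  proof -
    have "(norm y)\<^sup>2 \<ge> 6\<^sup>2" using y by (intro power_mono) auto
    moreover have "(n \<bullet> y)\<^sup>2 \<le> 1\<^sup>2" using strip[OF y(1)] h(2) abs_le_square_iff[of "n \<bullet> y" 1] by simp
    ultimately show ?thesis using orthonormal_frame_norm[OF n1 t0, of y] by simp
  qed
  then have "\<bar>t0 \<bullet> y\<bar> \<ge> 5" using abs_le_square_iff[of 5 "t0 \<bullet> y"] by simp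
  then obtain t where t: "norm t = 1" "n \<bullet> t = 0" "t \<bullet> y \<ge> 5"
  proof (cases "t0 \<bullet> y \<ge> 5")
    case True then show ?thesis using that[of t0] t0 by simp
  next
    case False
    then have "(- t0) \<bullet> y \<ge> 5" using \<open>\<bar>t0 \<bullet> y\<bar> \<ge> 5\<close> by simp
    then show ?thesis using that[of "- t0"] t0 by simp
  qed
  have tx: "t \<bullet> x \<le> 1" using norm_cauchy_schwarz[of t x] t x by simp
  have Lp: "L > 0" "L * c = 2 * \<delta>" using \<delta> c L by auto
  \<comment> \<open>The segment starts far enough before the strip to keep distance \<open>h\<close> from it over its whole
    length \<open>L\<close>.\<close>
  define m where "m = L + 2 * h"
  define y0 where "y0 = 3 *\<^sub>R t - m *\<^sub>R n"
  have m: "m > 0" "m + L \<le> 1/4" using Lp h small(2) by (auto simp: m_def h_def)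
  have pt: "norm (y0 + s *\<^sub>R v) < 4" "n \<bullet> (y0 + s *\<^sub>R v) \<le> - 2 * h" "n \<bullet> (y0 + s *\<^sub>R v) \<ge> - (2 * L + 2 * h)"
    "t \<bullet> (y0 + s *\<^sub>R v) \<ge> 3 - 1/4" "t \<bullet> (y0 + s *\<^sub>R v) \<le> 3 + 1/4"
    if s: "0 \<le> s" "s \<le> L" for s
  proof -
    have "norm (y0 + s *\<^sub>R v) \<le> norm (3 *\<^sub>R t) + norm (m *\<^sub>R n) + norm (s *\<^sub>R v)"
      unfolding y0_def by (metis (no_types) norm_triangle_ineq norm_triangle_ineq4 add_right_mono order_trans)
    also have "\<dots> = 3 + m + s" using t n1 v m s by simp
    finally show "norm (y0 + s *\<^sub>R v) < 4" using m s by linarith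
    have nn: "n \<bullet> n = 1" "t \<bullet> t = 1" using n1 t by (simp_all add: norm_eq_1)
    have "\<bar>n \<bullet> v\<bar> \<le> 1" "\<bar>t \<bullet> v\<bar> \<le> 1" using Cauchy_Schwarz_ineq2[of n v] Cauchy_Schwarz_ineq2[of t v] n1 t v by auto
    then have "\<bar>s * (n \<bullet> v)\<bar> \<le> s" "\<bar>s * (t \<bullet> v)\<bar> \<le> s" using s by (auto simp: abs_mult mult_left_le)
    moreover have "n \<bullet> (y0 + s *\<^sub>R v) = - m + s * (n \<bullet> v)" "t \<bullet> (y0 + s *\<^sub>R v) = 3 + s * (t \<bullet> v)"
      using nn t by (simp_all add: y0_def inner_add_right inner_diff_right inner_commute[of t n])
    ultimately show "n \<bullet> (y0 + s *\<^sub>R v) \<le> - 2 * h" "n \<bullet> (y0 + s *\<^sub>R v) \<ge> - (2 * L + 2 * h)"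
      "t \<bullet> (y0 + s *\<^sub>R v) \<ge> 3 - 1/4" "t \<bullet> (y0 + s *\<^sub>R v) \<le> 3 + 1/4"
      using s m by (auto simp: m_def)
  qed
  have inc: "L * C k v \<le> u (y0 + L *\<^sub>R v) - u y0"
  proof -
    have b: "y0 + L *\<^sub>R v \<in> ball 0 8" "y0 \<in> ball 0 8" using pt(1)[of L] pt(1)[of 0] Lp by auto
    have "u (y0 + L *\<^sub>R v) - u y0 \<ge> e \<bullet> (y0 + L *\<^sub>R v) - e \<bullet> y0 - 2 * \<delta>"
      using approx[OF b(1)] approx[OF b(2)] by linarith
    also have "e \<bullet> (y0 + L *\<^sub>R v) - e \<bullet> y0 = L * (e \<bullet> v)" by (simp add: inner_add_right)
    finally have "u (y0 + L *\<^sub>R v) - u y0 \<ge> L * (e \<bullet> v) - L * c" using Lp by simp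
    moreover have "L * (e \<bullet> v) \<ge> L * (C k v + c)" using c Lp by (intro mult_left_mono) auto
    ultimately show ?thesis by (simp add: distrib_left)
  qed
  \<comment> \<open>The gain of excess that brings the chain from its least possible starting value
    \<open>- 2 * D * L - 3 * \<delta>\<close> to \<open>3 * \<delta>\<close>; collecting it takes length \<open>W / \<rho>\<close>.\<close>
  define W where "W = 2 * D * L + 6 * \<delta>"
  have W: "W > 0" "W / \<rho> \<le> 1/4" using D Lp \<delta> \<rho> small(3) by (auto simp: W_def field_simps add_pos_pos)
  have PU: "path_image P \<subseteq> ball 0 8" using P Uab unfolding above_def by blast
  \<comment> \<open>The least excess along \<open>P\<close> determines how short the edges of the chain have to be.\<close>
  obtain \<mu> where \<mu>: "\<mu> > 0" "\<And>p. p \<in> path_image P \<Longrightarrow> \<mu> \<le> excess f p"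
  proof -
    have "continuous_on (path_image P) (excess f)" by (rule continuous_on_subset[OF excess_cont PU])
    from continuous_attains_inf[OF compact_path_image[OF P(1)] _ this]
    obtain q where q: "q \<in> path_image P" "\<And>p. p \<in> path_image P \<Longrightarrow> excess f q \<le> excess f p" by auto
    moreover have "excess f q > 0" using q(1) P Uab unfolding above_def by blast
    ultimately show ?thesis using that by blast
  qed
  have "uniformly_continuous_on (cball 0 7) (excess f)"
    by (intro compact_uniformly_continuous continuous_on_subset[OF excess_cont]) auto
  then obtain r where r: "r > 0" "\<And>p q. p \<in> cball 0 7 \<Longrightarrow> q \<in> cball 0 7 \<Longrightarrow> dist q p < r \<Longrightarrow> dist (excess f q) (excess f p) < \<mu> / 2"
    unfolding uniformly_continuous_on_def using \<mu>(1) by (metis half_gt_zero)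
  obtain N0 :: nat where N0: "N0 > 0" "L / real N0 < min r (1/8)"
  proof -
    obtain N0 :: nat where "L / min r (1/8) < real N0" using reals_Archimedean2 by blast
    moreover have M: "min r (1/8) > 0" using r by auto
    moreover have "L / min r (1/8) > 0" using Lp M by simp
    ultimately have N0: "real N0 > 0" "L < real N0 * min r (1/8)"
      using pos_divide_less_eq[OF M] by (blast intro: less_trans)+
    have "L / real N0 < min r (1/8)"
      using N0(2) pos_divide_less_eq[OF N0(1), of L "min r (1/8)"] by (simp only: mult.commute)
    moreover have "N0 > 0" using N0(1) by simp
    ultimately show ?thesis using that by blast
  qed
  define s where "s = L / real N0"
  have s: "s > 0" "s < r" "s < 1/8" using N0 Lp by (auto simp: s_def)
  obtain s0 where s0: "0 \<le> s0" "s0 \<le> L" "steep (y0 + s0 *\<^sub>R v) s k"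
    using steep_point_on_segment[OF inc Lp(1) less_imp_le[OF k] v N0(1)] unfolding s_def by blast
  define z where "z = y0 + s0 *\<^sub>R v"
  note z = pt[OF s0(1,2), folded z_def]
  define N where "N = nat \<lceil>W / (\<rho> * s)\<rceil>"
  have N1: "real N * \<rho> * s \<ge> W"
  proof -
    have "W / (\<rho> * s) \<le> real N" unfolding N_def by linarith
    then show ?thesis using \<rho> s by (simp add: pos_divide_le_eq mult.assoc)
  qed
  have N2: "real N * s \<le> 1/4 + s"
  proof -
    have "W / (\<rho> * s) > 0" using W \<rho> s by simp
    then have "real N \<le> W / (\<rho> * s) + 1" unfolding N_def by linarith
    then have "real N * s \<le> (W / (\<rho> * s) + 1) * s" using s by (intro mult_right_mono) auto
    also have "\<dots> = W / \<rho> + s" using s \<rho> by (simp add: field_simps)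
    finally show ?thesis using W by linarith
  qed
  have rad: "(real N + 1) * s \<le> 1/2" using N2 s by (simp add: algebra_simps)
  have NN: "real N * s \<le> (real N + 1) * s" using s by simp
  have sub7: "cball z ((real N + 1) * s) \<subseteq> cball 0 7"
  proof
    fix p assume "p \<in> cball z ((real N + 1) * s)"
    then have "dist z p \<le> 1/2" using rad by simp
    then have "norm p \<le> norm z + 1/2" using norm_triangle_ineq[of z "p - z"] by (simp add: dist_norm norm_minus_commute)
    then show "p \<in> cball 0 7" using z(1) by simp
  qed
  have "\<exists>\<Gamma> y. path \<Gamma> \<and> pathstart \<Gamma> = z \<and> pathfinish \<Gamma> = y \<and> path_image \<Gamma> \<subseteq> cball z (real N * s) \<and>
     excess f z + real N * \<rho> * s \<le> excess f y \<and> steep y s k \<and>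
     (\<forall>p\<in>path_image \<Gamma>. \<mu> \<le> excess f p \<longrightarrow> \<mu> / 2 < excess f y \<and> y \<in> component f p)"
  proof (rule ascending_chain[OF k s(1) s0(3)[folded z_def], of N])
    show "cball z ((real N + 1) * s) \<subseteq> ball 0 8" using sub7 by force
    show "\<bar>excess f p - excess f q\<bar> < \<mu> / 2"
      if "p \<in> cball z (real N * s)" "q \<in> cball z (real N * s)" "dist p q \<le> s" for p q
    proof -
      have "p \<in> cball 0 7" "q \<in> cball 0 7" using that(1,2) sub7 NN by (meson mem_cball order_trans subsetD)+
      then show ?thesis using r(2)[of q p] that(3) s by (simp add: dist_real_def)
    qed
  qed (use \<rho> cond \<mu> in auto)
  then obtain \<Gamma> y1 where \<Gamma>: "path \<Gamma>" "pathstart \<Gamma> = z" "pathfinish \<Gamma> = y1" "path_image \<Gamma> \<subseteq> cball z (real N * s)"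
    and y1: "excess f z + real N * \<rho> * s \<le> excess f y1"
    and good: "\<And>p. p \<in> path_image \<Gamma> \<Longrightarrow> \<mu> \<le> excess f p \<Longrightarrow> y1 \<in> component f p" by blast
  have z8: "z \<in> ball 0 8" using z(1) by simp
  have y18: "y1 \<in> ball 0 8"
  proof -
    have "y1 \<in> cball z (real N * s)" using \<Gamma> pathfinish_in_path_image[of \<Gamma>] by auto
    then have "y1 \<in> cball 0 7" using sub7 NN by (meson mem_cball order_trans subsetD)
    then show ?thesis by simp
  qed
  have "excess f z \<ge> - 2 * D * L - 3 * \<delta>"
  proof -
    have "D * (n \<bullet> z) \<ge> D * (- (2 * L + 2 * h))" using z(3) D by (intro mult_left_mono) auto
    then show ?thesis using ex[OF z8] h(3) unfolding dn by (simp add: algebra_simps)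
  qed
  then have "excess f y1 \<ge> 3 * \<delta>" using y1 N1 by (simp add: W_def)
  then have dy1: "d \<bullet> y1 \<ge> 2 * \<delta>" using ex[OF y18] by linarith
  have "\<exists>p. p \<in> path_image P \<and> p \<in> path_image \<Gamma>"
  proof (rule crossing_paths_in_strip[OF n1 t(1,2) h(1) P(1) _ _ _ \<Gamma>(1)])
    show "\<bar>n \<bullet> p\<bar> \<le> h" if "p \<in> path_image P" for p using strip that P by blast
    show "t \<bullet> pathstart P \<le> 1" "5 \<le> t \<bullet> pathfinish P" using P tx t by auto
    show "2 \<le> t \<bullet> p \<and> t \<bullet> p \<le> 4" if "p \<in> path_image \<Gamma>" for p
    proof -
      have "dist z p \<le> real N * s" using that \<Gamma> by auto
      then have "norm (p - z) \<le> 1/2" using rad NN by (simp add: dist_norm norm_minus_commute)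
      moreover have "\<bar>t \<bullet> (p - z)\<bar> \<le> norm (p - z)" using Cauchy_Schwarz_ineq2[of t "p - z"] t by simp
      ultimately have "\<bar>t \<bullet> p - t \<bullet> z\<bar> \<le> 1/2" by (simp add: inner_diff_right)
      then show ?thesis using z(4,5) by linarith
    qed
    show "n \<bullet> pathstart \<Gamma> \<le> - 2 * h" using \<Gamma> z by simp
    have "D * (n \<bullet> y1) \<ge> D * (2 * h)" using dy1 h(3) unfolding dn by simp
    then show "2 * h \<le> n \<bullet> pathfinish \<Gamma>" using \<Gamma> D by simp
  qed auto
  then obtain p where p: "p \<in> path_image P" "p \<in> path_image \<Gamma>" by blast
  then have "y1 \<in> component f p" using good \<mu> by blast
  moreover have "component f p = U"
  proof -
    have "p \<in> component f x" using p(1) P(2) unfolding U_def by blast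
    then show ?thesis unfolding U_def by (rule connected_component_eq)
  qed
  ultimately have "d \<bullet> y1 \<le> \<delta>" using near by (simp add: U_def d_def)
  then show False using dy1 \<delta> by linarith
qed

end

section \<open>Choice of uniform constants\<close>

context hamiltonian begin

lemma H_pos: "f \<noteq> 0 \<Longrightarrow> H f > 0"
proof (rule ccontr)
  assume f: "f \<noteq> 0" "\<not> H f > 0"
  then have "H f = 0" using H_nonneg[of f] by simp
  have "closed_segment 0 f \<subseteq> H -` {0}"
  proof
    fix x assume "x \<in> closed_segment 0 f"
    then obtain t where t: "0 \<le> t" "t \<le> 1" "x = (1 - t) *\<^sub>R 0 + t *\<^sub>R f" by (auto simp: in_segment)
    then have "H x \<le> 0" using H_convex[of t 0 f] H_0 \<open>H f = 0\<close> by simp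
    then show "x \<in> H -` {0}" using H_nonneg[of x] by simp
  qed
  then show False using no_segment[of 0] f unfolding has_line_segment_def by metis
qed

text \<open>
  Otherwise \<open>H\<close> takes the same value at \<open>p\<close>, \<open>q\<close> and their midpoint. A point of the segment with a
  different value has a smaller one by convexity; writing the midpoint as a combination of it and
  an endpoint gives a contradiction.
\<close>

lemma midpoint_strict:
  assumes pq: "p \<noteq> q"
  shows "H (p + (1/2) *\<^sub>R (q - p)) < max (H p) (H q)"
proof (rule ccontr)
  let ?m = "p + (1/2) *\<^sub>R (q - p)"
  assume "\<not> ?thesis"
  moreover have "H ?m \<le> (1/2) * H p + (1/2) * H q"
  proof -
    have "?m = (1 - 1/2) *\<^sub>R p + (1/2) *\<^sub>R q" by (simp add: algebra_simps flip: scaleR_add_left)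
    then show ?thesis using H_convex[of "1/2" p q] by simp
  qed
  ultimately have eq: "H p = H ?m" "H q = H ?m" by (auto simp: max_def split: if_splits)
  define c where "c = H ?m"
  obtain x where x: "x \<in> closed_segment p q" "H x \<noteq> c"
    using no_segment[of c] pq unfolding has_line_segment_def by (auto simp: vimage_def)
  then obtain t where t: "0 \<le> t" "t \<le> 1" "x = (1 - t) *\<^sub>R p + t *\<^sub>R q" by (auto simp: in_segment)
  have "H x \<le> (1 - t) * c + t * c" using H_convex[of t p q] t eq by (simp add: c_def)
  then have xc: "H x < c" using x by (simp add: algebra_simps)
  show False
  proof (cases "t \<le> 1/2")
    case True
    define s where "s = 1 / (2 * (1 - t))"
    have s: "0 < s" "s \<le> 1" "s * (1 - t) = 1/2" using True by (auto simp: s_def field_simps)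
    have "?m = (1 - (1 - s)) *\<^sub>R x + (1 - s) *\<^sub>R q"
    proof -
      have "(1 - (1 - s)) *\<^sub>R x + (1 - s) *\<^sub>R q = (s * (1 - t)) *\<^sub>R p + (1 - s * (1 - t)) *\<^sub>R q"
        unfolding t(3) by (simp add: algebra_simps)
      then show ?thesis unfolding s(3) by (simp add: algebra_simps flip: scaleR_add_left)
    qed
    then have "H ?m \<le> s * H x + (1 - s) * H q" using H_convex[of "1 - s" x q] s by simp
    also have "\<dots> < s * c + (1 - s) * c" using xc s eq by (simp add: c_def)
    finally show False by (simp add: c_def algebra_simps)
  next
    case False
    define s where "s = 1 / (2 * t)"
    have s: "0 < s" "s \<le> 1" "s * t = 1/2" using False by (auto simp: s_def field_simps)
    have "?m = (1 - s) *\<^sub>R p + s *\<^sub>R x"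
    proof -
      have "(1 - s) *\<^sub>R p + s *\<^sub>R x = (1 - s * t) *\<^sub>R p + (s * t) *\<^sub>R q"
        unfolding t(3) by (simp add: algebra_simps)
      then show ?thesis unfolding s(3) by (simp add: algebra_simps flip: scaleR_add_left)
    qed
    then have "H ?m \<le> (1 - s) * H p + s * H x" using H_convex[of s p x] s by simp
    also have "\<dots> < (1 - s) * c + s * c" using xc s eq by (simp add: c_def)
    finally show False by (simp add: c_def algebra_simps)
  qed
qed

end

text \<open>
  By strict quasiconvexity the gap \<open>\<phi>\<close> between the larger of \<open>H e\<close>, \<open>H f\<close> and the value at the midpoint
  has a positive minimum \<open>c1\<close> over the circle. If \<open>H f\<close> is at least \<open>c1 / 2\<close> below \<open>H e\<close>, there is room
  for a level \<open>k\<close> between them and \<open>component_far_below\<close> applies; otherwise the midpoint value is below \<open>H f\<close>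
  by at least \<open>c1 / 2\<close>, and \<open>component_far_strict\<close> applies. The hypothesis \<open>\<epsilon> < norm e\<close> keeps the origin,
  the only zero of \<open>H\<close>, off the circle.
\<close>

lemma far_connection:
  fixes H :: "real^2 \<Rightarrow> real"
  assumes ham: "hamiltonian H" and \<epsilon>: "\<epsilon> > 0" "\<epsilon> < norm e"
  obtains \<delta>1 where "\<delta>1 > 0" "\<delta>1 \<le> \<epsilon>"
    "\<And>u \<delta> f x. cone_comparison H (ball 0 8) u \<Longrightarrow> 0 < \<delta> \<Longrightarrow> \<delta> \<le> \<delta>1 \<Longrightarrow>
       (\<And>x. x \<in> ball 0 8 \<Longrightarrow> \<bar>u x - u 0 - e \<bullet> x\<bar> \<le> \<delta>) \<Longrightarrow> norm (e - f) = \<epsilon> \<Longrightarrow>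
       x \<in> ball 0 1 \<Longrightarrow> u x - u 0 - f \<bullet> x > 0 \<Longrightarrow>
       \<exists>y. connected_component {z \<in> ball 0 8. u z - u 0 - f \<bullet> z > 0} x y \<and> (e - f) \<bullet> y > \<delta>"
proof -
  interpret hamiltonian H by (rule ham)
  define K where "K = H e"
  have "e \<noteq> 0" using \<epsilon> by (metis norm_zero less_asym)
  then have K: "K > 0" using H_pos by (simp add: K_def)
  define \<phi> where "\<phi> f = max (H f) K - H (f + (1/2) *\<^sub>R (e - f))" for f
  have "continuous_on (sphere e \<epsilon>) \<phi>"
    unfolding \<phi>_def
    by (intro continuous_intros continuous_on_subset[OF cont] continuous_on_compose2[OF cont]) auto
  moreover have "sphere e \<epsilon> \<noteq> {}" using \<epsilon> by simp
  ultimately obtain f0 where f0: "f0 \<in> sphere e \<epsilon>" "\<And>f. f \<in> sphere e \<epsilon> \<Longrightarrow> \<phi> f0 \<le> \<phi> f"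
    using continuous_attains_inf[OF compact_sphere] by blast
  define c1 where "c1 = \<phi> f0"
  have "f0 \<noteq> e" using f0(1) \<epsilon> by auto
  then have c1: "c1 > 0" using midpoint_strict[of f0 e] by (simp add: c1_def \<phi>_def K_def)
  define R where "R = norm e + 2 * \<epsilon>"
  obtain \<rho> where \<rho>: "\<rho> > 0" "\<And>p q. norm p \<le> R \<Longrightarrow> norm (q - p) \<le> \<rho> \<Longrightarrow> \<bar>H q - H p\<bar> \<le> c1 / 4"
    using H_unif[of "c1 / 4" R] c1 by auto
  obtain v where v: "norm v = 1" "C K v = e \<bullet> v" using support_normal[of e] K by (auto simp: K_def)
  define k where "k = max (K - c1 / 4) (K / 2)"
  have k: "k > 0" "k < K" using K c1 by (auto simp: k_def)
  obtain c where c: "c > 0" "\<And>y. C K y \<ge> C k y + c * norm y"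
    using support_strict_mono[of k K] k by auto
  define \<delta>1 where "\<delta>1 = min \<epsilon> (min (1 / (16 / c + 8 / \<epsilon>)) (min (\<rho> / (4 * (4 * \<epsilon> / c + 6))) (\<rho> / 2)))"
  have pos: "16 / c + 8 / \<epsilon> > 0" "4 * (4 * \<epsilon> / c + 6) > 0" using c \<epsilon> by (auto intro!: add_pos_pos)
  show ?thesis
  proof (rule that)
    show "\<delta>1 > 0" using \<epsilon> c \<rho> pos by (auto simp: \<delta>1_def)
    show "\<delta>1 \<le> \<epsilon>" by (simp add: \<delta>1_def)
    fix u \<delta> f x
    assume cc: "cone_comparison H (ball 0 8) u" and \<delta>: "0 < \<delta>" "\<delta> \<le> \<delta>1"
      and approx: "\<And>x. x \<in> ball 0 8 \<Longrightarrow> \<bar>u x - u 0 - e \<bullet> x\<bar> \<le> \<delta>"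
      and f: "norm (e - f) = \<epsilon>" and x: "x \<in> ball 0 1" "u x - u 0 - f \<bullet> x > 0"
    interpret planar_cone_subsolution H u
      by unfold_locales (use cc in auto)
    have ab: "{z \<in> ball 0 8. u z - u 0 - f \<bullet> z > 0} = above f" by (auto simp: above_def excess_def)
    have xab: "x \<in> above f" using x by (auto simp: above_def excess_def)
    have small: "\<delta> \<le> \<epsilon>" "\<delta> \<le> 1 / (16 / c + 8 / \<epsilon>)" "\<delta> \<le> \<rho> / (4 * (4 * \<epsilon> / c + 6))" "\<delta> \<le> \<rho> / 2"
      using \<delta> by (auto simp: \<delta>1_def)
    have s2: "8 * (2 * \<delta> / c) + 8 * (\<delta> / \<epsilon>) \<le> 1"
    proof -
      have "\<delta> * (16 / c + 8 / \<epsilon>) \<le> 1" using small(2) pos(1) by (simp add: pos_le_divide_eq)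
      then show ?thesis by (simp add: distrib_left mult.commute)
    qed
    have s3: "4 * (2 * \<epsilon> * (2 * \<delta> / c) + 6 * \<delta>) \<le> \<rho>"
    proof -
      have "\<delta> * (4 * (4 * \<epsilon> / c + 6)) \<le> \<rho>" using small(3) pos(2) by (simp only: pos_le_divide_eq)
      then show ?thesis by (simp add: algebra_simps)
    qed
    have "f \<noteq> 0" using f \<epsilon> by auto
    then have Hf: "H f > 0" by (rule H_pos)
    have fs: "f \<in> sphere e \<epsilon>" using f by (simp add: dist_norm)
    have nf: "norm f \<le> R" using f norm_triangle_ineq4[of e "e - f"] \<epsilon> by (simp add: R_def)
    have "\<exists>y\<in>component f x. (e - f) \<bullet> y > \<delta>"
    proof (cases "H f \<le> K - c1 / 2")
      case True
      show ?thesis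
      proof (rule component_far_below[OF approx \<delta>(1) Hf k(1) \<rho>(1) _ v(1) c(1) _ f[symmetric] \<epsilon>(1) refl small(1) s2 s3 xab x(1)])
        show "H (f + h) \<le> k" if "norm h \<le> \<rho>" for h
        proof -
          have "\<bar>H (f + h) - H f\<bar> \<le> c1 / 4" using \<rho>(2)[OF nf, of "f + h"] that by simp
          then have "H (f + h) \<le> K - c1 / 4" using True by linarith
          then show ?thesis by (simp add: k_def)
        qed
        show "C k v + c \<le> e \<bullet> v" using c(2)[of v] v by simp
      qed
    next
      case False
      have "c1 \<le> \<phi> f" using f0(2)[OF fs] by (simp add: c1_def)
      moreover have "max (H f) K \<le> H f + c1 / 2" using False c1 by auto
      ultimately have mid: "H (f + (1/2) *\<^sub>R (e - f)) \<le> H f - c1 / 2" unfolding \<phi>_def by linarith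
      have nm: "norm (f + (1/2) *\<^sub>R (e - f)) \<le> R"
      proof -
        have "norm (f + (1/2) *\<^sub>R (e - f)) \<le> norm f + norm ((1/2) *\<^sub>R (e - f))" by (rule norm_triangle_ineq)
        also have "\<dots> \<le> norm e + \<epsilon> + \<epsilon> / 2" using f norm_triangle_ineq4[of e "e - f"] by simp
        finally show ?thesis using \<epsilon> by (simp add: R_def)
      qed
      show ?thesis
      proof (rule component_far_strict[OF refl approx \<delta>(1) Hf \<rho>(1) _ _ xab x(1)])
        show "H (f + (1/2) *\<^sub>R (e - f) + h) \<le> H f" if "norm h \<le> \<rho>" for h
        proof -
          have "\<bar>H (f + (1/2) *\<^sub>R (e - f) + h) - H (f + (1/2) *\<^sub>R (e - f))\<bar> \<le> c1 / 4"
            using \<rho>(2)[OF nm, of "f + (1/2) *\<^sub>R (e - f) + h"] that by simp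
          then show ?thesis using mid c1 by linarith
        qed
        show "2 * \<delta> \<le> \<rho>" using small(4) by simp
      qed
    qed
    then show "\<exists>y. connected_component {z \<in> ball 0 8. u z - u 0 - f \<bullet> z > 0} x y \<and> (e - f) \<bullet> y > \<delta>"
      unfolding ab by auto
  qed
qed

section \<open>A winding number obstruction\<close>

lemma winding_number_part_circlepath_centre:
  assumes "r > 0"
  shows "winding_number (part_circlepath z r s t) z = of_real ((t - s) / (2 * pi))"
proof -
  have nz: "z \<notin> path_image (part_circlepath z r s t)"
    using path_image_part_circlepath_subset'[of r z s t] assms by auto
  have "((\<lambda>w. 1 / (w - z)) has_contour_integral (\<i> * of_real (t - s))) (part_circlepath z r s t)"
    unfolding has_contour_integral_def
  proof (rule has_integral_eq[rotated])
    have "((\<lambda>x::real. \<i> * of_real (t - s)) has_integral (1 - 0) *\<^sub>R (\<i> * of_real (t - s))) {0..1}"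
      by (rule has_integral_const_real[of "\<i> * of_real (t - s)" 0 1, simplified content_real])
    then show "((\<lambda>x::real. \<i> * of_real (t - s)) has_integral (\<i> * of_real (t - s))) {0..1}" by simp
    show "\<i> * of_real (t - s) = 1 / (part_circlepath z r s t x - z) *
        vector_derivative (part_circlepath z r s t) (at x within {0..1})" if "x \<in> {0..1}" for x
      using that assms by (simp add: vector_derivative_part_circlepath01) (simp add: part_circlepath_def)
  qed
  then have "contour_integral (part_circlepath z r s t) (\<lambda>w. 1 / (w - z)) = \<i> * of_real (t - s)"
    by (rule contour_integral_unique)
  then have "winding_number (part_circlepath z r s t) z = 1 / (of_real (2 * pi) * \<i>) * (\<i> * of_real (t - s))"
    by (simp only: winding_number_valid_path[OF valid_path_part_circlepath nz])
  then show ?thesis by simp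
qed

text \<open>
  For fixed \<open>\<theta>\<close> the winding number about \<open>q\<close> is the same for all admissible paths, since the difference of
  two of them is a loop whose outside contains \<open>q\<close>. Extending an admissible path by an arc of the circle
  gives an admissible path for nearby parameters, so the winding number minus \<open>\<theta> / (2 * pi)\<close> is locally
  constant in \<open>\<theta>\<close>, hence constant, whereas the winding number itself takes equal values at \<open>0\<close> and \<open>2 * pi\<close>.
\<close>

lemma no_rotating_path_family:
  fixes G :: "real \<Rightarrow> complex set" and p q :: complex and R :: real
  assumes R: "R > 0"
    and conn: "\<And>\<theta>. \<exists>P. path P \<and> path_image P \<subseteq> G \<theta> \<and> pathstart P = p \<and> pathfinish P = q + R * exp (\<i> * \<theta>)"
    and sep: "\<And>\<theta>. \<exists>T. connected T \<and> \<not> bounded T \<and> q \<in> T \<and> T \<inter> G \<theta> = {}"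
    and opn: "\<And>\<theta>. open (G \<theta>)"
    and stable: "\<And>\<theta> K. compact K \<Longrightarrow> K \<subseteq> G \<theta> \<Longrightarrow> \<forall>\<^sub>F \<theta>' in at \<theta>. K \<subseteq> G \<theta>'"
    and per: "G (2 * pi) = G 0"
  shows False
proof -
  define adm where "adm \<theta> P \<longleftrightarrow> path P \<and> path_image P \<subseteq> G \<theta> \<and> pathstart P = p \<and> pathfinish P = q + R * exp (\<i> * of_real \<theta>)" for \<theta> P
  have uniq: "winding_number P q = winding_number P' q" if P: "adm \<theta> P" and P': "adm \<theta> P'" for \<theta> P P'
  proof -
    obtain T where T: "connected T" "\<not> bounded T" "q \<in> T" "T \<inter> G \<theta> = {}" using sep by blast
    let ?L = "P +++ reversepath P'"
    have im: "path_image ?L \<subseteq> G \<theta>"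
      using P P' by (auto simp: adm_def path_image_join)
    have loop: "path ?L" "pathfinish ?L = pathstart ?L" using P P' by (auto simp: adm_def)
    have "T \<subseteq> connected_component_set (- path_image ?L) q"
      using T im by (intro connected_component_maximal) auto
    then have "\<not> bounded (connected_component_set (- path_image ?L) q)" using T bounded_subset by blast
    moreover have "q \<notin> path_image ?L" using T im by blast
    ultimately have "q \<in> outside (path_image ?L)" by (simp add: outside_def)
    then have "winding_number ?L q = 0" by (rule winding_number_zero_in_outside[OF loop])
    moreover have "q \<notin> path_image P" "q \<notin> path_image P'" using T P P' by (auto simp: adm_def)
    ultimately show ?thesis using P P' by (simp add: adm_def winding_number_join winding_number_reversepath)
  qed
  define b where "b \<theta> = winding_number (SOME P. adm \<theta> P) q" for \<theta>
  have some: "adm \<theta> (SOME P. adm \<theta> P)" for \<theta>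
    using conn[of \<theta>] unfolding adm_def by (rule someI_ex)
  have b: "b \<theta> = winding_number P q" if "adm \<theta> P" for \<theta> P
    unfolding b_def using uniq[OF some that] .
  define c where "c \<theta> = b \<theta> - of_real (\<theta> / (2 * pi))" for \<theta>
  have "c 0 = c (2 * pi)"
  proof (rule connected_local_const[of "UNIV :: real set"], goal_cases)
    case 4
    show ?case
    proof
      fix \<theta>\<^sub>0 :: real
      define P where "P = (SOME P. adm \<theta>\<^sub>0 P)"
      have P: "adm \<theta>\<^sub>0 P" unfolding P_def by (rule some)
      define A where "A = q + R * exp (\<i> * of_real \<theta>\<^sub>0)"
      have "A \<in> G \<theta>\<^sub>0" using P pathfinish_in_path_image[of P] by (auto simp: adm_def A_def)
      then obtain e where e: "e > 0" "cball A e \<subseteq> G \<theta>\<^sub>0" using opn open_contains_cball by blast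
      have cK: "compact (path_image P \<union> cball A e)"
        using P by (auto simp: adm_def compact_path_image intro!: compact_Un)
      have KG: "path_image P \<union> cball A e \<subseteq> G \<theta>\<^sub>0" using P e by (auto simp: adm_def)
      have "\<forall>\<^sub>F \<theta> in at \<theta>\<^sub>0. \<bar>\<theta> - \<theta>\<^sub>0\<bar> < e / R"
        using e R by (auto simp: eventually_at dist_real_def intro!: exI[of _ "e / R"])
      with stable[OF cK KG] show "\<forall>\<^sub>F \<theta> in at \<theta>\<^sub>0 within UNIV. c \<theta>\<^sub>0 = c \<theta>"
      proof eventually_elim
        case (elim \<theta>)
        let ?Q = "P +++ part_circlepath q R \<theta>\<^sub>0 \<theta>"
        have arc: "path_image (part_circlepath q R \<theta>\<^sub>0 \<theta>) \<subseteq> cball A e"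
        proof
          fix w assume "w \<in> path_image (part_circlepath q R \<theta>\<^sub>0 \<theta>)"
          then obtain x where x: "x \<in> closed_segment \<theta>\<^sub>0 \<theta>" "w = q + R * cis x"
            by (auto simp: path_image_part_circlepath')
          have "\<bar>x - \<theta>\<^sub>0\<bar> \<le> \<bar>\<theta> - \<theta>\<^sub>0\<bar>" using x(1) by (auto simp: closed_segment_eq_real_ivl split: if_splits)
          moreover have "norm (cis x - cis \<theta>\<^sub>0) \<le> \<bar>x - \<theta>\<^sub>0\<bar>"
          proof -
            have "cis x - cis \<theta>\<^sub>0 = cis \<theta>\<^sub>0 * (exp (\<i> * of_real (x - \<theta>\<^sub>0)) - 1)"
              by (simp add: cis_conv_exp right_diff_distrib flip: exp_add)
            then have "norm (cis x - cis \<theta>\<^sub>0) = 2 * \<bar>sin ((x - \<theta>\<^sub>0) / 2)\<bar>"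
              by (simp only: norm_mult norm_cis dist_exp_i_1)
            also have "\<dots> \<le> 2 * \<bar>(x - \<theta>\<^sub>0) / 2\<bar>" by (intro mult_left_mono abs_sin_x_le_abs_x) auto
            finally have "norm (cis x - cis \<theta>\<^sub>0) \<le> \<bar>x - \<theta>\<^sub>0\<bar>" by simp
            then show ?thesis by simp
          qed
          ultimately have "norm (cis x - cis \<theta>\<^sub>0) < e / R" using elim by linarith
          moreover have "dist A w = R * norm (cis x - cis \<theta>\<^sub>0)"
            using R unfolding A_def x(2) cis_conv_exp[symmetric]
            by (simp add: dist_norm norm_minus_commute flip: right_diff_distrib) (simp add: norm_mult)
          ultimately show "w \<in> cball A e" using R by (simp add: field_simps)
        qed
        have Q: "adm \<theta> ?Q"
          using P arc elim by (auto simp: adm_def path_image_join)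
        have q: "q \<notin> path_image P" "q \<notin> path_image (part_circlepath q R \<theta>\<^sub>0 \<theta>)"
          using sep[of \<theta>\<^sub>0] KG arc by blast+
        have "b \<theta> = winding_number P q + winding_number (part_circlepath q R \<theta>\<^sub>0 \<theta>) q"
          unfolding b[OF Q] using P q by (intro winding_number_join) (auto simp: adm_def)
        then show ?case
          using b[OF P] by (simp add: c_def winding_number_part_circlepath_centre[OF R] field_simps)
      qed
    qed
  qed auto
  moreover have "b (2 * pi) = b 0"
  proof -
    have "adm 0 (SOME P. adm (2 * pi) P)"
      using some[of "2 * pi"] unfolding adm_def[of 0] unfolding adm_def[of "2 * pi"] per
      by (simp add: mult.commute[of \<i>] exp_two_pi_i)
    then show ?thesis unfolding b_def[of "2 * pi"] using b by simp
  qed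
  ultimately show False by (simp add: c_def)
qed

text \<open>
  Winding numbers refer to paths in the complex plane; this isometry carries them over to \<open>real^2\<close>.
\<close>

definition plane_of :: "complex \<Rightarrow> real^2" where
  "plane_of z = Re z *\<^sub>R axis 1 1 + Im z *\<^sub>R axis 2 1"

lemma plane_of_nth [simp]: "plane_of z $ 1 = Re z" "plane_of z $ 2 = Im z"
  by (simp_all add: plane_of_def axis_def)

lemma linear_plane_of: "linear plane_of"
  by (rule linearI) (simp_all add: vec_eq_iff forall_2)

lemma norm_plane_of [simp]: "norm (plane_of z) = cmod z"
  by (simp add: norm_vec_def L2_set_def UNIV_2 cmod_def)

lemma continuous_plane_of: "continuous_on A plane_of"
  unfolding plane_of_def by (intro continuous_intros)

definition complex_of_plane :: "real^2 \<Rightarrow> complex" where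
  "complex_of_plane x = Complex (x $ 1) (x $ 2)"

lemma plane_of_inverse [simp]: "plane_of (complex_of_plane x) = x" "complex_of_plane (plane_of z) = z"
  by (simp_all add: vec_eq_iff forall_2 complex_of_plane_def)

lemma continuous_complex_of_plane: "continuous_on A complex_of_plane"
  unfolding complex_of_plane_def by (intro continuous_intros)

lemma convex_component_subset:
  fixes x :: "'a::real_normed_vector"
  assumes "convex T" "T \<subseteq> S" "connected_component S x y" "y \<in> T" "z \<in> T"
  shows "connected_component S x z"
proof -
  have "connected_component S y z"
    unfolding connected_component_def
    by (intro exI[of _ T] conjI convex_connected[OF assms(1)] assms(2,4,5))
  with assms(3) show ?thesis by (rule connected_component_trans)
qed

text \<open>
  Parametrize the circle as \<open>f \<theta> = e - \<epsilon> *\<^sub>R W \<theta>\<close> with unit vectors \<open>W \<theta>\<close>, and take \<open>p\<close> a small positive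
  multiple of \<open>b - e\<close>. If \<open>b\<close> is outside the circle, then the increments of \<open>u\<close> at \<open>p\<close> and \<open>-p\<close>, which are
  almost those of slope \<open>b\<close>, exceed, respectively fall short of, those of every slope \<open>f \<theta>\<close>. The point \<open>p\<close> is
  joined in the positive set to \<open>-p + 4 *\<^sub>R W \<theta>\<close>, while the negative component of \<open>-p\<close> together with a
  ray in direction \<open>-W \<theta>\<close> joins \<open>-p\<close> to infinity outside the positive set. This contradicts
  \<open>no_rotating_path_family\<close>.
\<close>

lemma slope_near_of_far_connection:
  fixes u :: "real^2 \<Rightarrow> real"
  assumes uc: "continuous_on (ball 0 8) u" and \<epsilon>: "\<epsilon> > 0" and \<delta>: "0 < \<delta>" "\<delta> \<le> \<epsilon>"
    and approx: "\<And>x. x \<in> ball 0 8 \<Longrightarrow> \<bar>u x - u 0 - e \<bullet> x\<bar> \<le> \<delta>"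
    and up: "\<And>f x. norm (e - f) = \<epsilon> \<Longrightarrow> x \<in> ball 0 1 \<Longrightarrow> u x - u 0 - f \<bullet> x > 0 \<Longrightarrow>
       \<exists>y. connected_component {z \<in> ball 0 8. u z - u 0 - f \<bullet> z > 0} x y \<and> (e - f) \<bullet> y > \<delta>"
    and down: "\<And>f x. norm (e - f) = \<epsilon> \<Longrightarrow> x \<in> ball 0 1 \<Longrightarrow> u x - u 0 - f \<bullet> x < 0 \<Longrightarrow>
       \<exists>y. connected_component {z \<in> ball 0 8. u z - u 0 - f \<bullet> z < 0} x y \<and> (e - f) \<bullet> y < - \<delta>"
    and slope: "\<And>\<kappa>. \<kappa> > 0 \<Longrightarrow> \<exists>r. 0 < r \<and> r < \<kappa> \<and> (\<forall>y\<in>ball 0 1. \<bar>(u (r *\<^sub>R y) - u 0) / r - b \<bullet> y\<bar> \<le> \<kappa>)"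
  shows "norm (e - b) \<le> \<epsilon>"
proof (rule ccontr)
  assume neg: "\<not> ?thesis"
  define g where "g = b - e"
  have g: "norm g > \<epsilon>" using neg by (simp add: g_def norm_minus_commute)
  define \<kappa> where "\<kappa> = min 1 ((norm g - \<epsilon>) / 4)"
  have \<kappa>: "\<kappa> > 0" "\<kappa> \<le> 1" "4 * \<kappa> \<le> norm g - \<epsilon>"
    using g min.cobounded2[of 1 "(norm g - \<epsilon>) / 4"] by (auto simp: \<kappa>_def simp del: min.cobounded2)
  obtain r where r: "0 < r" "r < \<kappa>" "\<And>y. y \<in> ball 0 1 \<Longrightarrow> \<bar>(u (r *\<^sub>R y) - u 0) / r - b \<bullet> y\<bar> \<le> \<kappa>"
    using slope[OF \<kappa>(1)] by blast
  define p0 where "p0 = (1 / (2 * norm g)) *\<^sub>R g"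
  define p where "p = r *\<^sub>R p0"
  have ng: "norm g > 0" using g \<epsilon> by linarith
  have np0: "norm p0 = 1/2" using ng by (simp add: p0_def)
  then have "norm p = r * (1/2)" unfolding p_def norm_scaleR using r by simp
  then have np: "norm p < 1/2" using r \<kappa> by linarith
  define W where "W \<theta> = plane_of (exp (\<i> * of_real \<theta>))" for \<theta> :: real
  have nW: "norm (W \<theta>) = 1" for \<theta> by (simp add: W_def)
  have WW: "W \<theta> \<bullet> W \<theta> = 1" for \<theta> using nW[of \<theta>] by (simp add: norm_eq_1)
  define f where "f \<theta> = e - \<epsilon> *\<^sub>R W \<theta>" for \<theta>
  have ef: "e - f \<theta> = \<epsilon> *\<^sub>R W \<theta>" "norm (e - f \<theta>) = \<epsilon>" for \<theta> using nW \<epsilon> by (simp_all add: f_def)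
  define w where "w \<theta> x = u x - u 0 - f \<theta> \<bullet> x" for \<theta> x
  have wd: "\<bar>w \<theta> x - \<epsilon> * (W \<theta> \<bullet> x)\<bar> \<le> \<delta>" if "x \<in> ball 0 8" for \<theta> x
    using approx[OF that] by (simp add: w_def f_def inner_diff_left)
  \<comment> \<open>All slopes on the circle are smaller than \<open>b\<close> in the direction of \<open>b - e\<close>.\<close>
  have far: "(b - f \<theta>) \<bullet> p0 > \<kappa>" for \<theta>
  proof -
    have "(b - f \<theta>) \<bullet> p0 = g \<bullet> p0 + \<epsilon> * (W \<theta> \<bullet> p0)" by (simp add: f_def g_def inner_diff_left inner_add_left)
    moreover have "g \<bullet> p0 = norm g / 2" using ng by (simp add: p0_def dot_square_norm power2_eq_square)
    moreover have "\<bar>W \<theta> \<bullet> p0\<bar> \<le> 1/2" using Cauchy_Schwarz_ineq2[of "W \<theta>" p0] nW np0 by simp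
    then have "\<epsilon> * (W \<theta> \<bullet> p0) \<ge> \<epsilon> * (- (1/2))" using \<epsilon> by (intro mult_left_mono) auto
    ultimately show ?thesis using \<kappa> by linarith
  qed
  have wp: "w \<theta> p > 0" for \<theta>
  proof -
    have "(u p - u 0) / r \<ge> b \<bullet> p0 - \<kappa>" using r(3)[of p0] np0 by (simp add: p_def abs_le_iff)
    then have "u p - u 0 \<ge> (b \<bullet> p0 - \<kappa>) * r" using r(1) by (simp add: pos_le_divide_eq)
    moreover have "((b - f \<theta>) \<bullet> p0 - \<kappa>) * r > 0" using far[of \<theta>] r by simp
    ultimately show ?thesis by (simp add: w_def p_def inner_diff_left algebra_simps)
  qed
  have wq: "w \<theta> (- p) < 0" for \<theta>
  proof -
    have "(u (- p) - u 0) / r \<le> - (b \<bullet> p0) + \<kappa>" using r(3)[of "- p0"] np0 by (simp add: p_def abs_le_iff)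
    then have "u (- p) - u 0 \<le> (- (b \<bullet> p0) + \<kappa>) * r" using r(1) by (simp add: pos_divide_le_eq)
    moreover have "((b - f \<theta>) \<bullet> p0 - \<kappa>) * r > 0" using far[of \<theta>] r by simp
    ultimately show ?thesis by (simp add: w_def p_def inner_diff_left algebra_simps)
  qed
  define A where "A \<theta> = {x \<in> ball 0 8. w \<theta> x > 0}" for \<theta>
  define B where "B \<theta> = {x \<in> ball 0 8. w \<theta> x < 0}" for \<theta>
  have wc: "continuous_on (ball 0 8) (w \<theta>)" for \<theta> unfolding w_def by (intro continuous_intros uc)
  have oA: "open (A \<theta>)" for \<theta>
  proof -
    obtain T where "open T" "T \<inter> ball 0 8 = {x \<in> ball 0 8. 0 < w \<theta> x}"
      using open_Collect_less_Int[OF continuous_on_const wc, of 0 \<theta>] by blast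
    then show ?thesis using open_Int[OF _ open_ball] unfolding A_def by metis
  qed
  have cvx: "convex {x \<in> ball 0 8. \<epsilon> * (W \<theta> \<bullet> x) > \<delta>}" "convex {x \<in> ball 0 8. \<epsilon> * (W \<theta> \<bullet> x) < - \<delta>}" for \<theta>
  proof -
    have "{x \<in> ball 0 8. \<epsilon> * (W \<theta> \<bullet> x) > \<delta>} = ball 0 8 \<inter> {x. (\<epsilon> *\<^sub>R W \<theta>) \<bullet> x > \<delta>}"
      "{x \<in> ball 0 8. \<epsilon> * (W \<theta> \<bullet> x) < - \<delta>} = ball 0 8 \<inter> {x. (\<epsilon> *\<^sub>R W \<theta>) \<bullet> x < - \<delta>}" by auto
    then show "convex {x \<in> ball 0 8. \<epsilon> * (W \<theta> \<bullet> x) > \<delta>}" "convex {x \<in> ball 0 8. \<epsilon> * (W \<theta> \<bullet> x) < - \<delta>}"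
      by (simp_all only: convex_Int convex_ball convex_halfspace_gt convex_halfspace_lt)
  qed
  have Wp: "\<bar>W \<theta> \<bullet> p\<bar> < 1/2" for \<theta> using Cauchy_Schwarz_ineq2[of "W \<theta>" p] nW np by simp
  have endA: "connected_component (A \<theta>) p (- p + 4 *\<^sub>R W \<theta>)" for \<theta>
  proof -
    have p1: "p \<in> ball 0 1" using np by simp
    obtain y where y: "connected_component (A \<theta>) p y" "\<epsilon> * (W \<theta> \<bullet> y) > \<delta>"
      using up[OF ef(2)[of \<theta>] p1] wp[of \<theta>] unfolding A_def w_def ef by auto
    show ?thesis
    proof (rule convex_component_subset[OF cvx(1)[of \<theta>] _ y(1)])
      show "{x \<in> ball 0 8. \<delta> < \<epsilon> * (W \<theta> \<bullet> x)} \<subseteq> A \<theta>"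
      proof
        fix x assume "x \<in> {x \<in> ball 0 8. \<delta> < \<epsilon> * (W \<theta> \<bullet> x)}"
        then show "x \<in> A \<theta>" using wd[of x \<theta>] by (auto simp: A_def abs_le_iff)
      qed
      have "y \<in> A \<theta>" using connected_component_in[OF y(1)] by simp
      then show "y \<in> {x \<in> ball 0 8. \<delta> < \<epsilon> * (W \<theta> \<bullet> x)}" using y(2) by (simp add: A_def)
      have "norm (- p + 4 *\<^sub>R W \<theta>) \<le> norm p + 4" using norm_triangle_ineq[of "- p" "4 *\<^sub>R W \<theta>"] nW by simp
      moreover have "\<epsilon> * (W \<theta> \<bullet> (- p + 4 *\<^sub>R W \<theta>)) > \<epsilon> * 1"
        using Wp[of \<theta>] WW[of \<theta>] \<epsilon> by (intro mult_strict_left_mono) (auto simp: inner_add_right inner_diff_right)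
      ultimately have "norm (- p + 4 *\<^sub>R W \<theta>) < 8" "\<delta> < \<epsilon> * (W \<theta> \<bullet> (- p + 4 *\<^sub>R W \<theta>))"
        using np \<delta> by linarith+
      then show "- p + 4 *\<^sub>R W \<theta> \<in> {x \<in> ball 0 8. \<delta> < \<epsilon> * (W \<theta> \<bullet> x)}"
        unfolding mem_Collect_eq mem_ball_0 by (rule conjI)
    qed
  qed
  have farB: "- p - t *\<^sub>R W \<theta> \<notin> A \<theta>" "- p - t *\<^sub>R W \<theta> \<in> ball 0 8 \<Longrightarrow> - p - t *\<^sub>R W \<theta> \<in> {x \<in> ball 0 8. \<epsilon> * (W \<theta> \<bullet> x) < - \<delta>}"
    if t: "t \<ge> 4" for t \<theta>
  proof -
    have "\<epsilon> * (W \<theta> \<bullet> (- p - t *\<^sub>R W \<theta>)) < \<epsilon> * (- 1)"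
      using Wp[of \<theta>] WW[of \<theta>] \<epsilon> t by (intro mult_strict_left_mono) (auto simp: inner_diff_right)
    then have *: "\<epsilon> * (W \<theta> \<bullet> (- p - t *\<^sub>R W \<theta>)) < - \<delta>" using \<delta> by linarith
    then show "- p - t *\<^sub>R W \<theta> \<in> ball 0 8 \<Longrightarrow> - p - t *\<^sub>R W \<theta> \<in> {x \<in> ball 0 8. \<epsilon> * (W \<theta> \<bullet> x) < - \<delta>}" by simp
    show "- p - t *\<^sub>R W \<theta> \<notin> A \<theta>"
    proof
      assume "- p - t *\<^sub>R W \<theta> \<in> A \<theta>"
      then have "- p - t *\<^sub>R W \<theta> \<in> ball 0 8" "w \<theta> (- p - t *\<^sub>R W \<theta>) > 0" unfolding A_def by blast+
      then show False using wd[of "- p - t *\<^sub>R W \<theta>" \<theta>] * by linarith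
    qed
  qed
  have endB: "connected_component (B \<theta>) (- p) (- p - 4 *\<^sub>R W \<theta>)" for \<theta>
  proof -
    have p1: "- p \<in> ball 0 1" using np by simp
    obtain y where y: "connected_component (B \<theta>) (- p) y" "\<epsilon> * (W \<theta> \<bullet> y) < - \<delta>"
      using down[OF ef(2)[of \<theta>] p1] wq[of \<theta>] unfolding B_def w_def ef by auto
    show ?thesis
    proof (rule convex_component_subset[OF cvx(2)[of \<theta>] _ y(1)])
      show "{x \<in> ball 0 8. \<epsilon> * (W \<theta> \<bullet> x) < - \<delta>} \<subseteq> B \<theta>"
      proof
        fix x assume "x \<in> {x \<in> ball 0 8. \<epsilon> * (W \<theta> \<bullet> x) < - \<delta>}"
        then show "x \<in> B \<theta>" using wd[of x \<theta>] by (auto simp: B_def abs_le_iff)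
      qed
      have "y \<in> B \<theta>" using connected_component_in[OF y(1)] by simp
      then show "y \<in> {x \<in> ball 0 8. \<epsilon> * (W \<theta> \<bullet> x) < - \<delta>}" using y(2) by (simp add: B_def)
      have "norm (- p - 4 *\<^sub>R W \<theta>) \<le> norm p + 4" using norm_triangle_ineq4[of "- p" "4 *\<^sub>R W \<theta>"] nW by simp
      then have "- p - 4 *\<^sub>R W \<theta> \<in> ball 0 8" using np by simp
      then show "- p - 4 *\<^sub>R W \<theta> \<in> {x \<in> ball 0 8. \<epsilon> * (W \<theta> \<bullet> x) < - \<delta>}" by (rule farB(2)[rotated]) simp
    qed
  qed
  have Wlip: "continuous_on UNIV W" unfolding W_def
    by (intro continuous_on_compose2[OF continuous_plane_of] continuous_intros) auto
  define G where "G \<theta> = plane_of -` A \<theta>" for \<theta>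
  define q where "q = complex_of_plane (- p)"
  have plane_q: "plane_of (q + 4 * exp (\<i> * of_real \<theta>)) = - p + 4 *\<^sub>R W \<theta>" for \<theta>
  proof -
    have "plane_of (q + 4 *\<^sub>R exp (\<i> * of_real \<theta>)) = plane_of q + 4 *\<^sub>R W \<theta>"
      by (simp only: W_def linear_add[OF linear_plane_of] linear_cmul[OF linear_plane_of])
    then show ?thesis by (simp add: q_def scaleR_conv_of_real)
  qed
  show False
  proof (rule no_rotating_path_family[where R = 4 and p = "complex_of_plane p" and q = q and G = G])
    show "\<exists>P. path P \<and> path_image P \<subseteq> G \<theta> \<and> pathstart P = complex_of_plane p \<and>
        pathfinish P = q + of_real 4 * exp (\<i> * of_real \<theta>)" for \<theta>
    proof -
      have "path_component (A \<theta>) p (- p + 4 *\<^sub>R W \<theta>)"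
        using endA[of \<theta>] by (simp only: open_path_connected_component[OF oA])
      then obtain P where P: "path P" "path_image P \<subseteq> A \<theta>" "pathstart P = p" "pathfinish P = - p + 4 *\<^sub>R W \<theta>"
        by (auto simp: path_component_def)
      have "complex_of_plane (- p + 4 *\<^sub>R W \<theta>) = q + of_real 4 * exp (\<i> * of_real \<theta>)"
        using plane_q[of \<theta>] plane_of_inverse(2) by (metis of_real_numeral)
      then show ?thesis using P
        by (intro exI[of _ "complex_of_plane \<circ> P"])
           (auto simp: G_def path_image_compose pathstart_compose pathfinish_compose
             intro!: path_continuous_image continuous_complex_of_plane)
    qed
    show "open (G \<theta>)" for \<theta>
      unfolding G_def by (rule open_vimage[OF oA continuous_plane_of])
    show "\<exists>T. connected T \<and> \<not> bounded T \<and> q \<in> T \<and> T \<inter> G \<theta> = {}" for \<theta>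
    proof -
      define Ray where "Ray = (\<lambda>t. - p - t *\<^sub>R W \<theta>) ` {4..}"
      define Q where "Q = connected_component_set (B \<theta>) (- p)"
      have "connected Ray" unfolding Ray_def by (intro connected_continuous_image continuous_intros connected_Ici)
      moreover have "- p - 4 *\<^sub>R W \<theta> \<in> Q \<inter> Ray" using endB[of \<theta>] by (auto simp: Q_def Ray_def)
      ultimately have cQR: "connected (Q \<union> Ray)" unfolding Q_def
        by (intro connected_Un connected_connected_component) blast+
      have "connected (complex_of_plane ` (Q \<union> Ray))"
        by (rule connected_continuous_image[OF continuous_complex_of_plane cQR])
      moreover have "\<not> bounded (complex_of_plane ` (Q \<union> Ray))"
      proof
        assume "bounded (complex_of_plane ` (Q \<union> Ray))"
        then obtain M where M: "\<And>x. x \<in> Q \<union> Ray \<Longrightarrow> norm (complex_of_plane x) \<le> M" by (auto simp: bounded_iff)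
        have nn: "norm (complex_of_plane x) = norm x" for x using norm_plane_of[of "complex_of_plane x"] by simp
        define t where "t = max 4 (M + 1)"
        have "- p - t *\<^sub>R W \<theta> \<in> Ray" by (auto simp: Ray_def t_def)
        then have "norm (- p - t *\<^sub>R W \<theta>) \<le> M" using M nn by (metis UnI2)
        moreover have "norm (t *\<^sub>R W \<theta>) \<le> norm (- p - t *\<^sub>R W \<theta>) + norm p"
          using norm_triangle_ineq4[of "- p" "- p - t *\<^sub>R W \<theta>"] by simp
        ultimately show False using nW[of \<theta>] np by (simp add: t_def)
      qed
      moreover have "q \<in> complex_of_plane ` (Q \<union> Ray)"
        using wq[of \<theta>] np by (auto simp: q_def Q_def B_def intro!: imageI)
      moreover have "complex_of_plane ` (Q \<union> Ray) \<inter> G \<theta> = {}"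
      proof -
        have "Q \<subseteq> B \<theta>" unfolding Q_def by (rule connected_component_subset)
        then have "Q \<inter> A \<theta> = {}" by (auto simp: A_def B_def)
        moreover have "Ray \<inter> A \<theta> = {}" using farB(1) by (auto simp: Ray_def)
        ultimately show ?thesis by (auto simp: G_def)
      qed
      ultimately show ?thesis by blast
    qed
    \<comment> \<open>On a compact subset of the positive set the deviation has a positive minimum, and it varies
      uniformly continuously with \<open>\<theta>\<close>.\<close>
    show "\<forall>\<^sub>F \<theta>' in at \<theta>. K \<subseteq> G \<theta>'" if K: "compact K" "K \<subseteq> G \<theta>" for \<theta> K
    proof (cases "K = {}")
      case False
      have cK: "compact (plane_of ` K)" by (intro compact_continuous_image continuous_plane_of K)
      have KA: "plane_of ` K \<subseteq> A \<theta>" using K by (auto simp: G_def)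
      then have K8: "plane_of ` K \<subseteq> ball 0 8" by (auto simp: A_def)
      obtain x0 where x0: "x0 \<in> plane_of ` K" "\<And>x. x \<in> plane_of ` K \<Longrightarrow> w \<theta> x0 \<le> w \<theta> x"
        using continuous_attains_inf[OF cK _ continuous_on_subset[OF wc K8], of \<theta>] False by blast
      define \<mu> where "\<mu> = w \<theta> x0"
      have \<mu>: "\<mu> > 0" using x0(1) KA by (auto simp: \<mu>_def A_def)
      have "isCont W \<theta>" using Wlip by (simp add: continuous_on_eq_continuous_at)
      then have "\<forall>\<^sub>F \<theta>' in at \<theta>. dist (W \<theta>') (W \<theta>) < \<mu> / (8 * \<epsilon>)"
        unfolding isCont_def using \<mu> \<epsilon> by (intro tendstoD) auto
      then show ?thesis
      proof eventually_elim
        case (elim \<theta>')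
        show ?case
        proof
          fix z assume z: "z \<in> K"
          define x where "x = plane_of z"
          have x: "x \<in> ball 0 8" "\<mu> \<le> w \<theta> x" using z K8 x0(2) by (auto simp: x_def \<mu>_def)
          have "w \<theta>' x - w \<theta> x = \<epsilon> * ((W \<theta>' - W \<theta>) \<bullet> x)"
            by (simp add: w_def f_def inner_diff_left algebra_simps)
          then have "\<bar>w \<theta>' x - w \<theta> x\<bar> = \<epsilon> * \<bar>(W \<theta>' - W \<theta>) \<bullet> x\<bar>" using \<epsilon> by (simp add: abs_mult)
          also have "\<bar>(W \<theta>' - W \<theta>) \<bullet> x\<bar> \<le> norm (W \<theta>' - W \<theta>) * norm x" by (rule Cauchy_Schwarz_ineq2)
          also have "norm (W \<theta>' - W \<theta>) * norm x \<le> norm (W \<theta>' - W \<theta>) * 8"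
            using x by (intro mult_left_mono) auto
          also have "\<epsilon> * (norm (W \<theta>' - W \<theta>) * 8) = norm (W \<theta>' - W \<theta>) * (8 * \<epsilon>)" by simp
          also have "\<dots> < \<mu>" using elim \<epsilon> by (simp add: dist_norm pos_less_divide_eq)
          finally have "\<bar>w \<theta>' x - w \<theta> x\<bar> < \<mu>" using \<epsilon> by simp
          then have "w \<theta>' x > 0" using x(2) by linarith
          then show "z \<in> G \<theta>'" using x(1) by (simp add: G_def A_def x_def)
        qed
      qed
    qed auto
    show "G (2 * pi) = G 0"
    proof -
      have "W (2 * pi) = W 0" by (simp add: W_def mult.commute[of \<i>])
      then show ?thesis by (simp add: G_def A_def w_def f_def)
    qed
  qed auto
qed

section \<open>Existence of blow-up slopes\<close>

text \<open>
  The sequence and the extended real suprema in the definition are eliminated in favour of approximation to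
  every accuracy at arbitrarily small scales.
\<close>

lemma blowup_slopes_iff:
  fixes u :: "'a::euclidean_space \<Rightarrow> real"
  shows "e \<in> blowup_slopes u 0 \<longleftrightarrow>
    (\<forall>\<kappa>>0. \<exists>r. 0 < r \<and> r < \<kappa> \<and> (\<forall>y\<in>ball 0 1. \<bar>(u (r *\<^sub>R y) - u 0) / r - e \<bullet> y\<bar> \<le> \<kappa>))"
    (is "?L \<longleftrightarrow> ?R")
proof
  assume ?L
  then obtain r :: "nat \<Rightarrow> real" where r: "\<And>k. r k > 0" "r \<longlonglongrightarrow> 0"
    "(\<lambda>k. SUP y\<in>ball 0 1. ereal \<bar>(u (r k *\<^sub>R y) - u 0) / r k - e \<bullet> y\<bar>) \<longlonglongrightarrow> 0"
    by (auto simp: blowup_slopes_def)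
  show ?R
  proof (intro allI impI)
    fix \<kappa> :: real assume \<kappa>: "\<kappa> > 0"
    have "\<forall>\<^sub>F k in sequentially. (SUP y\<in>ball 0 1. ereal \<bar>(u (r k *\<^sub>R y) - u 0) / r k - e \<bullet> y\<bar>) < ereal \<kappa>"
      using order_tendstoD(2)[OF r(3), of "ereal \<kappa>"] \<kappa> by simp
    moreover have "\<forall>\<^sub>F k in sequentially. r k < \<kappa>" using order_tendstoD(2)[OF r(2) \<kappa>] .
    ultimately have "\<forall>\<^sub>F k in sequentially. (SUP y\<in>ball 0 1. ereal \<bar>(u (r k *\<^sub>R y) - u 0) / r k - e \<bullet> y\<bar>) < ereal \<kappa> \<and> r k < \<kappa>"
      by (rule eventually_conj)
    then obtain k where k: "(SUP y\<in>ball 0 1. ereal \<bar>(u (r k *\<^sub>R y) - u 0) / r k - e \<bullet> y\<bar>) < ereal \<kappa>" "r k < \<kappa>"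
      using eventually_happens'[OF sequentially_bot] by blast
    have "\<bar>(u (r k *\<^sub>R y) - u 0) / r k - e \<bullet> y\<bar> \<le> \<kappa>" if y: "y \<in> ball 0 1" for y
    proof -
      have "ereal \<bar>(u (r k *\<^sub>R y) - u 0) / r k - e \<bullet> y\<bar> \<le> (SUP y\<in>ball 0 1. ereal \<bar>(u (r k *\<^sub>R y) - u 0) / r k - e \<bullet> y\<bar>)"
        using y by (rule SUP_upper)
      also have "\<dots> < ereal \<kappa>" by (rule k)
      finally show ?thesis by simp
    qed
    then show "\<exists>r. 0 < r \<and> r < \<kappa> \<and> (\<forall>y\<in>ball 0 1. \<bar>(u (r *\<^sub>R y) - u 0) / r - e \<bullet> y\<bar> \<le> \<kappa>)"
      using r(1) k(2) by blast
  qed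
next
  assume R: ?R
  define h where "h k = inverse (real (Suc k))" for k
  have h: "h k > 0" for k by (simp add: h_def)
  have "\<exists>r. 0 < r \<and> r < h k \<and> (\<forall>y\<in>ball 0 1. \<bar>(u (r *\<^sub>R y) - u 0) / r - e \<bullet> y\<bar> \<le> h k)" for k
    using R h by blast
  then obtain r where r: "\<And>k. 0 < r k" "\<And>k. r k < h k"
    "\<And>k y. y \<in> ball 0 1 \<Longrightarrow> \<bar>(u (r k *\<^sub>R y) - u 0) / r k - e \<bullet> y\<bar> \<le> h k" by metis
  have hl: "h \<longlonglongrightarrow> 0" unfolding h_def by (rule LIMSEQ_inverse_real_of_nat)
  have "r \<longlonglongrightarrow> 0"
    by (rule tendsto_sandwich[OF _ _ tendsto_const hl]) (use r in \<open>auto intro!: always_eventually less_imp_le\<close>)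
  moreover have "(\<lambda>k. SUP y\<in>ball 0 1. ereal \<bar>(u (r k *\<^sub>R y) - u 0) / r k - e \<bullet> y\<bar>) \<longlonglongrightarrow> 0"
  proof (rule tendsto_sandwich[OF _ _ tendsto_const])
    show "(\<lambda>k. ereal (h k)) \<longlonglongrightarrow> 0" using hl by (simp add: zero_ereal_def)
    have "(SUP y\<in>ball 0 1. ereal \<bar>(u (r k *\<^sub>R y) - u 0) / r k - e \<bullet> y\<bar>) \<le> ereal (h k)" for k
      by (rule SUP_least) (use r(3) in simp)
    then show "\<forall>\<^sub>F k in sequentially. (SUP y\<in>ball 0 1. ereal \<bar>(u (r k *\<^sub>R y) - u 0) / r k - e \<bullet> y\<bar>) \<le> ereal (h k)"
      by (intro always_eventually allI)
    have "0 \<le> (SUP y\<in>ball 0 1. ereal \<bar>(u (r k *\<^sub>R y) - u 0) / r k - e \<bullet> y\<bar>)" for k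
      by (rule SUP_upper2[of 0]) auto
    then show "\<forall>\<^sub>F k in sequentially. 0 \<le> (SUP y\<in>ball 0 1. ereal \<bar>(u (r k *\<^sub>R y) - u 0) / r k - e \<bullet> y\<bar>)"
      by (intro always_eventually allI)
  qed
  ultimately show ?L using r(1) unfolding blowup_slopes_def by auto
qed

text \<open>
  As \<open>H\<close> vanishes only at the origin, its sublevel sets shrink to the origin.
\<close>

lemma (in hamiltonian) support_small:
  assumes "\<kappa> > 0"
  obtains k where "k > 0" "\<And>y. C k y \<le> \<kappa> * norm y"
proof -
  have ne: "sphere (0::'a) \<kappa> \<noteq> {}" using assms by simp
  obtain q where q: "q \<in> sphere 0 \<kappa>" "\<And>p. p \<in> sphere 0 \<kappa> \<Longrightarrow> H q \<le> H p"
    using continuous_attains_inf[OF compact_sphere ne continuous_on_subset[OF cont]] by blast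
  have "q \<noteq> 0" using q(1) assms by auto
  then have Hq: "H q > 0" by (rule H_pos)
  have "norm p \<le> \<kappa>" if "H p \<le> H q / 2" for p
  proof (rule ccontr)
    assume p: "\<not> norm p \<le> \<kappa>"
    define t where "t = \<kappa> / norm p"
    have "norm p > 0" using p assms by linarith
    then have t: "0 < t" "t \<le> 1" "t * norm p = \<kappa>" using p assms by (auto simp: t_def divide_le_eq)
    have "H (t *\<^sub>R p) \<le> t * H p" using H_convex[of t 0 p] t H_0 by simp
    also have "\<dots> \<le> 1 * H p" using t H_nonneg by (intro mult_right_mono) auto
    finally have "H (t *\<^sub>R p) < H q" using that Hq by linarith
    moreover have "t *\<^sub>R p \<in> sphere 0 \<kappa>" using t by simp
    ultimately show False using q(2)[of "t *\<^sub>R p"] by linarith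
  qed
  then have "C (H q / 2) y \<le> \<kappa> * norm y" for y using Hq by (intro support_le_norm) auto
  then show ?thesis using that[of "H q / 2"] Hq by simp
qed

lemma (in hamiltonian) support_grad_scaleR:
  assumes "k \<ge> 0" "t > 0"
  shows "support_grad H k (t *\<^sub>R y) = support_grad H k y"
  using assms by (simp add: support_grad_def support_scaleR)

context cone_subsolution begin

text \<open>
  The levels of cones with vertex at the origin that bound \<open>u\<close> from above near the origin.
\<close>

definition dominated :: "real \<Rightarrow> bool" where
  "dominated k \<longleftrightarrow> k > 0 \<and> (\<exists>r>0. cball 0 r \<subseteq> \<Omega> \<and> (\<forall>x\<in>cball 0 r. u x \<le> u 0 + C k x))"

lemma dominated_mono: "dominated k \<Longrightarrow> k \<le> k' \<Longrightarrow> dominated k'"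
proof -
  assume d: "dominated k" and k: "k \<le> k'"
  obtain r where r: "k > 0" "r > 0" "cball 0 r \<subseteq> \<Omega>" "\<And>x. x \<in> cball 0 r \<Longrightarrow> u x \<le> u 0 + C k x"
    using d unfolding dominated_def by blast
  have "u x \<le> u 0 + C k' x" if "x \<in> cball 0 r" for x
    using r(4)[OF that] support_mono[of k k' x] r(1) k by simp
  then show "dominated k'" using r k unfolding dominated_def by auto
qed

lemma dominated_ex:
  assumes "0 \<in> \<Omega>" shows "\<exists>k. dominated k"
proof -
  obtain r where r: "r > 0" "cball 0 r \<subseteq> \<Omega>" using \<Omega> assms open_contains_cball by blast
  have "compact (u ` cball 0 r)"
    by (intro compact_continuous_image continuous_on_subset[OF u_cont r(2)]) auto
  then have "bounded (u ` cball 0 r)" by (rule compact_imp_bounded)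
  then obtain M where M: "\<And>x. x \<in> cball 0 r \<Longrightarrow> \<bar>u x\<bar> \<le> M"
    unfolding bounded_iff by (metis imageI real_norm_def)
  obtain k where k: "k > 0" "\<And>y. C k y \<ge> (2 * M / r) * norm y" using support_large by metis
  have "u x \<le> u 0 + C k (x - 0)" if "x \<in> cball 0 r" for x
  proof (rule compare_cone_ball[OF r(2) k(1) _ _ that])
    fix y :: 'a assume y: "y \<in> sphere 0 r"
    have "2 * M \<le> C k y" using k(2)[of y] y r by simp
    moreover have "\<bar>u y\<bar> \<le> M" "\<bar>u 0\<bar> \<le> M" using M[of y] M[of 0] y r by auto
    ultimately show "u y \<le> u 0 + C k (y - 0)" by simp
  qed auto
  then have "dominated k" using k(1) r unfolding dominated_def by auto
  then show ?thesis ..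
qed

text \<open>
  A bound by a cone at the origin with level below \<open>k\<close> is, on a sphere of fixed radius, still a bound by a
  cone of level \<open>k\<close> after a small displacement of the vertex, and comparison extends it into the ball.
\<close>

lemma dominated_local_increment:
  assumes dom: "dominated k'" and k: "k' < k"
  obtains r where "r > 0" "cball 0 r \<subseteq> \<Omega>" "\<And>x y. x \<in> cball 0 r \<Longrightarrow> y \<in> cball 0 r \<Longrightarrow> u y \<le> u x + C k (y - x)"
proof -
  obtain s where s: "s > 0" "cball 0 s \<subseteq> \<Omega>" "\<And>x. x \<in> cball 0 s \<Longrightarrow> u x \<le> u 0 + C k' x" and k'0: "k' > 0"
    using dom unfolding dominated_def by blast
  obtain c where c: "c > 0" "\<And>y. C k y \<ge> C k' y + c * norm y" using support_strict_mono[of k' k] k k'0 by auto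
  have "isCont (\<lambda>x. u 0 - u x + C k' x) 0"
  proof -
    have "0 \<in> \<Omega>" using s(1,2) by auto
    then have "isCont u 0" using u_cont \<Omega> by (simp add: continuous_on_eq_continuous_at)
    moreover have "isCont (C k') 0" using continuous_support[of k' UNIV] k'0 by (simp add: continuous_on_eq_continuous_at)
    ultimately show ?thesis by (intro continuous_intros)
  qed
  then obtain d where d: "d > 0" "\<And>x. dist x 0 < d \<Longrightarrow> \<bar>u 0 - u x + C k' x\<bar> < c * (s / 2)"
    unfolding continuous_at_eps_delta using c s support_zero[of k'] k'0
    by (auto simp: dist_real_def dest!: spec[of _ "c * (s / 2)"])
  define r where "r = min (d / 2) (s / 2)"
  have r: "r > 0" "r < d" "r \<le> s / 2" using d s by (auto simp: r_def)
  show ?thesis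
  proof (rule that[OF r(1)])
    have rs: "cball (0::'a) r \<subseteq> cball 0 s" using r s by (simp add: subset_cball)
    then show "cball 0 r \<subseteq> \<Omega>" using s by blast
    fix x y :: 'a assume x: "x \<in> cball 0 r" and y: "y \<in> cball 0 r"
    show "u y \<le> u x + C k (y - x)"
    proof (rule compare_cone_ball[OF s(2)])
      show "y \<in> cball 0 s" using y rs by blast
      fix z :: 'a assume z: "z \<in> sphere 0 s"
      have "u z \<le> u 0 + C k' z" using s(3) z by simp
      also have "C k' z \<le> C k' (z - x) + C k' x" using support_add[of k' "z - x" x] k'0 by simp
      finally have a: "u z \<le> u 0 + (C k' (z - x) + C k' x)" by simp
      have "norm (z - x) \<ge> s / 2" using z x r norm_triangle_ineq2[of z x] by simp
      then have "c * norm (z - x) \<ge> c * (s / 2)" using c by (intro mult_left_mono) auto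
      moreover have "\<bar>u 0 - u x + C k' x\<bar> < c * (s / 2)" using d(2)[of x] x r by simp
      ultimately show "u z \<le> u x + C k (z - x)" using a c(2)[of "z - x"] by linarith
    qed (use k k'0 in auto)
  qed
qed

lemma not_dominated_steep:
  assumes "\<not> dominated k" "k > 0" "r > 0" "cball 0 r \<subseteq> \<Omega>"
  obtains y where "y \<in> sphere 0 r" "u y > u 0 + C k y"
proof -
  have "\<exists>y\<in>sphere 0 r. u y > u 0 + C k y"
  proof (rule ccontr)
    assume "\<not> ?thesis"
    then have "u y \<le> u 0 + C k (y - 0)" if "y \<in> sphere 0 r" for y using that by force
    then have "u y \<le> u 0 + C k (y - 0)" if "y \<in> cball 0 r" for y
      using compare_cone_ball[OF assms(4,2) _ _ that, of "u 0" 0] by auto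
    then show False using assms unfolding dominated_def by auto
  qed
  then show ?thesis using that by blast
qed

end

text \<open>
  Let \<open>k0\<close> be the infimum of the levels dominating \<open>u\<close>. By \<open>dominated_local_increment\<close> the same infimum
  belongs to \<open>-u\<close>. For levels slightly above \<open>k0\<close> the increments of \<open>u\<close> near \<open>0\<close> are bounded by the cone; for
  levels slightly below, the bound fails on every small sphere. So on a sphere of radius \<open>T * r\<close> there are
  points \<open>y\<close> and \<open>-z\<close> at which \<open>u\<close> rises, respectively falls, almost as much as the cone of level \<open>k0\<close>
  allows. Comparing \<open>u x\<close> with these two values, for \<open>\<bar>x\<bar> \<le> r\<close>, bounds \<open>u\<close> from below and from above by linear
  functions with slopes \<open>D C k0 y\<close> and \<open>D C k0 z\<close>, up to an error of order \<open>\<kappa> * r\<close>; here \<open>T\<close> is large, so that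
  the gradient of \<open>C k0\<close> hardly varies over distance \<open>r\<close>. Both functions being linear, the two bounds are
  close to each other on the ball of radius \<open>r\<close>. Approximate slopes at ever better accuracy accumulate in the
  compact set \<open>{H \<le> k0}\<close>.
\<close>

lemma blowup_slopes_nonempty:
  fixes u :: "'a::euclidean_space \<Rightarrow> real"
  assumes ham: "hamiltonian H" and \<Omega>: "open \<Omega>" "0 \<in> \<Omega>" and cc: "cone_comparison H \<Omega> u"
    "cone_comparison (\<lambda>p. H (- p)) \<Omega> (\<lambda>x. - u x)"
  shows "blowup_slopes u 0 \<noteq> {}"
proof -
  interpret hamiltonian H by (rule ham)
  interpret up: cone_subsolution H \<Omega> u by unfold_locales (use \<Omega> cc in auto)
  interpret dn: cone_subsolution "\<lambda>p. H (- p)" \<Omega> "\<lambda>x. - u x"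
    by (intro cone_subsolution.intro hamiltonian_reflect cone_subsolution_axioms.intro \<Omega> cc)
  have up_dn: "dn.dominated k" if dom: "up.dominated k'" "k' < k" for k k'
  proof -
    obtain r where r: "r > 0" "cball 0 r \<subseteq> \<Omega>" "\<And>x y. x \<in> cball 0 r \<Longrightarrow> y \<in> cball 0 r \<Longrightarrow> u y \<le> u x + C k (y - x)"
      using up.dominated_local_increment[OF dom] by blast
    have "- u x \<le> - u 0 + C k (- x)" if "x \<in> cball 0 r" for x using r(3)[of x 0] that r(1) by simp
    then show ?thesis using r dom unfolding dn.dominated_def up.dominated_def support_reflect
      by (intro conjI exI[of _ r]) auto
  qed
  have dn_up: "up.dominated k" if dom: "dn.dominated k'" "k' < k" for k k'
  proof -
    obtain r where r: "r > 0" "cball 0 r \<subseteq> \<Omega>"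
      "\<And>x y. x \<in> cball 0 r \<Longrightarrow> y \<in> cball 0 r \<Longrightarrow> - u y \<le> - u x + support (\<lambda>p. H (- p)) k (y - x)"
      using dn.dominated_local_increment[OF dom] by blast
    have "u x \<le> u 0 + C k x" if "x \<in> cball 0 r" for x using r(3)[of x 0] that r(1) by (simp add: support_reflect)
    then show ?thesis using r dom unfolding dn.dominated_def up.dominated_def
      by (intro conjI exI[of _ r]) auto
  qed
  define k0 where "k0 = Inf {k. up.dominated k}"
  have ne: "{k. up.dominated k} \<noteq> {}" using up.dominated_ex \<Omega> by auto
  have bb: "bdd_below {k. up.dominated k}" by (rule bdd_belowI[of _ 0]) (auto simp: up.dominated_def)
  have k0: "k0 \<ge> 0" unfolding k0_def by (rule cInf_greatest[OF ne]) (auto simp: up.dominated_def)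
  have big: "up.dominated k" if "k > k0" for k
  proof -
    obtain k' where "up.dominated k'" "k' < k" using cInf_lessD[OF ne] \<open>k > k0\<close> unfolding k0_def by blast
    then show ?thesis using up.dominated_mono by fastforce
  qed
  have smallu: "\<not> up.dominated k" if "k < k0" for k
  proof
    assume "up.dominated k"
    then have "k0 \<le> k" unfolding k0_def by (intro cInf_lower bb) auto
    then show False using that by simp
  qed
  have smalld: "\<not> dn.dominated k" if "k < k0" for k
    using dn_up[of k "(k + k0) / 2"] smallu[of "(k + k0) / 2"] that by auto
  have inc: "\<exists>r>0. cball 0 r \<subseteq> \<Omega> \<and> (\<forall>x\<in>cball 0 r. \<forall>y\<in>cball 0 r. u y \<le> u x + C k (y - x))" if "k > k0" for k
  proof -
    have d: "up.dominated ((k + k0) / 2)" "(k + k0) / 2 < k" using that by (auto intro: big)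
    obtain r where "r > 0" "cball 0 r \<subseteq> \<Omega>" "\<And>x y. x \<in> cball 0 r \<Longrightarrow> y \<in> cball 0 r \<Longrightarrow> u y \<le> u x + C k (y - x)"
      using up.dominated_local_increment[OF d] by blast
    then show ?thesis by blast
  qed
  have approx: "\<exists>p. H p \<le> k0 \<and> (\<exists>r. 0 < r \<and> r < \<kappa> \<and> (\<forall>y\<in>ball 0 1. \<bar>(u (r *\<^sub>R y) - u 0) / r - p \<bullet> y\<bar> \<le> \<kappa>))"
    if \<kappa>: "\<kappa> > 0" for \<kappa>
  proof -
    have conclude: "\<exists>r. 0 < r \<and> r < \<kappa> \<and> (\<forall>y\<in>ball 0 1. \<bar>(u (r *\<^sub>R y) - u 0) / r - p \<bullet> y\<bar> \<le> \<kappa>)"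
      if r: "0 < r" "r < \<kappa>" "\<And>x. norm x \<le> r \<Longrightarrow> \<bar>u x - u 0 - p \<bullet> x\<bar> \<le> \<kappa> * r" for r p
    proof (intro exI conjI ballI)
      fix y :: 'a assume "y \<in> ball 0 1"
      then have "\<bar>u (r *\<^sub>R y) - u 0 - p \<bullet> (r *\<^sub>R y)\<bar> \<le> \<kappa> * r" using r by (intro r(3)) simp
      moreover have "(u (r *\<^sub>R y) - u 0) / r - p \<bullet> y = (u (r *\<^sub>R y) - u 0 - p \<bullet> (r *\<^sub>R y)) / r"
        using r by (simp add: diff_divide_distrib)
      ultimately show "\<bar>(u (r *\<^sub>R y) - u 0) / r - p \<bullet> y\<bar> \<le> \<kappa>" using r by (simp add: pos_divide_le_eq)
    qed (use r in auto)
    show ?thesis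
    proof (cases "k0 = 0")
      case True
      obtain k where k: "k > 0" "\<And>y. C k y \<le> \<kappa> * norm y" using support_small[OF \<kappa>] by blast
      obtain r1 where r1: "r1 > 0" "\<And>x y. x \<in> cball 0 r1 \<Longrightarrow> y \<in> cball 0 r1 \<Longrightarrow> u y \<le> u x + C k (y - x)"
        using inc[of k] k True by blast
      define r where "r = min r1 (\<kappa> / 2)"
      have r: "0 < r" "r < \<kappa>" "r \<le> r1" using r1 \<kappa> by (auto simp: r_def)
      have "\<bar>u x - u 0 - 0 \<bullet> x\<bar> \<le> \<kappa> * r" if x: "norm x \<le> r" for x
      proof -
        have "u x \<le> u 0 + C k x" "u 0 \<le> u x + C k (- x)" using r1(2)[of 0 x] r1(2)[of x 0] x r by auto
        moreover have "C k x \<le> \<kappa> * norm x" "C k (- x) \<le> \<kappa> * norm x" using k(2)[of x] k(2)[of "- x"] by auto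
        moreover have "\<kappa> * norm x \<le> \<kappa> * r" using x \<kappa> by (intro mult_left_mono) auto
        ultimately show ?thesis by (auto simp: abs_le_iff)
      qed
      from conclude[OF r(1,2) this] show ?thesis using H_0 k0 by (intro exI[of _ 0]) auto
    next
      case False
      then have k0p: "k0 > 0" using k0 by simp
      define \<kappa>1 where "\<kappa>1 = \<kappa> / 6"
      have \<kappa>1: "\<kappa>1 > 0" using \<kappa> by (simp add: \<kappa>1_def)
      obtain R where R: "R > 0" "\<And>p. H p \<le> k0 \<Longrightarrow> norm p \<le> R" using sublevel_bound by metis
      let ?G = "support_grad H k0"
      have GH: "H (?G y) \<le> k0" "?G y \<bullet> y = C k0 y" for y using support_grad[OF k0] by auto
      obtain d where d: "d > 0" "d \<le> 1/2" "\<And>y h. norm y = 1 \<Longrightarrow> norm h \<le> d \<Longrightarrow> norm (?G (y + h) - ?G y) \<le> \<kappa>1"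
      proof -
        define N where "N = cball (0::'a) 2 - ball 0 (1/2)"
        have "compact N" unfolding N_def by (intro compact_diff) auto
        moreover have "continuous_on N ?G"
          by (rule continuous_on_subset[OF continuous_support_grad[OF k0p]]) (auto simp: N_def)
        ultimately have "uniformly_continuous_on N ?G" by (intro compact_uniformly_continuous)
        then obtain d where d: "d > 0" "\<And>y z. y \<in> N \<Longrightarrow> z \<in> N \<Longrightarrow> dist z y < d \<Longrightarrow> dist (?G z) (?G y) < \<kappa>1"
          unfolding uniformly_continuous_on_def using \<kappa>1 by metis
        show ?thesis
        proof (rule that[of "min (d / 2) (1/2)"])
          fix y h :: 'a assume y: "norm y = 1" and h: "norm h \<le> min (d / 2) (1/2)"
          have "norm (y + h) \<le> 2" using norm_triangle_ineq[of y h] y h by simp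
          moreover have "norm (y + h) \<ge> 1/2" using norm_diff_ineq[of y h] y h by simp
          ultimately have "y + h \<in> N" "y \<in> N" using y by (simp_all add: N_def)
          moreover have "dist (y + h) y < d" using h d(1) by (simp add: dist_norm)
          ultimately have "dist (?G (y + h)) (?G y) < \<kappa>1" by (intro d(2))
          then show "norm (?G (y + h) - ?G y) \<le> \<kappa>1" by (simp add: dist_norm)
        qed (use d in auto)
      qed
      \<comment> \<open>A displacement by \<open>r\<close> at distance \<open>T * r\<close> is one by \<open>d\<close> at distance \<open>1\<close>, by homogeneity.\<close>
      define T where "T = 1 / d"
      have T: "T \<ge> 2" "T * d = 1" using d by (auto simp: T_def field_simps)
      \<comment> \<open>The error \<open>err\<close> of replacing the levels \<open>k0 - \<eta>\<close> and \<open>k0 + \<eta>\<close> by \<open>k0\<close>, at distances up to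
        \<open>2 * T * r\<close>, is at most \<open>\<kappa>1 * r\<close>.\<close>
      define \<eta> where "\<eta> = min (k0 / 2) (\<kappa>1 * k0 / (3 * R * T))"
      have \<eta>: "\<eta> > 0" "\<eta> < k0" "\<eta> / k0 * (R * (3 * T)) \<le> \<kappa>1"
      proof -
        show "\<eta> > 0" "\<eta> < k0" using k0p \<kappa>1 R T by (auto simp: \<eta>_def)
        have "\<eta> \<le> \<kappa>1 * k0 / (3 * R * T)" by (simp add: \<eta>_def)
        then show "\<eta> / k0 * (R * (3 * T)) \<le> \<kappa>1" using k0p R T by (simp add: field_simps)
      qed
      obtain r1 where r1: "r1 > 0" "cball 0 r1 \<subseteq> \<Omega>"
        "\<And>x y. x \<in> cball 0 r1 \<Longrightarrow> y \<in> cball 0 r1 \<Longrightarrow> u y \<le> u x + C (k0 + \<eta>) (y - x)"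
        using inc[of "k0 + \<eta>"] \<eta> by auto
      define r where "r = min (r1 / T) (\<kappa> / 2)"
      have r: "0 < r" "r < \<kappa>" "T * r \<le> r1" "r \<le> T * r"
      proof -
        show "0 < r" "r < \<kappa>" using r1 T \<kappa> by (auto simp: r_def)
        have "r \<le> r1 / T" by (simp add: r_def)
        then show "T * r \<le> r1" using T by (simp add: field_simps)
        show "r \<le> T * r" using T \<open>0 < r\<close> by (simp add: mult_le_cancel_right1)
      qed
      have TrO: "cball 0 (T * r) \<subseteq> \<Omega>" using r(3) r1(2) by (meson order_trans subset_cball)
      have Tr0: "T * r > 0" using T r by simp
      have err: "C k0 y - C (k0 - \<eta>) y + (C (k0 + \<eta>) z - C k0 z) \<le> \<kappa>1 * r"
        if y: "norm y = T * r" and z: "norm z \<le> 2 * (T * r)" for y z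
      proof -
        have "C (k0 - \<eta>) y \<ge> ((k0 - \<eta>) / k0) * C k0 y" using \<eta> k0p by (intro support_ratio) auto
        then have "C k0 y - C (k0 - \<eta>) y \<le> \<eta> / k0 * C k0 y" using k0p by (simp add: field_simps)
        also have "\<dots> \<le> \<eta> / k0 * (R * (T * r))"
          using support_le_norm[OF k0 R(2), of y] \<eta> k0p y by (intro mult_left_mono) auto
        finally have 1: "C k0 y - C (k0 - \<eta>) y \<le> \<eta> / k0 * (R * (T * r))" .
        have "C k0 z \<ge> (k0 / (k0 + \<eta>)) * C (k0 + \<eta>) z" using \<eta> k0p by (intro support_ratio) auto
        then have "C (k0 + \<eta>) z - C k0 z \<le> \<eta> / k0 * C k0 z" using k0p \<eta> by (simp add: field_simps)
        also have "\<dots> \<le> \<eta> / k0 * (R * (2 * (T * r)))"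
        proof (intro mult_left_mono)
          have "C k0 z \<le> R * norm z" by (rule support_le_norm[OF k0 R(2)])
          also have "\<dots> \<le> R * (2 * (T * r))" using z R by (intro mult_left_mono) auto
          finally show "C k0 z \<le> R * (2 * (T * r))" .
        qed (use \<eta> k0p in auto)
        finally have 2: "C (k0 + \<eta>) z - C k0 z \<le> \<eta> / k0 * (R * (2 * (T * r)))" .
        have "\<eta> / k0 * (R * (T * r)) + \<eta> / k0 * (R * (2 * (T * r))) = \<eta> / k0 * (R * (3 * T)) * r"
          by (simp add: algebra_simps)
        also have "\<dots> \<le> \<kappa>1 * r" using \<eta> r by (intro mult_right_mono) auto
        finally show ?thesis using add_mono[OF 1 2] by (rule order_trans[rotated])
      qed
      have Gclose: "\<bar>(?G (y + x) - ?G y) \<bullet> x\<bar> \<le> \<kappa>1 * r" if y: "norm y = T * r" and x: "norm x \<le> r" for x y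
      proof -
        define s where "s = 1 / (T * r)"
        have s: "s > 0" "s * (T * r) = 1" using Tr0 by (auto simp: s_def)
        have "norm (s *\<^sub>R y) = 1" using y s by simp
        moreover have "norm (s *\<^sub>R x) \<le> d"
        proof -
          have "norm (s *\<^sub>R x) \<le> s * r" using x s by (simp add: mult_left_mono)
          also have "s * r = d" using T r d by (simp add: s_def T_def)
          finally show ?thesis .
        qed
        ultimately have "norm (?G (s *\<^sub>R y + s *\<^sub>R x) - ?G (s *\<^sub>R y)) \<le> \<kappa>1" by (rule d(3))
        then have g: "norm (?G (y + x) - ?G y) \<le> \<kappa>1"
          using support_grad_scaleR[OF k0 s(1), of "y + x"] support_grad_scaleR[OF k0 s(1), of y]
          by (simp add: scaleR_add_right)
        have "norm (?G (y + x) - ?G y) * norm x \<le> \<kappa>1 * r"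
          by (rule mult_mono[OF g x order_trans[OF norm_ge_zero g] norm_ge_zero])
        then show ?thesis using Cauchy_Schwarz_ineq2[of "?G (y + x) - ?G y" x] by linarith
      qed
      have rT: "r \<le> r1" using r by linarith
      have k0e: "k0 - \<eta> > 0" "k0 - \<eta> < k0" using \<eta> by auto
      obtain y where y: "norm y = T * r" "u y > u 0 + C (k0 - \<eta>) y"
        using up.not_dominated_steep[OF smallu[OF k0e(2)] k0e(1) Tr0 TrO] by auto
      obtain z' where z': "norm z' = T * r" "- u z' > - u 0 + C (k0 - \<eta>) (- z')"
        using dn.not_dominated_steep[OF smalld[OF k0e(2)] k0e(1) Tr0 TrO] by (auto simp: support_reflect)
      define z where "z = - z'"
      have z: "norm z = T * r" "u (- z) < u 0 - C (k0 - \<eta>) z" using z' by (auto simp: z_def)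
      have lower: "u x - u 0 \<ge> ?G y \<bullet> x - 2 * \<kappa>1 * r" if x: "norm x \<le> r" for x
      proof -
        have xy: "norm (y - x) \<le> 2 * (T * r)" using norm_triangle_ineq4[of y x] x y r by linarith
        have "x \<in> cball 0 r1" "y \<in> cball 0 r1" using order_trans[OF x rT] y r by auto
        then have "u y \<le> u x + C (k0 + \<eta>) (y - x)" by (rule r1(3))
        moreover have "C k0 y - C (k0 - \<eta>) y + (C (k0 + \<eta>) (y - x) - C k0 (y - x)) \<le> \<kappa>1 * r"
          using err y xy by blast
        moreover have "C k0 y \<ge> ?G (y - x) \<bullet> y" by (rule support_ge[OF GH(1)])
        moreover have "C k0 (y - x) = ?G (y - x) \<bullet> y - ?G (y - x) \<bullet> x"
          using GH(2)[of "y - x"] by (simp add: inner_diff_right)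
        moreover have "\<bar>(?G (y - x) - ?G y) \<bullet> (- x)\<bar> \<le> \<kappa>1 * r" using Gclose[of y "- x"] y x by simp
        then have "?G (y - x) \<bullet> x \<ge> ?G y \<bullet> x - \<kappa>1 * r" by (simp add: inner_diff_left abs_le_iff)
        ultimately show ?thesis using y(2) by linarith
      qed
      have upper: "u x - u 0 \<le> ?G z \<bullet> x + 2 * \<kappa>1 * r" if x: "norm x \<le> r" for x
      proof -
        have xz: "norm (z + x) \<le> 2 * (T * r)" using norm_triangle_ineq[of z x] x z r by linarith
        have "- z \<in> cball 0 r1" "x \<in> cball 0 r1" using order_trans[OF x rT] z r by auto
        then have "u x \<le> u (- z) + C (k0 + \<eta>) (x - - z)" by (rule r1(3))
        then have "u x \<le> u (- z) + C (k0 + \<eta>) (z + x)" by (simp add: add.commute)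
        moreover have "C k0 z - C (k0 - \<eta>) z + (C (k0 + \<eta>) (z + x) - C k0 (z + x)) \<le> \<kappa>1 * r"
          using err z xz by blast
        moreover have "C k0 z \<ge> ?G (z + x) \<bullet> z" by (rule support_ge[OF GH(1)])
        moreover have "C k0 (z + x) = ?G (z + x) \<bullet> z + ?G (z + x) \<bullet> x"
          using GH(2)[of "z + x"] by (simp add: inner_add_right)
        moreover have "\<bar>(?G (z + x) - ?G z) \<bullet> x\<bar> \<le> \<kappa>1 * r" using Gclose[of z x] z x by simp
        then have "?G (z + x) \<bullet> x \<le> ?G z \<bullet> x + \<kappa>1 * r" by (simp add: inner_diff_left abs_le_iff)
        ultimately show ?thesis using z(2) by linarith
      qed
      \<comment> \<open>Lower and upper bound at \<open>-x\<close> bound the difference of the two linear functions at \<open>x\<close>.\<close>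
      have gap: "(?G z - ?G y) \<bullet> x \<le> 4 * \<kappa>1 * r" if x: "norm x \<le> r" for x
      proof -
        have "?G y \<bullet> (- x) - 2 * \<kappa>1 * r \<le> ?G z \<bullet> (- x) + 2 * \<kappa>1 * r"
          using lower[of "- x"] upper[of "- x"] x by simp
        then show ?thesis by (simp add: inner_diff_left)
      qed
      have "\<bar>u x - u 0 - ?G y \<bullet> x\<bar> \<le> \<kappa> * r" if x: "norm x \<le> r" for x
      proof -
        have "u x - u 0 - ?G y \<bullet> x \<ge> - (2 * \<kappa>1 * r)" using lower[OF x] by simp
        moreover have "u x - u 0 - ?G y \<bullet> x \<le> 6 * \<kappa>1 * r"
          using upper[OF x] gap[OF x] by (simp add: inner_diff_left)
        moreover have "6 * \<kappa>1 * r = \<kappa> * r" "2 * \<kappa>1 * r \<le> \<kappa> * r" using \<kappa> r by (auto simp: \<kappa>1_def)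
        ultimately show ?thesis by (intro abs_leI) linarith+
      qed
      from conclude[OF r(1,2) this] show ?thesis using GH by blast
    qed
  qed
  define h where "h n = inverse (real (Suc n))" for n
  have h: "h n > 0" for n by (simp add: h_def)
  have hl: "h \<longlonglongrightarrow> 0" unfolding h_def by (rule LIMSEQ_inverse_real_of_nat)
  obtain p where p: "\<And>n. H (p n) \<le> k0"
    "\<And>n. \<exists>r. 0 < r \<and> r < h n \<and> (\<forall>y\<in>ball 0 1. \<bar>(u (r *\<^sub>R y) - u 0) / r - p n \<bullet> y\<bar> \<le> h n)"
    using approx[OF h] by metis
  obtain e s where es: "strict_mono s" "(p \<circ> s) \<longlonglongrightarrow> e"
    using compact_sublevel[of k0] p(1) unfolding compact_def by (metis (mono_tags, lifting) mem_Collect_eq)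
  have "e \<in> blowup_slopes u 0"
    unfolding blowup_slopes_iff
  proof (intro allI impI)
    fix \<kappa> :: real assume \<kappa>: "\<kappa> > 0"
    have "\<forall>\<^sub>F n in sequentially. dist ((p \<circ> s) n) e < \<kappa> / 2" by (rule tendstoD[OF es(2)]) (use \<kappa> in simp)
    moreover have "\<forall>\<^sub>F n in sequentially. (h \<circ> s) n < \<kappa> / 2"
      by (rule order_tendstoD(2)[OF LIMSEQ_subseq_LIMSEQ[OF hl es(1)]]) (use \<kappa> in simp)
    ultimately have "\<forall>\<^sub>F n in sequentially. dist ((p \<circ> s) n) e < \<kappa> / 2 \<and> (h \<circ> s) n < \<kappa> / 2" by (rule eventually_conj)
    then obtain n where n: "dist (p (s n)) e < \<kappa> / 2" "h (s n) < \<kappa> / 2"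
      using eventually_happens'[OF sequentially_bot] by auto
    obtain r where r: "0 < r" "r < h (s n)" "\<And>y. y \<in> ball 0 1 \<Longrightarrow> \<bar>(u (r *\<^sub>R y) - u 0) / r - p (s n) \<bullet> y\<bar> \<le> h (s n)"
      using p(2) by blast
    have "\<bar>(u (r *\<^sub>R y) - u 0) / r - e \<bullet> y\<bar> \<le> \<kappa>" if y: "y \<in> ball 0 1" for y
    proof -
      have "\<bar>(p (s n) - e) \<bullet> y\<bar> \<le> norm (p (s n) - e) * norm y" by (rule Cauchy_Schwarz_ineq2)
      also have "\<dots> \<le> norm (p (s n) - e) * 1" using y by (intro mult_left_mono) auto
      finally have "\<bar>p (s n) \<bullet> y - e \<bullet> y\<bar> \<le> \<kappa> / 2" using n by (simp add: dist_norm inner_diff_left)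
      then show ?thesis using r(3)[OF y] n(2) by linarith
    qed
    then show "\<exists>r. 0 < r \<and> r < \<kappa> \<and> (\<forall>y\<in>ball 0 1. \<bar>(u (r *\<^sub>R y) - u 0) / r - e \<bullet> y\<bar> \<le> \<kappa>)"
      using r n \<kappa> by (intro exI[of _ r]) auto
  qed
  then show ?thesis by blast
qed

lemma closed_blowup_slopes: "closed (blowup_slopes u (0::'a::euclidean_space))"
  unfolding closed_sequential_limits
proof (intro allI impI)
  fix p :: "nat \<Rightarrow> 'a" and e
  assume "(\<forall>n. p n \<in> blowup_slopes u 0) \<and> p \<longlonglongrightarrow> e"
  then have p: "\<And>n. p n \<in> blowup_slopes u 0" "p \<longlonglongrightarrow> e" by auto
  show "e \<in> blowup_slopes u 0"
    unfolding blowup_slopes_iff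
  proof (intro allI impI)
    fix \<kappa> :: real assume \<kappa>: "\<kappa> > 0"
    obtain n where n: "dist (p n) e < \<kappa> / 2"
      using eventually_happens'[OF sequentially_bot tendstoD[OF p(2), of "\<kappa> / 2"]] \<kappa> by auto
    obtain r where r: "0 < r" "r < \<kappa> / 2" "\<And>y. y \<in> ball 0 1 \<Longrightarrow> \<bar>(u (r *\<^sub>R y) - u 0) / r - p n \<bullet> y\<bar> \<le> \<kappa> / 2"
      using p(1)[of n] \<kappa> unfolding blowup_slopes_iff by (meson half_gt_zero)
    have "\<bar>(u (r *\<^sub>R y) - u 0) / r - e \<bullet> y\<bar> \<le> \<kappa>" if y: "y \<in> ball 0 1" for y
    proof -
      have "\<bar>(p n - e) \<bullet> y\<bar> \<le> norm (p n - e) * norm y" by (rule Cauchy_Schwarz_ineq2)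
      also have "\<dots> \<le> norm (p n - e) * 1" using y by (intro mult_left_mono) auto
      finally have "\<bar>p n \<bullet> y - e \<bullet> y\<bar> \<le> \<kappa> / 2" using n by (simp add: dist_norm inner_diff_left)
      then show ?thesis using r(3)[OF y] by linarith
    qed
    then show "\<exists>r. 0 < r \<and> r < \<kappa> \<and> (\<forall>y\<in>ball 0 1. \<bar>(u (r *\<^sub>R y) - u 0) / r - e \<bullet> y\<bar> \<le> \<kappa>)"
      using r \<kappa> by (intro exI[of _ r]) auto
  qed
qed

section \<open>Blow-up slopes of nearly affine minimizers\<close>

theorem theorem6p1:
  fixes H :: "real ^ 2 \<Rightarrow> real" and \<epsilon> :: real and e8 :: "real ^ 2"
  assumes "continuous_on UNIV H" and "convex_on UNIV H" and "superlinear H"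
    and "H 0 = 0" and "\<And>p. H p \<ge> 0"
    and "\<And>c. \<not> has_line_segment (H -` {c})"
    and "\<epsilon> > 0" and "e8 \<in> H -` {1..2}"
  shows "\<exists>\<delta>s > 0. \<forall>u \<in> AM H (ball 0 8). \<forall>\<delta>. 0 < \<delta> \<and> \<delta> < \<delta>s \<longrightarrow>
           e8 \<in> approx_slopes u 0 8 (\<delta> / 8) \<longrightarrow>
           (\<exists>m. is_arg_max (\<lambda>e. norm (e8 - e)) (\<lambda>e. e \<in> blowup_slopes u 0) m \<and>
                norm (e8 - m) \<le> \<epsilon>)"
proof -
  interpret hamiltonian H by unfold_locales (use assms in auto)
  have "e8 \<noteq> 0" using assms(8) H_0 by auto
  \<comment> \<open>The circle of radius \<open>\<epsilon>'\<close> about \<open>e8\<close> must not reach the origin.\<close>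
  define \<epsilon>' where "\<epsilon>' = min \<epsilon> (norm e8 / 2)"
  have \<epsilon>': "\<epsilon>' > 0" "\<epsilon>' \<le> \<epsilon>" "\<epsilon>' < norm e8" using \<open>e8 \<noteq> 0\<close> assms(7) by (auto simp: \<epsilon>'_def min_less_iff_disj)
  obtain \<delta>1 where \<delta>1: "\<delta>1 > 0" "\<delta>1 \<le> \<epsilon>'"
    "\<And>u \<delta> f x. cone_comparison H (ball 0 8) u \<Longrightarrow> 0 < \<delta> \<Longrightarrow> \<delta> \<le> \<delta>1 \<Longrightarrow>
       (\<And>x. x \<in> ball 0 8 \<Longrightarrow> \<bar>u x - u 0 - e8 \<bullet> x\<bar> \<le> \<delta>) \<Longrightarrow> norm (e8 - f) = \<epsilon>' \<Longrightarrow>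
       x \<in> ball 0 1 \<Longrightarrow> u x - u 0 - f \<bullet> x > 0 \<Longrightarrow>
       \<exists>y. connected_component {z \<in> ball 0 8. u z - u 0 - f \<bullet> z > 0} x y \<and> (e8 - f) \<bullet> y > \<delta>"
    using far_connection[OF hamiltonian_axioms \<epsilon>'(1,3)] by blast
  have ne: "\<epsilon>' < norm (- e8)" using \<epsilon>' by simp
  obtain \<delta>2 where \<delta>2: "\<delta>2 > 0" "\<delta>2 \<le> \<epsilon>'"
    "\<And>u \<delta> f x. cone_comparison (\<lambda>p. H (- p)) (ball 0 8) u \<Longrightarrow> 0 < \<delta> \<Longrightarrow> \<delta> \<le> \<delta>2 \<Longrightarrow>
       (\<And>x. x \<in> ball 0 8 \<Longrightarrow> \<bar>u x - u 0 - (- e8) \<bullet> x\<bar> \<le> \<delta>) \<Longrightarrow> norm (- e8 - f) = \<epsilon>' \<Longrightarrow>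
       x \<in> ball 0 1 \<Longrightarrow> u x - u 0 - f \<bullet> x > 0 \<Longrightarrow>
       \<exists>y. connected_component {z \<in> ball 0 8. u z - u 0 - f \<bullet> z > 0} x y \<and> (- e8 - f) \<bullet> y > \<delta>"
    using far_connection[OF hamiltonian_reflect \<epsilon>'(1) ne] by blast
  show ?thesis
  proof (intro exI[of _ "min \<delta>1 \<delta>2"] conjI ballI allI impI)
    show "min \<delta>1 \<delta>2 > 0" using \<delta>1 \<delta>2 by simp
    fix u \<delta>
    assume u: "u \<in> AM H (ball 0 8)" and \<delta>: "0 < \<delta> \<and> \<delta> < min \<delta>1 \<delta>2"
      and e8: "e8 \<in> approx_slopes u 0 8 (\<delta> / 8)"
    note cc = AM_imp_cone_comparison[OF open_ball u]
    have uc: "continuous_on (ball 0 8) u" using u by (simp add: AM_def)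
    have approx: "\<bar>u x - u 0 - e8 \<bullet> x\<bar> \<le> \<delta>" if x: "x \<in> ball 0 8" for x
    proof -
      have "ereal \<bar>u x - u 0 - e8 \<bullet> (x - 0)\<bar> \<le> (SUP x\<in>ball 0 8. ereal \<bar>u x - u 0 - e8 \<bullet> (x - 0)\<bar>)"
        using x by (rule SUP_upper)
      also have "\<dots> \<le> ereal (\<delta> / 8 * 8)" using e8 by (simp add: approx_slopes_def)
      finally show ?thesis by simp
    qed
    have near: "norm (e8 - b) \<le> \<epsilon>'" if b: "b \<in> blowup_slopes u 0" for b
    proof (rule slope_near_of_far_connection[OF uc \<epsilon>'(1) _ _ approx])
      show "0 < \<delta>" "\<delta> \<le> \<epsilon>'" using \<delta> \<delta>1 by auto
      show "\<exists>y. connected_component {z \<in> ball 0 8. u z - u 0 - f \<bullet> z > 0} x y \<and> (e8 - f) \<bullet> y > \<delta>"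
        if "norm (e8 - f) = \<epsilon>'" "x \<in> ball 0 1" "u x - u 0 - f \<bullet> x > 0" for f x
        using \<delta>1(3)[OF cc(1) _ _ approx that] \<delta> by simp
      show "\<exists>y. connected_component {z \<in> ball 0 8. u z - u 0 - f \<bullet> z < 0} x y \<and> (e8 - f) \<bullet> y < - \<delta>"
        if fx: "norm (e8 - f) = \<epsilon>'" "x \<in> ball 0 1" "u x - u 0 - f \<bullet> x < 0" for f x
      proof -
        have "\<exists>y. connected_component {z \<in> ball 0 8. - u z - - u 0 - (- f) \<bullet> z > 0} x y \<and> (- e8 - - f) \<bullet> y > \<delta>"
        proof (rule \<delta>2(3)[OF cc(2)])
          show "0 < \<delta>" "\<delta> \<le> \<delta>2" using \<delta> by auto
          show "\<bar>- u x - - u 0 - - e8 \<bullet> x\<bar> \<le> \<delta>" if "x \<in> ball 0 8" for x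
            using approx[OF that] by (simp add: abs_le_iff)
          show "norm (- e8 - - f) = \<epsilon>'" using fx(1) by (simp add: norm_minus_commute)
        qed (use fx in auto)
        moreover have "{z \<in> ball 0 8. - u z - - u 0 - (- f) \<bullet> z > 0} = {z \<in> ball 0 8. u z - u 0 - f \<bullet> z < 0}" by auto
        ultimately show ?thesis by (auto simp: inner_diff_left)
      qed
      show "\<exists>r. 0 < r \<and> r < \<kappa> \<and> (\<forall>y\<in>ball 0 1. \<bar>(u (r *\<^sub>R y) - u 0) / r - b \<bullet> y\<bar> \<le> \<kappa>)" if "\<kappa> > 0" for \<kappa>
        using b that unfolding blowup_slopes_iff by blast
    qed
    have "bounded (blowup_slopes u 0)"
      by (rule bounded_subset[of "cball e8 \<epsilon>'"]) (use near in \<open>auto simp: dist_norm\<close>)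
    then have compact: "compact (blowup_slopes u 0)" using closed_blowup_slopes by (simp add: compact_eq_bounded_closed)
    have nonempty: "blowup_slopes u 0 \<noteq> {}"
      by (rule blowup_slopes_nonempty[OF hamiltonian_axioms open_ball _ cc]) simp
    have "continuous_on (blowup_slopes u 0) (\<lambda>e. norm (e8 - e))" by (intro continuous_intros)
    from continuous_attains_sup[OF compact nonempty this]
    obtain m where m: "m \<in> blowup_slopes u 0" "\<And>e. e \<in> blowup_slopes u 0 \<Longrightarrow> norm (e8 - e) \<le> norm (e8 - m)"
      by (elim bexE) (rule that, auto)
    show "\<exists>m. is_arg_max (\<lambda>e. norm (e8 - e)) (\<lambda>e. e \<in> blowup_slopes u 0) m \<and> norm (e8 - m) \<le> \<epsilon>"
    proof (intro exI[of _ m] conjI)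
      show "is_arg_max (\<lambda>e. norm (e8 - e)) (\<lambda>e. e \<in> blowup_slopes u 0) m"
        using m by (auto simp: is_arg_max_def not_less)
      show "norm (e8 - m) \<le> \<epsilon>" using near[OF m(1)] \<epsilon>'(2) by simp
    qed
  qed
qed

end
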